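(* Let $k$ be a positive integer and let $S$ be the set of $k$-matchings in the complete graph $K_{2k}$. Then, as $S_{2k}$-modules, $$\mathbb{C}[S] \cong \bigoplus_{\lambda} S^\lambda,$$ where the direct sum is over all partitions $\lambda$ of $2k$ consisting of even parts. The multiplicity of each such $S^\lambda$ is $1$.
   Context: A matching in a graph is a set of pairwise disjoint edges; a $k$-matching is a matching consisting of $k$ edges (so a $k$-matching in $K_{2k}$ is a perfect matching). The symmetric group $S_{2k}$ acts on $S$ by permuting the vertices of $K_{2k}$, and $\mathbb{C}[S]$ is the resulting permutation module over $\mathbb{C}$. $S^\lambda$ denotes the Specht module over $\mathbb{C}$ (irreducible representation of $S_{2k}$) indexed by $\lambda \vdash 2k$. *)

theory Defs
  imports
    Complex_Main
    "HOL-Library.Function_Algebras"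
    "HOL-Library.FuncSet"
    "HOL-Algebra.Sym_Groups"
begin

section \<open>Complex vector spaces\<close>

text \<open>The complex counterpart of \<open>real_vector\<close>; functions into a complex vector space form one
  under the pointwise operations.\<close>

class complex_vector = ab_group_add +
  fixes scaleC :: "complex \<Rightarrow> 'a \<Rightarrow> 'a" (infixr \<open>*\<^sub>C\<close> 75)
  assumes scaleC_add_right: "a *\<^sub>C (x + y) = a *\<^sub>C x + a *\<^sub>C y"
    and scaleC_add_left: "(a + b) *\<^sub>C x = a *\<^sub>C x + b *\<^sub>C x"
    and scaleC_scaleC: "a *\<^sub>C b *\<^sub>C x = (a * b) *\<^sub>C x"
    and scaleC_one: "1 *\<^sub>C x = x"

global_interpretation complex_vector: vector_space "scaleC :: complex \<Rightarrow> 'a \<Rightarrow> 'a::complex_vector"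
  defines csubspace = complex_vector.subspace
    and cspan = complex_vector.span
  by unfold_locales (simp_all add: scaleC_add_right scaleC_add_left scaleC_scaleC scaleC_one)

instantiation complex :: complex_vector
begin
definition scaleC_complex :: "complex \<Rightarrow> complex \<Rightarrow> complex" where
  "scaleC_complex a x = a * x"
instance
  by standard (simp_all add: scaleC_complex_def algebra_simps)
end

instantiation "fun" :: (type, complex_vector) complex_vector
begin
definition scaleC_fun :: "complex \<Rightarrow> ('a \<Rightarrow> 'b) \<Rightarrow> 'a \<Rightarrow> 'b" where
  "scaleC_fun a f = (\<lambda>x. a *\<^sub>C f x)"
instance
  by standard (simp_all add: scaleC_fun_def fun_eq_iff scaleC_add_right scaleC_add_left
      scaleC_scaleC scaleC_one)
end

lemma sum_fun_apply: "(\<Sum>i\<in>A. f i) x = (\<Sum>i\<in>A. f i x)"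
  for f :: "'i \<Rightarrow> 'a \<Rightarrow> 'b::comm_monoid_add"
  by (induction A rule: infinite_finite_induct) simp_all


section \<open>Complex representations of a group\<close>

record ('g, 'v) crep =
  rep_space :: "'v set"
  rep_act :: "'g \<Rightarrow> 'v \<Rightarrow> 'v"

definition is_rep :: "('g, 'm) monoid_scheme \<Rightarrow> ('g, 'v::complex_vector) crep \<Rightarrow> bool" where
  "is_rep G M \<longleftrightarrow> group G \<and> csubspace (rep_space M) \<and>
    (\<forall>g\<in>carrier G. \<forall>v\<in>rep_space M. rep_act M g v \<in> rep_space M) \<and>
    (\<forall>g\<in>carrier G. \<forall>u\<in>rep_space M. \<forall>v\<in>rep_space M.
      rep_act M g (u + v) = rep_act M g u + rep_act M g v) \<and>
    (\<forall>g\<in>carrier G. \<forall>c. \<forall>v\<in>rep_space M. rep_act M g (c *\<^sub>C v) = c *\<^sub>C rep_act M g v) \<and>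
    (\<forall>v\<in>rep_space M. rep_act M \<one>\<^bsub>G\<^esub> v = v) \<and>
    (\<forall>g\<in>carrier G. \<forall>h\<in>carrier G. \<forall>v\<in>rep_space M.
      rep_act M (g \<otimes>\<^bsub>G\<^esub> h) v = rep_act M g (rep_act M h v))"

definition rep_iso :: "('g, 'm) monoid_scheme \<Rightarrow> ('g, 'v::complex_vector) crep \<Rightarrow>
    ('g, 'w::complex_vector) crep \<Rightarrow> bool" where
  "rep_iso G M N \<longleftrightarrow> (\<exists>\<phi>. bij_betw \<phi> (rep_space M) (rep_space N) \<and>
    (\<forall>u\<in>rep_space M. \<forall>v\<in>rep_space M. \<phi> (u + v) = \<phi> u + \<phi> v) \<and>
    (\<forall>c. \<forall>v\<in>rep_space M. \<phi> (c *\<^sub>C v) = c *\<^sub>C \<phi> v) \<and>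
    (\<forall>g\<in>carrier G. \<forall>v\<in>rep_space M. \<phi> (rep_act M g v) = rep_act N g (\<phi> v)))"

definition direct_sum :: "'i set \<Rightarrow> ('i \<Rightarrow> ('g, 'v::complex_vector) crep) \<Rightarrow>
    ('g, 'i \<Rightarrow> 'v) crep" where
  "direct_sum I M =
    \<lparr>rep_space = {f. (\<forall>i\<in>I. f i \<in> rep_space (M i)) \<and> (\<forall>i. i \<notin> I \<longrightarrow> f i = 0) \<and>
                    finite {i. f i \<noteq> 0}},
     rep_act = (\<lambda>g f i. if i \<in> I then rep_act (M i) g (f i) else 0)\<rparr>"

definition subrep :: "('g, 'm) monoid_scheme \<Rightarrow> ('g, 'v::complex_vector) crep \<Rightarrow> 'v set \<Rightarrow> bool" where
  "subrep G M U \<longleftrightarrow> csubspace U \<and> U \<subseteq> rep_space M \<and>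
    (\<forall>g\<in>carrier G. \<forall>u\<in>U. rep_act M g u \<in> U)"

definition irreducible_rep :: "('g, 'm) monoid_scheme \<Rightarrow> ('g, 'v::complex_vector) crep \<Rightarrow> bool" where
  "irreducible_rep G M \<longleftrightarrow> is_rep G M \<and> rep_space M \<noteq> {0} \<and>
    (\<forall>U. subrep G M U \<longrightarrow> U = {0} \<or> U = rep_space M)"

text \<open>An internal direct sum decomposition into irreducible subrepresentations. The summands are
  nonzero and independent, hence distinct, so a set of subspaces records them faithfully even when
  some are isomorphic.\<close>

definition irreducible_decomposition ::
    "('g, 'm) monoid_scheme \<Rightarrow> ('g, 'v::complex_vector) crep \<Rightarrow> 'v set set \<Rightarrow> bool" where
  "irreducible_decomposition G M D \<longleftrightarrow> finite D \<and>
    (\<forall>U\<in>D. subrep G M U \<and> irreducible_rep G (M\<lparr>rep_space := U\<rparr>)) \<and>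
    (\<forall>v\<in>rep_space M. \<exists>!f. f \<in> (\<Pi>\<^sub>E U\<in>D. U) \<and> v = (\<Sum>U\<in>D. f U))"

text \<open>The number of summands isomorphic to \<open>L\<close> in a decomposition of \<open>M\<close> into irreducibles. The
  definite description is meaningful exactly when a decomposition exists and this number does
  not depend on it, as is the case for complex representations of finite groups of finite
  dimension.\<close>

definition multiplicity :: "('g, 'm) monoid_scheme \<Rightarrow> ('g, 'v::complex_vector) crep \<Rightarrow>
    ('g, 'w::complex_vector) crep \<Rightarrow> nat" where
  "multiplicity G M L = (THE m. \<exists>D. irreducible_decomposition G M D \<and>
    m = card {U \<in> D. rep_iso G (M\<lparr>rep_space := U\<rparr>) L})"


section \<open>Permutation representations\<close>

definition basis_vec :: "'x \<Rightarrow> 'x \<Rightarrow> complex" where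
  "basis_vec x = (\<lambda>y. if y = x then 1 else 0)"

text \<open>The space with basis \<open>S\<close> (a finite set), consisting of the functions supported on \<open>S\<close>, with
  the action \<open>\<phi>\<close> of a group on \<open>S\<close> extended linearly.\<close>

definition perm_rep :: "'x set \<Rightarrow> ('g \<Rightarrow> 'x \<Rightarrow> 'x) \<Rightarrow> ('g, 'x \<Rightarrow> complex) crep" where
  "perm_rep S \<phi> =
    \<lparr>rep_space = {f. \<forall>x. x \<notin> S \<longrightarrow> f x = 0},
     rep_act = (\<lambda>g f. \<Sum>s\<in>S. f s *\<^sub>C basis_vec (\<phi> g s))\<rparr>"

lemma is_rep_perm_rep:
  assumes "group G" "finite S"
    and closed: "\<And>g s. g \<in> carrier G \<Longrightarrow> s \<in> S \<Longrightarrow> \<phi> g s \<in> S"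
    and one: "\<And>s. s \<in> S \<Longrightarrow> \<phi> \<one>\<^bsub>G\<^esub> s = s"
    and mult: "\<And>g h s. g \<in> carrier G \<Longrightarrow> h \<in> carrier G \<Longrightarrow> s \<in> S \<Longrightarrow>
      \<phi> (g \<otimes>\<^bsub>G\<^esub> h) s = \<phi> g (\<phi> h s)"
  shows "is_rep G (perm_rep S \<phi>)"
proof -
  have act: "rep_act (perm_rep S \<phi>) g f y = (\<Sum>s\<in>S. if \<phi> g s = y then f s else 0)" for g f y
    unfolding perm_rep_def
    by (auto simp: sum_fun_apply scaleC_fun_def scaleC_complex_def basis_vec_def intro!: sum.cong)
  have comp: "rep_act (perm_rep S \<phi>) (g \<otimes>\<^bsub>G\<^esub> h) v =
      rep_act (perm_rep S \<phi>) g (rep_act (perm_rep S \<phi>) h v)"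
    if g: "g \<in> carrier G" and h: "h \<in> carrier G" for g h v
  proof
    fix y
    have "rep_act (perm_rep S \<phi>) g (rep_act (perm_rep S \<phi>) h v) y =
        (\<Sum>s\<in>S. \<Sum>r\<in>S. if s = \<phi> h r then (if \<phi> g s = y then v r else 0) else 0)"
      unfolding act by (intro sum.cong refl) (auto intro!: sum.cong sum.neutral)
    also have "\<dots> = (\<Sum>r\<in>S. if \<phi> g (\<phi> h r) = y then v r else 0)"
      by (subst sum.swap) (auto simp: sum.delta' \<open>finite S\<close> closed h intro!: sum.cong)
    also have "\<dots> = rep_act (perm_rep S \<phi>) (g \<otimes>\<^bsub>G\<^esub> h) v y"
      unfolding act by (intro sum.cong refl) (simp add: mult g h)
    finally show "rep_act (perm_rep S \<phi>) (g \<otimes>\<^bsub>G\<^esub> h) v y =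
      rep_act (perm_rep S \<phi>) g (rep_act (perm_rep S \<phi>) h v) y" by simp
  qed
  have sp: "rep_space (perm_rep S \<phi>) = {f. \<forall>x. x \<notin> S \<longrightarrow> f x = 0}"
    by (simp add: perm_rep_def)
  have "csubspace (rep_space (perm_rep S \<phi>))"
    unfolding sp by (intro complex_vector.subspaceI) (auto simp: scaleC_fun_def scaleC_complex_def)
  moreover have "rep_act (perm_rep S \<phi>) g v \<in> rep_space (perm_rep S \<phi>)"
    if "g \<in> carrier G" for g v
    unfolding sp using that closed by (auto simp: act intro!: sum.neutral)
  moreover have "rep_act (perm_rep S \<phi>) g (u + v) =
      rep_act (perm_rep S \<phi>) g u + rep_act (perm_rep S \<phi>) g v" for g u v
    by (rule ext) (auto simp: act simp flip: sum.distrib intro!: sum.cong)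
  moreover have "rep_act (perm_rep S \<phi>) g (c *\<^sub>C v) = c *\<^sub>C rep_act (perm_rep S \<phi>) g v" for g c v
    by (rule ext)
      (auto simp: act scaleC_fun_def scaleC_complex_def sum_distrib_left intro!: sum.cong)
  moreover have "rep_act (perm_rep S \<phi>) \<one>\<^bsub>G\<^esub> v = v" if "v \<in> rep_space (perm_rep S \<phi>)" for v
  proof
    fix y
    have "rep_act (perm_rep S \<phi>) \<one>\<^bsub>G\<^esub> v y = (\<Sum>s\<in>S. if s = y then v s else 0)"
      unfolding act by (intro sum.cong refl) (simp add: one)
    then show "rep_act (perm_rep S \<phi>) \<one>\<^bsub>G\<^esub> v y = v y"
      using that by (simp add: sum.delta \<open>finite S\<close> sp)
  qed
  ultimately show ?thesis
    unfolding is_rep_def using \<open>group G\<close> comp by blast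
qed

lemma is_rep_subrep:
  assumes "is_rep G M" "subrep G M U"
  shows "is_rep G (M\<lparr>rep_space := U\<rparr>)"
  using assms unfolding is_rep_def subrep_def by (simp add: subset_iff)


section \<open>Specht modules\<close>

definition partitions_of :: "nat \<Rightarrow> nat list set" where
  "partitions_of n = {\<mu>. sorted_wrt (\<ge>) \<mu> \<and> 0 \<notin> set \<mu> \<and> sum_list \<mu> = n}"

definition diagram :: "nat list \<Rightarrow> (nat \<times> nat) set" where
  "diagram \<mu> = {(i, j). i < length \<mu> \<and> j < \<mu> ! i}"

text \<open>Only the values of a tableau on the cells of the diagram matter below; outside the diagram
  it is arbitrary.\<close>

definition tableau :: "nat list \<Rightarrow> (nat \<times> nat \<Rightarrow> nat) \<Rightarrow> bool" where
  "tableau \<mu> t \<longleftrightarrow> bij_betw t (diagram \<mu>) {1..sum_list \<mu>}"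

text \<open>Two tableaux are row equivalent iff corresponding rows have the same entries, so a tabloid,
  that is, a row equivalence class, is given by the list of the row sets.\<close>

definition tabloid :: "nat list \<Rightarrow> (nat \<times> nat \<Rightarrow> nat) \<Rightarrow> nat set list" where
  "tabloid \<mu> t = map (\<lambda>i. {t (i, j) | j. (i, j) \<in> diagram \<mu>}) [0..<length \<mu>]"

definition tabloids :: "nat list \<Rightarrow> nat set list set" where
  "tabloids \<mu> = {tabloid \<mu> t | t. tableau \<mu> t}"

definition tabloid_act :: "(nat \<Rightarrow> nat) \<Rightarrow> nat set list \<Rightarrow> nat set list" where
  "tabloid_act \<pi> = map ((`) \<pi>)"

definition column :: "nat list \<Rightarrow> (nat \<times> nat \<Rightarrow> nat) \<Rightarrow> nat \<Rightarrow> nat set" where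
  "column \<mu> t j = {t (i, j) | i. (i, j) \<in> diagram \<mu>}"

definition column_stabilizer :: "nat list \<Rightarrow> (nat \<times> nat \<Rightarrow> nat) \<Rightarrow> (nat \<Rightarrow> nat) set" where
  "column_stabilizer \<mu> t =
    {\<sigma>. \<sigma> permutes {1..sum_list \<mu>} \<and> (\<forall>j. \<sigma> ` column \<mu> t j = column \<mu> t j)}"

definition polytabloid :: "nat list \<Rightarrow> (nat \<times> nat \<Rightarrow> nat) \<Rightarrow> nat set list \<Rightarrow> complex" where
  "polytabloid \<mu> t =
    (\<Sum>\<sigma>\<in>column_stabilizer \<mu> t. of_int (sign \<sigma>) *\<^sub>C basis_vec (tabloid \<mu> (\<sigma> \<circ> t)))"

text \<open>The Specht module is the submodule of the permutation module on tabloids that is spanned by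
  the polytabloids.\<close>

definition specht :: "nat list \<Rightarrow> (nat \<Rightarrow> nat, nat set list \<Rightarrow> complex) crep" where
  "specht \<mu> =
    (perm_rep (tabloids \<mu>) tabloid_act)\<lparr>rep_space := cspan {polytabloid \<mu> t | t. tableau \<mu> t}\<rparr>"

lemma tabloid_act_tabloid: "tabloid_act \<pi> (tabloid \<mu> t) = tabloid \<mu> (\<pi> \<circ> t)"
  by (auto simp: tabloid_act_def tabloid_def)

lemma tableau_comp:
  assumes "\<pi> permutes {1..sum_list \<mu>}" "tableau \<mu> t"
  shows "tableau \<mu> (\<pi> \<circ> t)"
  using assms unfolding tableau_def by (metis bij_betw_trans permutes_imp_bij)

lemma tabloid_comp_in_tabloids:
  assumes "\<pi> permutes {1..sum_list \<mu>}" "tableau \<mu> t"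
  shows "tabloid \<mu> (\<pi> \<circ> t) \<in> tabloids \<mu>"
  using tableau_comp[OF assms] unfolding tabloids_def by blast

lemma finite_tabloids: "finite (tabloids \<mu>)"
proof (rule finite_subset)
  show "tabloids \<mu> \<subseteq> {xs. set xs \<subseteq> Pow {1..sum_list \<mu>} \<and> length xs = length \<mu>}"
    unfolding tabloids_def tabloid_def tableau_def bij_betw_def by fastforce
  show "finite {xs. set xs \<subseteq> Pow {1..sum_list \<mu>} \<and> length xs = length \<mu>}"
    by (intro finite_lists_length_eq) simp
qed

lemma is_rep_tabloids: "is_rep (sym_group (sum_list \<mu>)) (perm_rep (tabloids \<mu>) tabloid_act)"
proof (rule is_rep_perm_rep)
  fix g h s assume "g \<in> carrier (sym_group (sum_list \<mu>))" "s \<in> tabloids \<mu>"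
  then obtain t where "g permutes {1..sum_list \<mu>}" "tableau \<mu> t" "s = tabloid \<mu> t"
    by (auto simp: tabloids_def sym_group_def)
  then show "tabloid_act g s \<in> tabloids \<mu>"
    by (simp only: tabloid_act_tabloid tabloid_comp_in_tabloids)
qed (rule sym_group_is_group finite_tabloids | simp add: tabloid_act_def sym_group_def image_image)+

lemma column_stabilizer_comp:
  assumes \<pi>: "\<pi> permutes {1..sum_list \<mu>}"
  shows "bij_betw (\<lambda>\<sigma>. \<pi> \<circ> \<sigma> \<circ> inv_into UNIV \<pi>) (column_stabilizer \<mu> t) (column_stabilizer \<mu> (\<pi> \<circ> t))"
proof -
  have col: "column \<mu> (\<pi> \<circ> t) j = \<pi> ` column \<mu> t j" for \<pi> t j
    by (auto simp: column_def)
  have sub: "\<pi> \<circ> \<sigma> \<circ> inv_into UNIV \<pi> \<in> column_stabilizer \<mu> (\<pi> \<circ> t)"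
    if "\<sigma> \<in> column_stabilizer \<mu> t" "\<pi> permutes {1..sum_list \<mu>}" for \<sigma> \<pi> t
  proof -
    have "(\<pi> \<circ> \<sigma> \<circ> inv_into UNIV \<pi>) ` (\<pi> ` A) = \<pi> ` \<sigma> ` A" for A
      using permutes_inverses(2)[OF that(2)] by (simp add: image_image)
    with that show ?thesis
      by (auto simp: column_stabilizer_def col intro!: permutes_compose permutes_inv)
  qed
  note inv = permutes_inv[OF \<pi>] permutes_inv_inv[OF \<pi>] permutes_inv_o[OF \<pi>]
  have t: "inv_into UNIV \<pi> \<circ> (\<pi> \<circ> t) = t"
    by (simp add: inv flip: comp_assoc)
  show ?thesis
  proof (rule bij_betw_byWitness[where f' = "\<lambda>\<sigma>. inv_into UNIV \<pi> \<circ> \<sigma> \<circ> \<pi>"])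
    show "\<forall>\<sigma>\<in>column_stabilizer \<mu> t. inv_into UNIV \<pi> \<circ> (\<pi> \<circ> \<sigma> \<circ> inv_into UNIV \<pi>) \<circ> \<pi> = \<sigma>"
      using permutes_inverses[OF \<pi>] by (auto simp: fun_eq_iff)
    show "\<forall>\<sigma>\<in>column_stabilizer \<mu> (\<pi> \<circ> t). \<pi> \<circ> (inv_into UNIV \<pi> \<circ> \<sigma> \<circ> \<pi>) \<circ> inv_into UNIV \<pi> = \<sigma>"
      using permutes_inverses[OF \<pi>] by (auto simp: fun_eq_iff)
    show "(\<lambda>\<sigma>. \<pi> \<circ> \<sigma> \<circ> inv_into UNIV \<pi>) ` column_stabilizer \<mu> t \<subseteq> column_stabilizer \<mu> (\<pi> \<circ> t)"
      using sub[OF _ \<pi>] by blast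
    show "(\<lambda>\<sigma>. inv_into UNIV \<pi> \<circ> \<sigma> \<circ> \<pi>) ` column_stabilizer \<mu> (\<pi> \<circ> t) \<subseteq> column_stabilizer \<mu> t"
      using sub[of _ "\<pi> \<circ> t", OF _ inv(1)] t inv(2) by auto
  qed
qed

lemma rep_act_perm_rep_basis_vec:
  assumes "finite S" "s \<in> S"
  shows "rep_act (perm_rep S \<phi>) g (basis_vec s) = basis_vec (\<phi> g s)"
proof -
  have "rep_act (perm_rep S \<phi>) g (basis_vec s) =
      (\<Sum>r\<in>S. if r = s then basis_vec (\<phi> g r) else 0)"
    unfolding perm_rep_def crep.simps
    by (intro sum.cong refl)
      (simp add: basis_vec_def scaleC_fun_def scaleC_complex_def fun_eq_iff)
  then show ?thesis
    using assms by simp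
qed

lemma rep_act_perm_rep_linear:
  "rep_act (perm_rep S \<phi>) g (\<Sum>i\<in>I. c i *\<^sub>C f i) = (\<Sum>i\<in>I. c i *\<^sub>C rep_act (perm_rep S \<phi>) g (f i))"
  by (simp add: perm_rep_def sum_fun_apply fun_eq_iff scaleC_fun_def scaleC_complex_def
      sum_distrib_left sum_distrib_right sum.swap[of _ I] mult.assoc)

lemma rep_act_polytabloid:
  assumes \<pi>: "\<pi> permutes {1..sum_list \<mu>}" and t: "tableau \<mu> t"
  shows "rep_act (perm_rep (tabloids \<mu>) tabloid_act) \<pi> (polytabloid \<mu> t) = polytabloid \<mu> (\<pi> \<circ> t)"
proof -
  let ?C = "column_stabilizer \<mu>"
  have "rep_act (perm_rep (tabloids \<mu>) tabloid_act) \<pi> (polytabloid \<mu> t) =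
      (\<Sum>\<sigma>\<in>?C t. of_int (sign \<sigma>) *\<^sub>C basis_vec (tabloid \<mu> (\<pi> \<circ> \<sigma> \<circ> t)))"
    unfolding polytabloid_def rep_act_perm_rep_linear
  proof (intro sum.cong refl arg_cong2[where f = scaleC])
    fix \<sigma> assume "\<sigma> \<in> ?C t"
    then have "tabloid \<mu> (\<sigma> \<circ> t) \<in> tabloids \<mu>"
      using t by (intro tabloid_comp_in_tabloids) (auto simp: column_stabilizer_def)
    then show "rep_act (perm_rep (tabloids \<mu>) tabloid_act) \<pi> (basis_vec (tabloid \<mu> (\<sigma> \<circ> t))) =
        basis_vec (tabloid \<mu> (\<pi> \<circ> \<sigma> \<circ> t))"
      by (simp add: rep_act_perm_rep_basis_vec finite_tabloids tabloid_act_tabloid comp_assoc)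
  qed
  also have "\<dots> = (\<Sum>\<sigma>\<in>?C t. of_int (sign (\<pi> \<circ> \<sigma> \<circ> inv_into UNIV \<pi>)) *\<^sub>C
      basis_vec (tabloid \<mu> ((\<pi> \<circ> \<sigma> \<circ> inv_into UNIV \<pi>) \<circ> (\<pi> \<circ> t))))"
  proof (intro sum.cong refl arg_cong2[where f = scaleC])
    fix \<sigma> assume "\<sigma> \<in> ?C t"
    then have "permutation \<sigma>" "permutation \<pi>"
      using \<pi> by (auto simp: column_stabilizer_def permutation_permutes)
    then have "sign (\<pi> \<circ> \<sigma> \<circ> inv_into UNIV \<pi>) = sign \<pi> * sign \<sigma> * sign \<pi>"
      by (simp add: sign_compose sign_inverse permutation_compose permutation_inverse)
    then show "of_int (sign \<sigma>) = (of_int (sign (\<pi> \<circ> \<sigma> \<circ> inv_into UNIV \<pi>)) :: complex)"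
      by (simp add: sign_def split: if_splits)
    have "(\<pi> \<circ> \<sigma> \<circ> inv_into UNIV \<pi>) \<circ> (\<pi> \<circ> t) = \<pi> \<circ> \<sigma> \<circ> t"
      using permutes_inverses[OF \<pi>] by (auto simp: fun_eq_iff)
    then show "basis_vec (tabloid \<mu> (\<pi> \<circ> \<sigma> \<circ> t)) =
        basis_vec (tabloid \<mu> ((\<pi> \<circ> \<sigma> \<circ> inv_into UNIV \<pi>) \<circ> (\<pi> \<circ> t)))"
      by simp
  qed
  also have "\<dots> = polytabloid \<mu> (\<pi> \<circ> t)"
    unfolding polytabloid_def
    by (rule sum.reindex_bij_betw[OF column_stabilizer_comp[OF \<pi>],
          of "\<lambda>\<sigma>. of_int (sign \<sigma>) *\<^sub>C basis_vec (tabloid \<mu> (\<sigma> \<circ> (\<pi> \<circ> t)))"])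
  finally show ?thesis .
qed

lemma is_rep_specht: "is_rep (sym_group (sum_list \<mu>)) (specht \<mu>)"
  unfolding specht_def
proof (rule is_rep_subrep[OF is_rep_tabloids])
  let ?M = "perm_rep (tabloids \<mu>) tabloid_act :: (nat \<Rightarrow> nat, _) crep"
  let ?P = "{polytabloid \<mu> t | t. tableau \<mu> t}"
  let ?G = "sym_group (sum_list \<mu>)"
  have M: "is_rep ?G ?M" by (rule is_rep_tabloids)
  have sub: "cspan ?P \<subseteq> rep_space ?M"
  proof (rule complex_vector.span_minimal)
    show "csubspace (rep_space ?M)" using M by (simp add: is_rep_def)
    show "?P \<subseteq> rep_space ?M"
      using tabloid_comp_in_tabloids[of _ \<mu>]
      by (fastforce simp: polytabloid_def perm_rep_def sum_fun_apply scaleC_fun_def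
          scaleC_complex_def basis_vec_def column_stabilizer_def intro!: sum.neutral)
  qed
  have "rep_act ?M \<pi> u \<in> cspan ?P" if \<pi>: "\<pi> \<in> carrier ?G" and u: "u \<in> cspan ?P" for \<pi> u
    using u
  proof (induction rule: complex_vector.span_induct_alt)
    case base
    have "rep_act ?M \<pi> 0 = 0"
      by (simp add: perm_rep_def scaleC_fun_def scaleC_complex_def fun_eq_iff sum_fun_apply)
    then show ?case by (simp only: complex_vector.span_zero)
  next
    case (step c x y)
    then obtain t where x: "x = polytabloid \<mu> t" and t: "tableau \<mu> t" by auto
    have \<pi>': "\<pi> permutes {1..sum_list \<mu>}" using \<pi> by (simp add: sym_group_def)
    have lin: "rep_act ?M \<pi> (c *\<^sub>C x + y) = c *\<^sub>C rep_act ?M \<pi> x + rep_act ?M \<pi> y"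
      by (simp add: perm_rep_def scaleC_fun_def scaleC_complex_def fun_eq_iff sum_fun_apply
          algebra_simps sum.distrib sum_distrib_left)
    have "rep_act ?M \<pi> x \<in> cspan ?P"
      unfolding x rep_act_polytabloid[OF \<pi>' t]
      using tableau_comp[OF \<pi>' t] by (auto intro: complex_vector.span_base)
    then show ?case
      unfolding lin using step
      by (intro complex_vector.span_add complex_vector.span_scale) auto
  qed
  then show "subrep ?G ?M (cspan ?P)"
    unfolding subrep_def using sub complex_vector.subspace_span by blast
qed


section \<open>Matchings in complete graphs\<close>

definition complete_graph_edges :: "nat \<Rightarrow> nat set set" where
  "complete_graph_edges n = {e. e \<subseteq> {1..n} \<and> card e = 2}"

definition matchings :: "nat \<Rightarrow> 'a set set \<Rightarrow> 'a set set set" where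
  "matchings k E = {M. M \<subseteq> E \<and> pairwise disjnt M \<and> finite M \<and> card M = k}"

definition matching_act :: "(nat \<Rightarrow> nat) \<Rightarrow> nat set set \<Rightarrow> nat set set" where
  "matching_act \<pi> M = (\<lambda>e. \<pi> ` e) ` M"

lemma is_rep_matchings:
  "is_rep (sym_group n) (perm_rep (matchings k (complete_graph_edges n)) matching_act)"
proof (rule is_rep_perm_rep)
  show "finite (matchings k (complete_graph_edges n))"
    by (rule finite_subset[of _ "Pow (Pow {1..n})"])
      (auto simp: matchings_def complete_graph_edges_def)
next
  fix g M assume "g \<in> carrier (sym_group n)" and M: "M \<in> matchings k (complete_graph_edges n)"
  then have g: "g permutes {1..n}" by (simp add: sym_group_def)
  have inj: "inj g" using g by (rule permutes_inj)
  have "g ` e \<in> complete_graph_edges n" if "e \<in> complete_graph_edges n" for e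
    using that permutes_image[OF g] image_mono[of e "{1..n}" g]
    by (auto simp: complete_graph_edges_def card_image[OF inj_on_subset[OF inj]])
  moreover have "card (matching_act g M) = card M"
    unfolding matching_act_def using inj by (intro card_image) (auto simp: inj_on_def inj_image_eq_iff)
  ultimately show "matching_act g M \<in> matchings k (complete_graph_edges n)"
    using M unfolding matchings_def matching_act_def
    by (auto simp: pairwise_def disjnt_def inj_eq[OF inj]) blast+
qed (rule sym_group_is_group | simp add: sym_group_def matching_act_def image_comp comp_def)+

end

theory Submission
  imports Defs
begin

text \<open>Let \<open>V\<close> be the module spanned by the set \<open>S\<close> of perfect matchings, and call a partition of
  \<open>2k\<close> even if all its parts are.

  Each Specht module of even shape \<open>\<mu>\<close> maps nontrivially to \<open>V\<close>: send a tabloid to the sum of the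
  matchings all of whose edges lie inside its rows. The matching that pairs neighbours within the
  rows of a tableau \<open>t\<close> has a nonzero coefficient in the image of the polytabloid of \<open>t\<close>. Indeed this
  coefficient is a sum of signs of column permutations, and a permutation that contributes must move
  the two columns of each neighbouring pair in the same way, so that its sign is a square
  (\<open>sign_eq_1_if_in_rows\<close>). Specht modules are irreducible and pairwise nonisomorphic
  (\<open>irreducible_specht\<close>, \<open>specht_iso_imp_eq\<close>; the proofs follow James), hence these maps are
  injective and their images are independent (\<open>independent_images\<close>).

  That the images fill \<open>V\<close> is not proved by comparing dimensions of the modules but of their vectors
  fixed by the stabilizer \<open>H\<close> of one matching \<open>M\<^sub>0\<close>. The union of \<open>M\<^sub>0\<close> with another matching consists of
  cycles of even length in which the two matchings alternate. Writing the cycles, sorted by length,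
  into the rows of a tableau shows that the \<open>H\<close>-orbit of the second matching is determined by an even
  partition (\<open>matching_pair_tableau\<close>). So \<open>V\<close> has at most as many independent \<open>H\<close>-fixed vectors as
  there are even partitions. As \<open>S\<close> is a single orbit, every nonzero submodule of \<open>V\<close> contains a nonzero
  \<open>H\<close>-fixed vector (\<open>stab_fixed_vector\<close>); one from each image gives a basis of the \<open>H\<close>-fixed
  vectors. Thus the sum of the images contains the \<open>H\<close>-fixed vector \<open>M\<^sub>0\<close>, and \<open>M\<^sub>0\<close> generates \<open>V\<close>
  (\<open>distinct_summands_of_few_orbits\<close>).

  Multiplicity one is then a consequence of Schur's lemma for any direct sum of pairwise
  nonisomorphic irreducibles, whatever decomposition is used to count (\<open>multiplicity_summand\<close>).\<close>

section \<open>Homomorphisms and Schur's lemma\<close>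
definition rep_hom :: "('g, 'm) monoid_scheme \<Rightarrow> ('g, 'v::complex_vector) crep \<Rightarrow>
    ('g, 'w::complex_vector) crep \<Rightarrow> ('v \<Rightarrow> 'w) \<Rightarrow> bool" where
  "rep_hom G M N \<phi> \<longleftrightarrow> (\<forall>v\<in>rep_space M. \<phi> v \<in> rep_space N) \<and>
    (\<forall>u\<in>rep_space M. \<forall>v\<in>rep_space M. \<phi> (u + v) = \<phi> u + \<phi> v) \<and>
    (\<forall>c. \<forall>v\<in>rep_space M. \<phi> (c *\<^sub>C v) = c *\<^sub>C \<phi> v) \<and>
    (\<forall>g\<in>carrier G. \<forall>v\<in>rep_space M. \<phi> (rep_act M g v) = rep_act N g (\<phi> v))"

lemma rep_homI:
  assumes "\<And>v. v \<in> rep_space M \<Longrightarrow> \<phi> v \<in> rep_space N"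
    and "\<And>u v. u \<in> rep_space M \<Longrightarrow> v \<in> rep_space M \<Longrightarrow> \<phi> (u + v) = \<phi> u + \<phi> v"
    and "\<And>c v. v \<in> rep_space M \<Longrightarrow> \<phi> (c *\<^sub>C v) = c *\<^sub>C \<phi> v"
    and "\<And>g v. g \<in> carrier G \<Longrightarrow> v \<in> rep_space M \<Longrightarrow> \<phi> (rep_act M g v) = rep_act N g (\<phi> v)"
  shows "rep_hom G M N \<phi>"
  using assms by (simp add: rep_hom_def)

lemma rep_homD:
  assumes "rep_hom G M N \<phi>"
  shows "v \<in> rep_space M \<Longrightarrow> \<phi> v \<in> rep_space N"
    and "u \<in> rep_space M \<Longrightarrow> v \<in> rep_space M \<Longrightarrow> \<phi> (u + v) = \<phi> u + \<phi> v"
    and "v \<in> rep_space M \<Longrightarrow> \<phi> (c *\<^sub>C v) = c *\<^sub>C \<phi> v"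
    and "g \<in> carrier G \<Longrightarrow> v \<in> rep_space M \<Longrightarrow> \<phi> (rep_act M g v) = rep_act N g (\<phi> v)"
  using assms by (simp_all add: rep_hom_def)

lemma rep_iso_iff_bij_rep_hom:
  fixes M :: "('g, 'v::complex_vector) crep" and N :: "('g, 'w::complex_vector) crep"
  shows "rep_iso G M N \<longleftrightarrow> (\<exists>\<phi>. rep_hom G M N \<phi> \<and> bij_betw \<phi> (rep_space M) (rep_space N))"
  unfolding rep_iso_def
proof (rule ex_cong1)
  fix \<phi> :: "'v \<Rightarrow> 'w"
  have "\<forall>v\<in>rep_space M. \<phi> v \<in> rep_space N" if "bij_betw \<phi> (rep_space M) (rep_space N)"
    using that bij_betwE by blast
  then show "(bij_betw \<phi> (rep_space M) (rep_space N) \<and>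
      (\<forall>u\<in>rep_space M. \<forall>v\<in>rep_space M. \<phi> (u + v) = \<phi> u + \<phi> v) \<and>
      (\<forall>c. \<forall>v\<in>rep_space M. \<phi> (c *\<^sub>C v) = c *\<^sub>C \<phi> v) \<and>
      (\<forall>g\<in>carrier G. \<forall>v\<in>rep_space M. \<phi> (rep_act M g v) = rep_act N g (\<phi> v))) =
    (rep_hom G M N \<phi> \<and> bij_betw \<phi> (rep_space M) (rep_space N))"
    unfolding rep_hom_def by argo
qed

lemma is_repD:
  assumes "is_rep G M"
  shows "group G" "csubspace (rep_space M)"
    and "g \<in> carrier G \<Longrightarrow> v \<in> rep_space M \<Longrightarrow> rep_act M g v \<in> rep_space M"
    and "g \<in> carrier G \<Longrightarrow> u \<in> rep_space M \<Longrightarrow> v \<in> rep_space M \<Longrightarrow>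
      rep_act M g (u + v) = rep_act M g u + rep_act M g v"
    and "g \<in> carrier G \<Longrightarrow> v \<in> rep_space M \<Longrightarrow> rep_act M g (c *\<^sub>C v) = c *\<^sub>C rep_act M g v"
    and "v \<in> rep_space M \<Longrightarrow> rep_act M \<one>\<^bsub>G\<^esub> v = v"
    and "g \<in> carrier G \<Longrightarrow> h \<in> carrier G \<Longrightarrow> v \<in> rep_space M \<Longrightarrow>
      rep_act M (g \<otimes>\<^bsub>G\<^esub> h) v = rep_act M g (rep_act M h v)"
  using assms by (simp_all add: is_rep_def)

lemma irreducible_repD:
  assumes "irreducible_rep G M"
  shows "is_rep G M" "rep_space M \<noteq> {0}" "subrep G M U \<Longrightarrow> U = {0} \<or> U = rep_space M"
  using assms by (simp_all add: irreducible_rep_def)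

lemma is_rep_space:
  assumes "is_rep G M"
  shows "0 \<in> rep_space M"
    and "u \<in> rep_space M \<Longrightarrow> v \<in> rep_space M \<Longrightarrow> u + v \<in> rep_space M"
    and "u \<in> rep_space M \<Longrightarrow> v \<in> rep_space M \<Longrightarrow> u - v \<in> rep_space M"
    and "v \<in> rep_space M \<Longrightarrow> c *\<^sub>C v \<in> rep_space M"
    and "(\<And>i. i \<in> A \<Longrightarrow> f i \<in> rep_space M) \<Longrightarrow> (\<Sum>i\<in>A. f i) \<in> rep_space M"
  using is_repD(2)[OF assms]
  by (auto intro: complex_vector.subspace_0 complex_vector.subspace_add complex_vector.subspace_diff
      complex_vector.subspace_scale complex_vector.subspace_sum)

lemma rep_act_sum:
  assumes "is_rep G M" "g \<in> carrier G" "\<And>i. i \<in> A \<Longrightarrow> f i \<in> rep_space M"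
  shows "rep_act M g (\<Sum>i\<in>A. f i) = (\<Sum>i\<in>A. rep_act M g (f i))"
proof -
  have zero: "rep_act M g 0 = 0"
    using is_repD(5)[OF assms(1,2) is_rep_space(1)[OF assms(1)], of 0] by simp
  show ?thesis
    using assms(3)
  proof (induction A rule: infinite_finite_induct)
    case (insert x A)
    then show ?case
      using is_rep_space(5)[OF assms(1), of A f] by (simp add: is_repD(4)[OF assms(1,2)])
  qed (simp_all add: zero)
qed

lemma rep_hom_zero: "is_rep G M \<Longrightarrow> rep_hom G M N \<phi> \<Longrightarrow> \<phi> 0 = 0"
  using rep_homD(3)[of G M N \<phi> 0 0] is_rep_space(1) by (metis complex_vector.scale_zero_left)

lemma rep_hom_sum:
  assumes M: "is_rep G M" and \<phi>: "rep_hom G M N \<phi>" and f: "\<And>i. i \<in> A \<Longrightarrow> f i \<in> rep_space M"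
  shows "\<phi> (\<Sum>i\<in>A. f i) = (\<Sum>i\<in>A. \<phi> (f i))"
  using f
proof (induction A rule: infinite_finite_induct)
  case (insert x A)
  then show ?case
    using is_rep_space(5)[OF M, of A f] by (simp add: rep_homD(2)[OF \<phi>])
qed (simp_all add: rep_hom_zero[OF M \<phi>])

lemma rep_hom_diff:
  assumes M: "is_rep G M" and \<phi>: "rep_hom G M N \<phi>" and u: "u \<in> rep_space M" and v: "v \<in> rep_space M"
  shows "\<phi> (u - v) = \<phi> u - \<phi> v"
  using rep_homD(2)[OF \<phi> is_rep_space(3)[OF M u v] v] by simp

lemma rep_hom_minus:
  assumes "is_rep G M" "rep_hom G M N \<phi>" "v \<in> rep_space M"
  shows "\<phi> (- v) = - \<phi> v"
  using rep_homD(3)[OF assms(2,3), of "-1"] by simp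

lemma rep_hom_comp:
  assumes "rep_hom G M N \<phi>" "rep_hom G N P \<psi>"
  shows "rep_hom G M P (\<lambda>v. \<psi> (\<phi> v))"
  using assms by (simp add: rep_hom_def)

lemma rep_hom_restrict:
  assumes "rep_hom G M N \<phi>" "subrep G M U"
  shows "rep_hom G (M\<lparr>rep_space := U\<rparr>) N \<phi>"
  using assms by (auto simp: rep_hom_def subrep_def)

lemma subrep_kernel:
  assumes M: "is_rep G M" and N: "is_rep G N" and \<phi>: "rep_hom G M N \<phi>"
  shows "subrep G M {v \<in> rep_space M. \<phi> v = 0}"
proof -
  have "rep_act N g 0 = 0" if "g \<in> carrier G" for g
    using is_repD(5)[OF N that is_rep_space(1)[OF N], of 0] by simp
  then show ?thesis
    unfolding subrep_def
    by (auto intro!: complex_vector.subspaceI is_repD(3)[OF M]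
        simp: rep_homD[OF \<phi>] is_rep_space[OF M] rep_hom_zero[OF M \<phi>])
qed

lemma subrep_image:
  assumes M: "is_rep G M" and N: "is_rep G N" and \<phi>: "rep_hom G M N \<phi>"
  shows "subrep G N (\<phi> ` rep_space M)"
  unfolding subrep_def
proof (intro conjI ballI complex_vector.subspaceI)
  show "0 \<in> \<phi> ` rep_space M"
    using rep_hom_zero[OF M \<phi>] is_rep_space(1)[OF M] by force
next
  fix u v assume "u \<in> \<phi> ` rep_space M" "v \<in> \<phi> ` rep_space M"
  then show "u + v \<in> \<phi> ` rep_space M"
    by (auto simp flip: rep_homD(2)[OF \<phi>] intro!: imageI is_rep_space[OF M])
next
  fix c v assume "v \<in> \<phi> ` rep_space M"
  then show "c *\<^sub>C v \<in> \<phi> ` rep_space M"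
    by (auto simp flip: rep_homD(3)[OF \<phi>] intro!: imageI is_rep_space[OF M])
next
  fix g v assume "g \<in> carrier G" "v \<in> \<phi> ` rep_space M"
  then show "rep_act N g v \<in> \<phi> ` rep_space M"
    by (auto simp flip: rep_homD(4)[OF \<phi>] intro!: imageI is_repD(3)[OF M])
qed (use rep_homD(1)[OF \<phi>] in auto)

lemma rep_hom_inj_on:
  assumes M: "is_rep G M" and \<phi>: "rep_hom G M N \<phi>"
    and ker: "\<And>v. v \<in> rep_space M \<Longrightarrow> \<phi> v = 0 \<Longrightarrow> v = 0"
  shows "inj_on \<phi> (rep_space M)"
proof (rule inj_onI)
  fix u v assume uv: "u \<in> rep_space M" "v \<in> rep_space M" "\<phi> u = \<phi> v"
  then have "\<phi> (u - v) = 0" by (simp add: rep_hom_diff[OF M \<phi>])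
  then show "u = v" using ker[OF is_rep_space(3)[OF M uv(1,2)]] by simp
qed

lemma irreducible_hom_inj_on:
  assumes L: "irreducible_rep G L" and N: "is_rep G N" and \<phi>: "rep_hom G L N \<phi>"
    and nz: "\<exists>v\<in>rep_space L. \<phi> v \<noteq> 0"
  shows "inj_on \<phi> (rep_space L)"
proof (rule rep_hom_inj_on[OF irreducible_repD(1)[OF L] \<phi>])
  have "{v \<in> rep_space L. \<phi> v = 0} = {0}"
    using irreducible_repD(3)[OF L subrep_kernel[OF irreducible_repD(1)[OF L] N \<phi>]] nz by auto
  then show "v = 0" if "v \<in> rep_space L" "\<phi> v = 0" for v using that by blast
qed

lemma schur_zero:
  assumes L: "irreducible_rep G L" and N: "irreducible_rep G N" and \<phi>: "rep_hom G L N \<phi>"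
    and ni: "\<not> rep_iso G L N" and v: "v \<in> rep_space L"
  shows "\<phi> v = 0"
proof (rule ccontr)
  assume nz: "\<phi> v \<noteq> 0"
  have "inj_on \<phi> (rep_space L)"
    using irreducible_hom_inj_on[OF L irreducible_repD(1)[OF N] \<phi>] v nz by blast
  moreover have "\<phi> ` rep_space L = rep_space N"
    using irreducible_repD(3)[OF N subrep_image[OF irreducible_repD(1)[OF L] irreducible_repD(1)[OF N] \<phi>]]
      v nz by auto
  ultimately show False
    using ni \<phi> unfolding rep_iso_iff_bij_rep_hom bij_betw_def by blast
qed

lemma rep_hom_inv_into:
  assumes M: "is_rep G M" and \<phi>: "rep_hom G M N \<phi>" and bij: "bij_betw \<phi> (rep_space M) (rep_space N)"
  shows "rep_hom G N M (inv_into (rep_space M) \<phi>)"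
proof -
  let ?f = "inv_into (rep_space M) \<phi>"
  have into: "?f v \<in> rep_space M" "\<phi> (?f v) = v" if "v \<in> rep_space N" for v
    using that bij by (auto simp: bij_betw_def f_inv_into_f inv_into_into)
  have eq: "?f v = w" if "w \<in> rep_space M" "\<phi> w = v" for v w
    using that bij by (auto simp: bij_betw_def)
  show ?thesis
    by (rule rep_homI) (auto intro!: eq into is_rep_space[OF M] is_repD(3)[OF M]
      simp: rep_homD[OF \<phi>] into)
qed

lemma rep_iso_sym:
  assumes M: "is_rep G M" and iso: "rep_iso G M N"
  shows "rep_iso G N M"
proof -
  obtain \<phi> where \<phi>: "rep_hom G M N \<phi>" and bij: "bij_betw \<phi> (rep_space M) (rep_space N)"
    using iso unfolding rep_iso_iff_bij_rep_hom by blast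
  show ?thesis
    unfolding rep_iso_iff_bij_rep_hom
    using rep_hom_inv_into[OF M \<phi> bij] bij_betw_inv_into[OF bij] by blast
qed

lemma rep_iso_trans:
  assumes "rep_iso G M N" "rep_iso G N P"
  shows "rep_iso G M P"
proof -
  obtain \<phi> \<psi> where "rep_hom G M N \<phi>" "bij_betw \<phi> (rep_space M) (rep_space N)"
    "rep_hom G N P \<psi>" "bij_betw \<psi> (rep_space N) (rep_space P)"
    using assms unfolding rep_iso_iff_bij_rep_hom by blast
  then have "rep_hom G M P (\<lambda>v. \<psi> (\<phi> v))" "bij_betw (\<psi> \<circ> \<phi>) (rep_space M) (rep_space P)"
    by (blast intro: rep_hom_comp bij_betw_trans)+
  then show ?thesis unfolding rep_iso_iff_bij_rep_hom comp_def by blast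
qed

lemma irreducible_rep_iso:
  assumes iso: "rep_iso G L N" and L: "irreducible_rep G L" and N: "is_rep G N"
  shows "irreducible_rep G N"
proof -
  note rL = irreducible_repD(1)[OF L]
  obtain \<phi> where \<phi>: "rep_hom G L N \<phi>" and bij: "bij_betw \<phi> (rep_space L) (rep_space N)"
    using iso by (auto simp: rep_iso_iff_bij_rep_hom)
  obtain v where v: "v \<in> rep_space L" "v \<noteq> 0"
    using irreducible_repD(2)[OF L] is_rep_space(1)[OF rL] by blast
  have "\<phi> v \<noteq> 0"
    using v bij rep_hom_zero[OF rL \<phi>] is_rep_space(1)[OF rL] by (metis bij_betw_def inj_onD)
  then have "rep_space N \<noteq> {0}" using rep_homD(1)[OF \<phi> v(1)] by auto
  moreover have "U = {0} \<or> U = rep_space N" if U: "subrep G N U" for U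
  proof -
    let ?U = "{v \<in> rep_space L. \<phi> v \<in> U}"
    have sub: "csubspace U" "U \<subseteq> rep_space N" "\<And>g u. g \<in> carrier G \<Longrightarrow> u \<in> U \<Longrightarrow> rep_act N g u \<in> U"
      using U unfolding subrep_def by auto
    have "subrep G L ?U"
      unfolding subrep_def
    proof (intro conjI ballI complex_vector.subspaceI)
      show "0 \<in> ?U"
        using rep_hom_zero[OF rL \<phi>] is_rep_space(1)[OF rL] complex_vector.subspace_0[OF sub(1)] by simp
    next
      fix u v assume "u \<in> ?U" "v \<in> ?U"
      then show "u + v \<in> ?U"
        using complex_vector.subspace_add[OF sub(1)] is_rep_space(2)[OF rL] by (simp add: rep_homD(2)[OF \<phi>])
    next
      fix c v assume "v \<in> ?U"
      then show "c *\<^sub>C v \<in> ?U"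
        using complex_vector.subspace_scale[OF sub(1)] is_rep_space(4)[OF rL] by (simp add: rep_homD(3)[OF \<phi>])
    next
      fix g v assume "g \<in> carrier G" "v \<in> ?U"
      then show "rep_act L g v \<in> ?U"
        using sub(3) is_repD(3)[OF rL] by (simp add: rep_homD(4)[OF \<phi>])
    qed auto
    then consider "?U = {0}" | "?U = rep_space L" using irreducible_repD(3)[OF L, of ?U] by argo
    moreover have "U = \<phi> ` ?U"
    proof (intro equalityI subsetI)
      fix x assume x: "x \<in> U"
      then have "x \<in> \<phi> ` rep_space L" using sub(2) bij_betw_imp_surj_on[OF bij] by auto
      then show "x \<in> \<phi> ` ?U" using x by force
    qed auto
    ultimately show ?thesis
    proof cases
      case 1
      then show ?thesis using \<open>U = \<phi> ` ?U\<close> rep_hom_zero[OF rL \<phi>] by simp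
    next
      case 2
      then show ?thesis using \<open>U = \<phi> ` ?U\<close> bij unfolding bij_betw_def by simp
    qed
  qed
  ultimately show ?thesis using N unfolding irreducible_rep_def by blast
qed

section \<open>Sums of pairwise nonisomorphic irreducible representations\<close>
text \<open>A nonzero map of an irreducible representation is injective, so each \<open>L i\<close> occurs in \<open>M\<close>.\<close>
locale distinct_constituents =
  fixes G :: "('g, 'm) monoid_scheme" and M :: "('g, 'v::complex_vector) crep"
    and I :: "'i set" and L :: "'i \<Rightarrow> ('g, 'w::complex_vector) crep" and \<phi> :: "'i \<Rightarrow> 'w \<Rightarrow> 'v"
  assumes rep: "is_rep G M" and finite_index: "finite I"
    and irreducible: "i \<in> I \<Longrightarrow> irreducible_rep G (L i)"
    and not_iso: "i \<in> I \<Longrightarrow> j \<in> I \<Longrightarrow> i \<noteq> j \<Longrightarrow> \<not> rep_iso G (L i) (L j)"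
    and hom: "i \<in> I \<Longrightarrow> rep_hom G (L i) M (\<phi> i)"
    and nonzero: "i \<in> I \<Longrightarrow> \<exists>v\<in>rep_space (L i). \<phi> i v \<noteq> 0"
begin

lemmas is_rep_L = irreducible_repD(1)[OF irreducible]

lemma embedding_inj_on: "i \<in> I \<Longrightarrow> inj_on (\<phi> i) (rep_space (L i))"
  by (rule irreducible_hom_inj_on[OF irreducible rep hom nonzero])

text \<open>If the image of a new constituent \<open>L a\<close> met the sum of the earlier ones, then by irreducibility it
would lie inside that sum. Its coordinates there, unique by induction, would be homomorphisms to
constituents not isomorphic to \<open>L a\<close>, hence zero.\<close>
lemma independent_images:
  assumes "finite A" "A \<subseteq> I" "\<And>i. i \<in> A \<Longrightarrow> f i \<in> rep_space (L i)"
    "(\<Sum>i\<in>A. \<phi> i (f i)) = 0" "i \<in> A"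
  shows "f i = 0"
  using assms
proof (induction A arbitrary: f i rule: finite_induct)
  case (insert a A)
  have a: "a \<in> I" and A: "\<And>i. i \<in> A \<Longrightarrow> i \<in> I" using insert.prems(1) by auto
  note L = is_rep_space[OF is_rep_L] is_repD(3)[OF is_rep_L]
  have uniq: "g i = g' i"
    if "\<And>i. i \<in> A \<Longrightarrow> g i \<in> rep_space (L i)" "\<And>i. i \<in> A \<Longrightarrow> g' i \<in> rep_space (L i)"
      "(\<Sum>i\<in>A. \<phi> i (g i)) = (\<Sum>i\<in>A. \<phi> i (g' i))" "i \<in> A" for g g' i
  proof -
    have "g i - g' i = 0"
    proof (rule insert.IH)
      have "(\<Sum>i\<in>A. \<phi> i (g i - g' i)) = (\<Sum>i\<in>A. \<phi> i (g i) - \<phi> i (g' i))"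
        by (intro sum.cong refl rep_hom_diff[OF is_rep_L hom]) (auto simp: A that)
      then show "(\<Sum>i\<in>A. \<phi> i (g i - g' i)) = 0"
        using that(3) by (simp add: sum_subtractf)
    qed (use A that L in auto)
    then show ?thesis by simp
  qed
  \<comment> \<open>\<open>P v g\<close>: the image of \<open>v\<close> is the sum of the images of the family \<open>g\<close> from the earlier constituents.
    The vectors \<open>v\<close> for which such a \<open>g\<close> exists form a subrepresentation of \<open>L a\<close>.\<close>
  define P where "P v g \<longleftrightarrow> (\<forall>i\<in>A. g i \<in> rep_space (L i)) \<and> \<phi> a v = (\<Sum>i\<in>A. \<phi> i (g i))" for v g
  have P_zero: "P 0 (\<lambda>_. 0)"
    using A a L by (auto simp: P_def rep_hom_zero[OF is_rep_L hom])
  have P_add: "P (u + v) (\<lambda>i. g i + h i)" if "P u g" "P v h" "u \<in> rep_space (L a)" "v \<in> rep_space (L a)" for u v g h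
    using that A a L by (auto simp: P_def rep_homD(2)[OF hom] sum.distrib)
  have P_scale: "P (c *\<^sub>C v) (\<lambda>i. c *\<^sub>C g i)" if "P v g" "v \<in> rep_space (L a)" for v g c
    using that A a L by (auto simp: P_def rep_homD(3)[OF hom] complex_vector.scale_sum_right)
  have P_act: "P (rep_act (L a) x v) (\<lambda>i. rep_act (L i) x (g i))"
    if "P v g" "v \<in> rep_space (L a)" "x \<in> carrier G" for v g x
  proof -
    show ?thesis
      using that A a L insert.hyps
      by (auto simp: P_def rep_homD(4)[OF hom] rep_homD(1)[OF hom] rep_act_sum[OF rep])
  qed
  let ?U = "{v \<in> rep_space (L a). \<exists>g. P v g}"
  have "subrep G (L a) ?U"
    unfolding subrep_def
  proof (intro conjI ballI complex_vector.subspaceI)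
    show "0 \<in> ?U" using P_zero L(1)[OF a] by blast
  next
    fix u v assume "u \<in> ?U" "v \<in> ?U"
    then show "u + v \<in> ?U" using P_add L(2)[OF a] by blast
  next
    fix c v assume "v \<in> ?U"
    then show "c *\<^sub>C v \<in> ?U" using P_scale L(4)[OF a] by blast
  next
    fix g v assume "g \<in> carrier G" "v \<in> ?U"
    then show "rep_act (L a) g v \<in> ?U" using P_act L(6)[OF a] by blast
  qed blast
  then have "?U = {0} \<or> ?U = rep_space (L a)"
    using irreducible_repD(3)[OF irreducible[OF a]] by blast
  moreover have "?U \<noteq> rep_space (L a)"
  proof
    assume "?U = rep_space (L a)"
    then have "\<forall>v\<in>rep_space (L a). \<exists>g. P v g" by blast
    then obtain \<gamma> where \<gamma>: "\<And>v. v \<in> rep_space (L a) \<Longrightarrow> P v (\<gamma> v)" by metis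
    have \<gamma>_eq: "\<gamma> v i = g i" if "P v g" "v \<in> rep_space (L a)" "i \<in> A" for v g i
      using uniq[of "\<gamma> v" g i] \<gamma>[OF that(2)] that by (auto simp: P_def)
    have "\<gamma> v i = 0" if i: "i \<in> A" and v: "v \<in> rep_space (L a)" for i v
    proof (rule schur_zero[OF irreducible[OF a] irreducible[OF A[OF i]] _ _ v])
      show "rep_hom G (L a) (L i) (\<lambda>v. \<gamma> v i)"
      proof (rule rep_homI)
        show "\<gamma> v i \<in> rep_space (L i)" if "v \<in> rep_space (L a)" for v
          using \<gamma>[OF that] i by (simp add: P_def)
        show "\<gamma> (u + v) i = \<gamma> u i + \<gamma> v i" if "u \<in> rep_space (L a)" "v \<in> rep_space (L a)" for u v
          by (rule \<gamma>_eq[OF P_add[OF \<gamma>[OF that(1)] \<gamma>[OF that(2)] that] L(2)[OF a that] i])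
        show "\<gamma> (c *\<^sub>C v) i = c *\<^sub>C \<gamma> v i" if "v \<in> rep_space (L a)" for c v
          by (rule \<gamma>_eq[OF P_scale[OF \<gamma>[OF that] that] L(4)[OF a that] i])
        show "\<gamma> (rep_act (L a) g v) i = rep_act (L i) g (\<gamma> v i)"
          if "g \<in> carrier G" "v \<in> rep_space (L a)" for g v
          by (rule \<gamma>_eq[OF P_act[OF \<gamma>[OF that(2)] that(2,1)] L(6)[OF a that] i])
      qed
      show "\<not> rep_iso G (L a) (L i)" using not_iso[OF a A[OF i]] insert.hyps i by blast
    qed
    then have "\<phi> a v = 0" if "v \<in> rep_space (L a)" for v
      using \<gamma>[OF that] that A by (auto simp: P_def rep_hom_zero[OF is_rep_L hom])
    then show False using nonzero[OF a] by blast
  qed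
  moreover have "f a \<in> ?U"
  proof -
    have "\<phi> a (f a) = - (\<Sum>i\<in>A. \<phi> i (f i))"
      using insert.prems(3) insert.hyps by (simp add: eq_neg_iff_add_eq_0)
    also have "\<dots> = (\<Sum>i\<in>A. \<phi> i (- f i))"
      using insert.prems(2) A by (simp add: rep_hom_minus[OF is_rep_L hom] sum_negf)
    finally show ?thesis
      using insert.prems(2) A L(4)[of _ "f _" "-1"]
      by (auto simp: P_def intro!: exI[of _ "\<lambda>i. - f i"])
  qed
  ultimately have fa: "f a = 0" by blast
  then have "(\<Sum>i\<in>A. \<phi> i (f i)) = 0"
    using insert.prems(3) insert.hyps rep_hom_zero[OF is_rep_L[OF a] hom[OF a]] by simp
  then show ?case using insert.IH[of f i] insert.prems(2,4) fa A by blast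
qed simp

definition total :: "('i \<Rightarrow> 'w) \<Rightarrow> 'v" where
  "total f = (\<Sum>i\<in>I. \<phi> i (f i))"

lemma space_direct_sum:
  "rep_space (direct_sum I L) = {f. (\<forall>i\<in>I. f i \<in> rep_space (L i)) \<and> (\<forall>i. i \<notin> I \<longrightarrow> f i = 0)}"
proof -
  have "finite {i. f i \<noteq> 0}" if "\<forall>i. i \<notin> I \<longrightarrow> f i = 0" for f :: "'i \<Rightarrow> 'w"
    by (rule finite_subset[OF _ finite_index]) (use that in blast)
  then show ?thesis by (auto simp: direct_sum_def)
qed

lemma act_direct_sum:
  "rep_act (direct_sum I L) g f = (\<lambda>i. if i \<in> I then rep_act (L i) g (f i) else 0)"
  by (simp add: direct_sum_def)

lemma total_hom: "rep_hom G (direct_sum I L) M total"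
  by (rule rep_homI)
    (auto simp: total_def space_direct_sum act_direct_sum scaleC_fun_def sum.distrib complex_vector.scale_sum_right
     rep_homD[OF hom] rep_act_sum[OF rep] intro!: is_rep_space(5)[OF rep] sum.cong)

lemma total_inj_on: "inj_on total (rep_space (direct_sum I L))"
proof (rule inj_onI)
  fix f g assume f: "f \<in> rep_space (direct_sum I L)" and g: "g \<in> rep_space (direct_sum I L)"
    and eq: "total f = total g"
  have "f i - g i = 0" if "i \<in> I" for i
  proof (rule independent_images[OF finite_index order_refl _ _ that])
    show "(\<Sum>i\<in>I. \<phi> i (f i - g i)) = 0"
      using eq f g by (simp add: total_def space_direct_sum rep_hom_diff[OF is_rep_L hom] sum_subtractf)
  qed (use f g is_rep_space(3)[OF is_rep_L] in \<open>auto simp: space_direct_sum\<close>)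
  moreover have "f i = g i" if "i \<notin> I" for i using f g that by (simp add: space_direct_sum)
  ultimately show "f = g" by (metis eq_iff_diff_eq_0 ext)
qed

lemma is_rep_direct_sum: "is_rep G (direct_sum I L)"
proof -
  have zero: "rep_act (L i) g 0 = 0" if "i \<in> I" "g \<in> carrier G" for i g
    using is_repD(5)[OF is_rep_L[OF that(1)] that(2) is_rep_space(1)[OF is_rep_L[OF that(1)]], of 0]
    by simp
  have "csubspace (rep_space (direct_sum I L))"
    by (rule complex_vector.subspaceI)
      (auto simp: space_direct_sum scaleC_fun_def is_rep_space[OF is_rep_L])
  then show ?thesis
    unfolding is_rep_def act_direct_sum using is_repD(1)[OF rep]
    by (auto simp: space_direct_sum fun_eq_iff scaleC_fun_def is_repD(3-7)[OF is_rep_L])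
qed

end

locale distinct_summands = distinct_constituents G M I L \<phi>
  for G :: "('g, 'm) monoid_scheme" and M :: "('g, 'v::complex_vector) crep"
    and I :: "'i set" and L :: "'i \<Rightarrow> ('g, 'w::complex_vector) crep" and \<phi> :: "'i \<Rightarrow> 'w \<Rightarrow> 'v" +
  assumes spanning: "rep_space M \<subseteq> total ` rep_space (direct_sum I L)"
begin

lemma total_bij: "bij_betw total (rep_space (direct_sum I L)) (rep_space M)"
  unfolding bij_betw_def using total_inj_on spanning rep_homD(1)[OF total_hom] by blast

theorem rep_iso_direct_sum: "rep_iso G M (direct_sum I L)"
proof (rule rep_iso_sym[OF is_rep_direct_sum])
  show "rep_iso G (direct_sum I L) M"
    unfolding rep_iso_iff_bij_rep_hom using total_hom total_bij by blast
qed

definition coord :: "'i \<Rightarrow> 'v \<Rightarrow> 'w" where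
  "coord i v = inv_into (rep_space (direct_sum I L)) total v i"

lemma coord_hom: "i \<in> I \<Longrightarrow> rep_hom G M (L i) (coord i)"
proof -
  assume i: "i \<in> I"
  have inv: "rep_hom G M (direct_sum I L) (inv_into (rep_space (direct_sum I L)) total)"
    by (rule rep_hom_inv_into[OF is_rep_direct_sum total_hom total_bij])
  have "f i \<in> rep_space (L i)" if "f \<in> rep_space (direct_sum I L)" for f
    using that i by (simp add: space_direct_sum)
  then show ?thesis
    by (intro rep_homI)
      (simp_all add: i coord_def rep_homD[OF inv] scaleC_fun_def act_direct_sum)
qed

lemma coord_sum:
  assumes "\<And>i. i \<in> I \<Longrightarrow> g i \<in> rep_space (L i)" "k \<in> I"
  shows "coord k (\<Sum>i\<in>I. \<phi> i (g i)) = g k"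
proof -
  let ?g = "\<lambda>i. if i \<in> I then g i else 0"
  have "(\<Sum>i\<in>I. \<phi> i (g i)) = total ?g" by (simp add: total_def)
  moreover have "?g \<in> rep_space (direct_sum I L)" using assms(1) by (simp add: space_direct_sum)
  ultimately show ?thesis
    using assms(2) by (simp add: coord_def inv_into_f_f[OF total_inj_on])
qed

lemma coord_embedding:
  assumes i: "i \<in> I" and k: "k \<in> I" and u: "u \<in> rep_space (L i)"
  shows "coord k (\<phi> i u) = (if k = i then u else 0)"
proof -
  have "(\<Sum>l\<in>I. \<phi> l (if l = i then u else 0)) = (\<Sum>l\<in>I. if l = i then \<phi> i u else 0)"
    by (intro sum.cong refl) (auto simp: rep_hom_zero[OF is_rep_L hom])
  then have "\<phi> i u = (\<Sum>l\<in>I. \<phi> l (if l = i then u else 0))"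
    using i finite_index by simp
  then show ?thesis
    using coord_sum[of "\<lambda>l. if l = i then u else 0", OF _ k] u is_rep_space(1)[OF is_rep_L] by auto
qed

lemma sum_coord: "v \<in> rep_space M \<Longrightarrow> v = (\<Sum>i\<in>I. \<phi> i (coord i v))"
  using f_inv_into_f[of v total] spanning by (auto simp: total_def coord_def)

definition summand :: "'i \<Rightarrow> 'v set" where
  "summand i = \<phi> i ` rep_space (L i)"

lemma subrep_summand: "i \<in> I \<Longrightarrow> subrep G M (summand i)"
  unfolding summand_def by (rule subrep_image[OF is_rep_L rep hom])

lemma rep_iso_summand:
  assumes "i \<in> I"
  shows "rep_iso G (L i) (M\<lparr>rep_space := summand i\<rparr>)"
  unfolding rep_iso_iff_bij_rep_hom
proof (intro exI conjI)
  show "rep_hom G (L i) (M\<lparr>rep_space := summand i\<rparr>) (\<phi> i)"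
    using hom[OF assms] by (simp add: rep_hom_def summand_def)
  show "bij_betw (\<phi> i) (rep_space (L i)) (rep_space (M\<lparr>rep_space := summand i\<rparr>))"
    using embedding_inj_on[OF assms] by (simp add: bij_betw_def summand_def)
qed

lemma irreducible_summand: "i \<in> I \<Longrightarrow> irreducible_rep G (M\<lparr>rep_space := summand i\<rparr>)"
  by (rule irreducible_rep_iso[OF rep_iso_summand irreducible is_rep_subrep[OF rep subrep_summand]])

lemma summand_inj_on: "inj_on summand I"
proof (rule inj_onI, rule ccontr)
  fix i k assume ik: "i \<in> I" "k \<in> I" "summand i = summand k" "i \<noteq> k"
  obtain u where u: "u \<in> rep_space (L i)" "\<phi> i u \<noteq> 0" using nonzero[OF ik(1)] by blast
  then obtain u' where u': "u' \<in> rep_space (L k)" "\<phi> i u = \<phi> k u'"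
    using ik(3) unfolding summand_def by blast
  have "u = 0"
    using coord_embedding[OF ik(1,1) u(1)] coord_embedding[OF ik(2,1) u'(1)] u'(2) ik(4) by simp
  then show False using u rep_hom_zero[OF is_rep_L[OF ik(1)] hom[OF ik(1)]] by simp
qed

lemma summand_decomposition: "irreducible_decomposition G M (summand ` I)"
  unfolding irreducible_decomposition_def
proof (intro conjI ballI)
  fix v assume v: "v \<in> rep_space M"
  have reindex: "(\<Sum>U\<in>summand ` I. f U) = (\<Sum>i\<in>I. f (summand i))" for f :: "'v set \<Rightarrow> 'v"
    by (simp add: sum.reindex[OF summand_inj_on])
  let ?f = "\<lambda>U\<in>summand ` I. \<phi> (inv_into I summand U) (coord (inv_into I summand U) v)"
  show "\<exists>!f. f \<in> (\<Pi>\<^sub>E U\<in>summand ` I. U) \<and> v = (\<Sum>U\<in>summand ` I. f U)"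
  proof (rule ex1I[of _ ?f])
    have f_eq: "?f (summand i) = \<phi> i (coord i v)" if "i \<in> I" for i
      using that by (simp add: inv_into_f_f[OF summand_inj_on])
    have "\<phi> i (coord i v) \<in> summand i" if "i \<in> I" for i
      using rep_homD(1)[OF coord_hom[OF that] v] by (simp add: summand_def)
    then have "?f \<in> (\<Pi>\<^sub>E U\<in>summand ` I. U)"
      by (auto simp: restrict_PiE_iff inv_into_f_f[OF summand_inj_on])
    moreover have "(\<Sum>i\<in>I. ?f (summand i)) = (\<Sum>i\<in>I. \<phi> i (coord i v))"
      by (intro sum.cong refl f_eq)
    ultimately show "?f \<in> (\<Pi>\<^sub>E U\<in>summand ` I. U) \<and> v = (\<Sum>U\<in>summand ` I. ?f U)"
      unfolding reindex using sum_coord[OF v] by simp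
  next
    fix f assume f: "f \<in> (\<Pi>\<^sub>E U\<in>summand ` I. U) \<and> v = (\<Sum>U\<in>summand ` I. f U)"
    then have "\<forall>i\<in>I. \<exists>u. u \<in> rep_space (L i) \<and> f (summand i) = \<phi> i u"
      by (auto simp: summand_def PiE_def Pi_def image_iff)
    then obtain g where g: "\<And>i. i \<in> I \<Longrightarrow> g i \<in> rep_space (L i)" "\<And>i. i \<in> I \<Longrightarrow> f (summand i) = \<phi> i (g i)"
      by metis
    have "v = (\<Sum>i\<in>I. \<phi> i (g i))" using f g(2) by (simp add: reindex)
    then have "f (summand i) = \<phi> i (coord i v)" if "i \<in> I" for i
      using g that by (simp add: coord_sum)
    then show "f = ?f"
      using f by (intro ext) (auto simp: PiE_def extensional_def inv_into_f_f[OF summand_inj_on])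
  qed
qed (use finite_index subrep_summand irreducible_summand in auto)

text \<open>All coordinates of \<open>U\<close> except the one at \<open>j\<close> vanish by Schur's lemma, so \<open>U\<close> lies in the
irreducible summand at \<open>j\<close>.\<close>
lemma constituent_eq_summand:
  assumes U: "subrep G M U" "irreducible_rep G (M\<lparr>rep_space := U\<rparr>)"
    and j: "j \<in> I" and iso: "rep_iso G (M\<lparr>rep_space := U\<rparr>) (L j)"
  shows "U = summand j"
proof -
  have zero: "coord k v = 0" if k: "k \<in> I" "k \<noteq> j" and v: "v \<in> U" for k v
  proof (rule schur_zero[OF U(2) irreducible[OF k(1)] rep_hom_restrict[OF coord_hom[OF k(1)] U(1)]])
    show "\<not> rep_iso G (M\<lparr>rep_space := U\<rparr>) (L k)"
      using rep_iso_trans[OF rep_iso_sym[OF irreducible_repD(1)[OF U(2)] iso]] not_iso[OF j k(1)] k(2) by blast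
  qed (use v in simp)
  have "U \<subseteq> summand j"
  proof
    fix v assume v: "v \<in> U"
    then have vM: "v \<in> rep_space M" using U(1) by (auto simp: subrep_def)
    have "v = (\<Sum>i\<in>I. \<phi> i (coord i v))" by (rule sum_coord[OF vM])
    also have "\<dots> = (\<Sum>i\<in>I. if i = j then \<phi> j (coord j v) else 0)"
      by (intro sum.cong refl) (auto simp: zero v rep_hom_zero[OF is_rep_L hom])
    finally show "v \<in> summand j"
      using j finite_index rep_homD(1)[OF coord_hom[OF j] vM] by (auto simp: summand_def)
  qed
  then have "subrep G (M\<lparr>rep_space := summand j\<rparr>) U"
    using U(1) by (simp add: subrep_def)
  then show ?thesis
    using irreducible_repD(3)[OF irreducible_summand[OF j]] irreducible_repD(2)[OF U(2)] by fastforce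
qed

text \<open>In any decomposition into irreducibles at most one part is isomorphic to \<open>L j\<close>, because such a part
equals the summand at \<open>j\<close>. If there were none, the coordinate at \<open>j\<close> would vanish on all parts and
therefore on \<open>M\<close>.\<close>
theorem multiplicity_summand:
  assumes j: "j \<in> I"
  shows "multiplicity G M (L j) = 1"
proof -
  have *: "card {U \<in> D. rep_iso G (M\<lparr>rep_space := U\<rparr>) (L j)} = 1"
    if D: "irreducible_decomposition G M D" for D
  proof -
    have U: "subrep G M U" "irreducible_rep G (M\<lparr>rep_space := U\<rparr>)" if "U \<in> D" for U
      using D that by (auto simp: irreducible_decomposition_def)
    have "\<exists>U\<in>D. rep_iso G (M\<lparr>rep_space := U\<rparr>) (L j)"
    proof (rule ccontr)
      assume none: "\<not> ?thesis"
      obtain u where u: "u \<in> rep_space (L j)" "\<phi> j u \<noteq> 0" using nonzero[OF j] by blast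
      then have v: "\<phi> j u \<in> rep_space M" using rep_homD(1)[OF hom[OF j]] by blast
      then obtain f where f: "f \<in> (\<Pi>\<^sub>E U\<in>D. U)" "\<phi> j u = (\<Sum>U\<in>D. f U)"
        using D unfolding irreducible_decomposition_def by blast
      have fU: "f W \<in> W" if "W \<in> D" for W using f(1) that by auto
      have "coord j (\<phi> j u) = (\<Sum>U\<in>D. coord j (f U))"
        unfolding f(2) by (rule rep_hom_sum[OF rep coord_hom[OF j]])
          (use fU U(1) in \<open>auto simp: subrep_def\<close>)
      also have "\<dots> = 0"
      proof (rule sum.neutral, rule ballI)
        fix W assume W: "W \<in> D"
        show "coord j (f W) = 0"
          by (rule schur_zero[OF U(2)[OF W] irreducible[OF j] rep_hom_restrict[OF coord_hom[OF j] U(1)[OF W]]])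
            (use none W fU[OF W] in auto)
      qed
      finally have "u = 0" using coord_embedding[OF j j u(1)] by simp
      then show False using u rep_hom_zero[OF is_rep_L[OF j] hom[OF j]] by simp
    qed
    then obtain U where "U \<in> D" "rep_iso G (M\<lparr>rep_space := U\<rparr>) (L j)" by blast
    then have "{U \<in> D. rep_iso G (M\<lparr>rep_space := U\<rparr>) (L j)} = {summand j}"
      using constituent_eq_summand[OF U j] by blast
    then show ?thesis by simp
  qed
  show ?thesis
    unfolding multiplicity_def
  proof (rule the_equality)
    show "\<exists>D. irreducible_decomposition G M D \<and>
        1 = card {U \<in> D. rep_iso G (M\<lparr>rep_space := U\<rparr>) (L j)}"
      using summand_decomposition *[OF summand_decomposition] by (intro exI[of _ "summand ` I"]) simp
    show "m = 1" if "\<exists>D. irreducible_decomposition G M D \<and>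
        m = card {U \<in> D. rep_iso G (M\<lparr>rep_space := U\<rparr>) (L j)}" for m
      using that * by blast
  qed
qed

end

section \<open>Permutation representations and vectors fixed by a stabilizer\<close>
locale perm_action =
  fixes G :: "('g, 'm) monoid_scheme" and S :: "'x set" and act :: "'g \<Rightarrow> 'x \<Rightarrow> 'x"
  assumes group: "group G" and finite_set: "finite S"
    and closed: "g \<in> carrier G \<Longrightarrow> s \<in> S \<Longrightarrow> act g s \<in> S"
    and one: "s \<in> S \<Longrightarrow> act \<one>\<^bsub>G\<^esub> s = s"
    and mult: "g \<in> carrier G \<Longrightarrow> h \<in> carrier G \<Longrightarrow> s \<in> S \<Longrightarrow> act (g \<otimes>\<^bsub>G\<^esub> h) s = act g (act h s)"
begin

lemma is_rep: "is_rep G (perm_rep S act)"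
  using group finite_set closed one mult by (rule is_rep_perm_rep)

lemma inv_closed: "g \<in> carrier G \<Longrightarrow> inv\<^bsub>G\<^esub> g \<in> carrier G"
  by (rule group.inv_closed[OF group])

lemma act_inv_act: "g \<in> carrier G \<Longrightarrow> s \<in> S \<Longrightarrow> act (inv\<^bsub>G\<^esub> g) (act g s) = s"
  by (simp add: inv_closed one group.l_inv[OF group] flip: mult)

lemma act_act_inv: "g \<in> carrier G \<Longrightarrow> s \<in> S \<Longrightarrow> act g (act (inv\<^bsub>G\<^esub> g) s) = s"
  by (simp add: inv_closed one group.r_inv[OF group] flip: mult)

lemma perm_rep_space: "rep_space (perm_rep S act) = {f. \<forall>x. x \<notin> S \<longrightarrow> f x = 0}"
  by (simp add: perm_rep_def)

lemma perm_rep_apply: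
  assumes g: "g \<in> carrier G"
  shows "rep_act (perm_rep S act) g f y = (if y \<in> S then f (act (inv\<^bsub>G\<^esub> g) y) else 0)"
proof -
  have "rep_act (perm_rep S act) g f y = (\<Sum>s\<in>S. if act g s = y then f s else 0)"
    unfolding perm_rep_def
    by (auto simp: sum_fun_apply scaleC_fun_def scaleC_complex_def basis_vec_def intro!: sum.cong)
  also have "\<dots> = (\<Sum>s\<in>S. if s = act (inv\<^bsub>G\<^esub> g) y then (if y \<in> S then f s else 0) else 0)"
    using act_inv_act[OF g] act_act_inv[OF g] closed[OF g] by (intro sum.cong refl) auto
  also have "\<dots> = (if y \<in> S then f (act (inv\<^bsub>G\<^esub> g) y) else 0)"
    using finite_set closed[OF inv_closed[OF g]] by (auto simp: sum.delta)
  finally show ?thesis .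
qed

lemma perm_rep_expand:
  assumes f: "f \<in> rep_space (perm_rep S act)"
  shows "f = (\<Sum>s\<in>S. f s *\<^sub>C basis_vec s)"
proof
  fix x
  have "(\<Sum>s\<in>S. f s *\<^sub>C basis_vec s) x = (\<Sum>s\<in>S. if s = x then f s else 0)"
    by (auto simp: sum_fun_apply scaleC_fun_def scaleC_complex_def basis_vec_def intro!: sum.cong)
  then show "f x = (\<Sum>s\<in>S. f s *\<^sub>C basis_vec s) x"
    using f finite_set by (auto simp: perm_rep_space)
qed

lemma basis_vec_in_perm_rep: "s \<in> S \<Longrightarrow> basis_vec s \<in> rep_space (perm_rep S act)"
  by (auto simp: perm_rep_space basis_vec_def)

end

text \<open>The linear map that sends a point of \<open>S\<close> to the sum of all points of \<open>T\<close> incident with it.\<close>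
definition incidence_hom :: "'x set \<Rightarrow> 'y set \<Rightarrow> ('x \<Rightarrow> 'y \<Rightarrow> bool) \<Rightarrow> ('x \<Rightarrow> complex) \<Rightarrow> 'y \<Rightarrow> complex" where
  "incidence_hom S T R f = (\<lambda>y. if y \<in> T then \<Sum>x | x \<in> S \<and> R x y. f x else 0)"

lemma rep_hom_incidence_hom:
  assumes S: "perm_action G S act" and T: "perm_action G T act'"
    and R: "\<And>g x y. g \<in> carrier G \<Longrightarrow> x \<in> S \<Longrightarrow> y \<in> T \<Longrightarrow> R x y \<Longrightarrow> R (act g x) (act' g y)"
  shows "rep_hom G (perm_rep S act) (perm_rep T act') (incidence_hom S T R)"
proof (rule rep_homI)
  interpret S: perm_action G S act by (rule S)
  interpret T: perm_action G T act' by (rule T)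
  fix g f assume g: "g \<in> carrier G"
  note ig = S.inv_closed[OF g]
  show "incidence_hom S T R (rep_act (perm_rep S act) g f) =
      rep_act (perm_rep T act') g (incidence_hom S T R f)"
  proof
    fix y
    show "incidence_hom S T R (rep_act (perm_rep S act) g f) y =
      rep_act (perm_rep T act') g (incidence_hom S T R f) y"
    proof (cases "y \<in> T")
      case y: True
      have "bij_betw (act (inv\<^bsub>G\<^esub> g)) {x \<in> S. R x y} {x \<in> S. R x (act' (inv\<^bsub>G\<^esub> g) y)}"
      proof (rule bij_betw_byWitness[where f' = "act g"])
        show "act g ` {x \<in> S. R x (act' (inv\<^bsub>G\<^esub> g) y)} \<subseteq> {x \<in> S. R x y}"
          using R[OF g _ T.closed[OF ig y]] T.act_act_inv[OF g y] S.closed[OF g] by auto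
      qed (use R[OF ig _ y] S.closed[OF ig] S.act_act_inv[OF g] S.act_inv_act[OF g] in auto)
      from sum.reindex_bij_betw[OF this, of f] show ?thesis
        using y T.closed[OF ig y] by (simp add: incidence_hom_def S.perm_rep_apply[OF g] T.perm_rep_apply[OF g])
    qed (simp add: incidence_hom_def T.perm_rep_apply[OF g])
  qed
qed (auto simp: incidence_hom_def perm_action.perm_rep_space[OF T] sum.distrib scaleC_fun_def
    scaleC_complex_def sum_distrib_left)

locale transitive_perm_action = perm_action +
  fixes x\<^sub>0
  assumes finite_group: "finite (carrier G)" and base: "x\<^sub>0 \<in> S"
    and transitive: "y \<in> S \<Longrightarrow> \<exists>g\<in>carrier G. act g x\<^sub>0 = y"
begin

definition stab where "stab = {h \<in> carrier G. act h x\<^sub>0 = x\<^sub>0}"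

lemma stab_inv: "h \<in> stab \<Longrightarrow> inv\<^bsub>G\<^esub> h \<in> stab"
  using act_inv_act[of h "x\<^sub>0"] base by (simp add: stab_def inv_closed)

lemma finite_stab: "finite stab"
  using finite_group by (simp add: stab_def)

text \<open>By transitivity some translate \<open>v\<close> of a nonzero vector of \<open>U\<close> has a nonzero coefficient at the base
point. Summing the translates of \<open>v\<close> under the stabilizer multiplies this coefficient by the order of
the stabilizer, so the sum cannot vanish.\<close>
lemma stab_fixed_vector:
  assumes M: "subrep G (perm_rep S act) U" and nz: "\<exists>u\<in>U. u \<noteq> 0"
  shows "\<exists>w\<in>U. w x\<^sub>0 \<noteq> 0 \<and> (\<forall>h\<in>stab. \<forall>x\<in>S. w (act h x) = w x)"
proof -
  have sub: "csubspace U" "U \<subseteq> rep_space (perm_rep S act)"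
    "\<And>g u. g \<in> carrier G \<Longrightarrow> u \<in> U \<Longrightarrow> rep_act (perm_rep S act) g u \<in> U"
    using M by (auto simp: subrep_def)
  obtain u y where u: "u \<in> U" "u y \<noteq> 0" using nz by (auto simp: fun_eq_iff)
  then have "y \<in> S" using sub(2) by (auto simp: perm_rep_space)
  then obtain g where g: "g \<in> carrier G" "act g x\<^sub>0 = y" using transitive by blast
  define v where "v = rep_act (perm_rep S act) (inv\<^bsub>G\<^esub> g) u"
  have v: "v \<in> U" "v x\<^sub>0 \<noteq> 0"
    using sub(3)[OF inv_closed[OF g(1)] u(1)] u(2) g base
    by (auto simp: v_def perm_rep_apply inv_closed group.inv_inv[OF group])
  define w where "w = (\<Sum>h\<in>stab. rep_act (perm_rep S act) h v)"
  have "bij_betw (m_inv G) stab stab"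
    by (rule bij_betw_byWitness[where f' = "m_inv G"])
      (auto simp: stab_inv, auto simp: stab_def group.inv_inv[OF group])
  have w: "w x = (\<Sum>h\<in>stab. v (act h x))" if "x \<in> S" for x
  proof -
    have "w x = (\<Sum>h\<in>stab. v (act (inv\<^bsub>G\<^esub> h) x))"
      using that by (auto simp: w_def sum_fun_apply perm_rep_apply stab_def intro!: sum.cong)
    also have "\<dots> = (\<Sum>h\<in>stab. v (act h x))"
      by (rule sum.reindex_bij_betw[OF \<open>bij_betw (m_inv G) stab stab\<close>])
    finally show ?thesis .
  qed
  show ?thesis
  proof (intro bexI conjI ballI)
    show "w \<in> U"
      unfolding w_def using sub(3) v(1) by (intro complex_vector.subspace_sum[OF sub(1)]) (auto simp: stab_def)
    have "\<one>\<^bsub>G\<^esub> \<in> stab"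
      using base one group.is_monoid[OF group] by (simp add: stab_def monoid.one_closed)
    then have "card stab \<noteq> 0" using finite_stab by auto
    moreover have "w x\<^sub>0 = of_nat (card stab) * v x\<^sub>0"
      by (simp add: w[OF base] stab_def)
    ultimately show "w x\<^sub>0 \<noteq> 0" using v(2) by simp
  next
    fix k x assume k: "k \<in> stab" and x: "x \<in> S"
    have kG: "k \<in> carrier G" using k by (simp add: stab_def)
    have st: "h \<otimes>\<^bsub>G\<^esub> l \<in> stab" if "h \<in> stab" "l \<in> stab" for h l
      using that base mult group.is_monoid[OF group] by (simp add: stab_def monoid.m_closed)
    have bij: "bij_betw (\<lambda>h. h \<otimes>\<^bsub>G\<^esub> k) stab stab"
      by (rule bij_betw_byWitness[where f' = "\<lambda>h. h \<otimes>\<^bsub>G\<^esub> inv\<^bsub>G\<^esub> k"])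
        (use st k stab_inv[OF k] in \<open>auto simp: stab_def group.is_monoid[OF group]
           monoid.m_assoc inv_closed group.l_inv[OF group] group.r_inv[OF group] monoid.r_one\<close>)
    have "w (act k x) = (\<Sum>h\<in>stab. v (act (h \<otimes>\<^bsub>G\<^esub> k) x))"
      unfolding w[OF closed[OF kG x]] using kG x by (intro sum.cong refl) (auto simp: mult stab_def)
    also have "\<dots> = w x"
      unfolding w[OF x] by (rule sum.reindex_bij_betw[OF bij])
    finally show "w (act k x) = w x" .
  qed
qed

text \<open>Points with equal labels lie in one orbit of the stabilizer, so fixed vectors are combinations of the
indicators \<open>e l\<close> of the sets of equally labelled points. The fixed vectors \<open>w i\<close>, one from each
constituent, are independent, and there are at least as many of them as indicators. Hence they span
all the indicators, and one of these is the base point, which is an orbit by itself.\<close>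
theorem distinct_summands_of_few_orbits:
  fixes L :: "'i \<Rightarrow> ('a, 'w::complex_vector) crep" and label :: "'c \<Rightarrow> 'i"
  assumes constituents: "distinct_constituents G (perm_rep S act) I L \<phi>"
    and label: "\<And>x. x \<in> S \<Longrightarrow> label x \<in> I"
    and orbit: "\<And>x y. x \<in> S \<Longrightarrow> y \<in> S \<Longrightarrow> label x = label y \<Longrightarrow> \<exists>h\<in>stab. act h x = y"
  shows "distinct_summands G (perm_rep S act) I L \<phi>"
proof -
  interpret distinct_constituents G "perm_rep S act" I L \<phi> by (rule constituents)
  have "\<exists>z. z \<in> rep_space (L i) \<and> \<phi> i z x\<^sub>0 \<noteq> 0 \<and> (\<forall>h\<in>stab. \<forall>x\<in>S. \<phi> i z (act h x) = \<phi> i z x)"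
    if i: "i \<in> I" for i
    using stab_fixed_vector[OF subrep_image[OF is_rep_L[OF i] is_rep hom[OF i]]] nonzero[OF i] by blast
  then obtain z where z: "\<And>i. i \<in> I \<Longrightarrow> z i \<in> rep_space (L i)" "\<And>i. i \<in> I \<Longrightarrow> \<phi> i (z i) x\<^sub>0 \<noteq> 0"
      "\<And>i h x. i \<in> I \<Longrightarrow> h \<in> stab \<Longrightarrow> x \<in> S \<Longrightarrow> \<phi> i (z i) (act h x) = \<phi> i (z i) x"
    by metis
  define w where "w i = \<phi> i (z i)" for i
  define e :: "'i \<Rightarrow> 'c \<Rightarrow> complex" where "e l = (\<lambda>x. if x \<in> S \<and> label x = l then 1 else 0)" for l
  have z_nz: "z i \<noteq> 0" if "i \<in> I" for i
    using z(2)[OF that] rep_hom_zero[OF is_rep_L[OF that] hom[OF that]] by auto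
  have w_space: "w i x = 0" if "i \<in> I" "x \<notin> S" for i x
    using rep_homD(1)[OF hom[OF that(1)] z(1)[OF that(1)]] that by (simp add: w_def perm_rep_space)
  have w_label: "w i x = w i y" if "i \<in> I" "x \<in> S" "y \<in> S" "label x = label y" for i x y
    using orbit[OF that(2-4)] z(3)[OF that(1) _ that(2)] by (auto simp: w_def)
  have inj: "inj_on w I"
  proof (rule inj_onI, rule ccontr)
    fix i k assume ik: "i \<in> I" "k \<in> I" "w i = w k" "i \<noteq> k"
    define f where "f l = (if l = i then z i else - z k)" for l
    have "f i = 0"
    proof (rule independent_images[of "{i, k}"])
      show "(\<Sum>l\<in>{i, k}. \<phi> l (f l)) = 0"
        using ik rep_hom_minus[OF is_rep_L[OF ik(2)] hom[OF ik(2)] z(1)[OF ik(2)]] by (simp add: w_def f_def)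
      show "f l \<in> rep_space (L l)" if "l \<in> {i, k}" for l
        using that ik z(1) is_rep_space(4)[OF is_rep_L[OF ik(2)] z(1)[OF ik(2)], of "-1"]
        by (auto simp: f_def)
    qed (use ik in auto)
    then show False using z_nz[OF ik(1)] by (simp add: f_def)
  qed
  have indep: "complex_vector.independent (w ` I)"
  proof -
    have "u v = 0" if u: "(\<Sum>v\<in>w ` I. u v *\<^sub>C v) = 0" and v: "v \<in> w ` I" for u v
    proof -
      obtain i where i: "i \<in> I" "v = w i" using v by blast
      have "u (w i) *\<^sub>C z i = 0"
      proof (rule independent_images[OF finite_index order_refl _ _ i(1)])
        show "(\<Sum>i\<in>I. \<phi> i (u (w i) *\<^sub>C z i)) = 0"
          using u by (simp add: sum.reindex[OF inj] rep_homD(3)[OF hom] z(1) flip: w_def)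
      qed (use z(1) is_rep_space(4)[OF is_rep_L] in blast)
      then show ?thesis using z_nz[OF i(1)] i(2) by simp
    qed
    then show ?thesis
      using finite_index by (auto simp: complex_vector.dependent_finite)
  qed
  have "w i \<in> cspan (e ` I)" if i: "i \<in> I" for i
  proof -
    \<comment> \<open>The value at a label that does not occur is irrelevant, as then \<open>e l\<close> is zero.\<close>
    define c where "c l = w i (SOME x. x \<in> S \<and> label x = l)" for l
    have "w i = (\<Sum>l\<in>I. c l *\<^sub>C e l)"
    proof
      fix x
      show "w i x = (\<Sum>l\<in>I. c l *\<^sub>C e l) x"
      proof (cases "x \<in> S")
        case True
        have "(SOME y. y \<in> S \<and> label y = label x) \<in> S \<and> label (SOME y. y \<in> S \<and> label y = label x) = label x"
          by (rule someI[of _ x]) (simp add: True)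
        then have "c (label x) = w i x"
          unfolding c_def by (intro w_label[OF i]) (use True in auto)
        moreover have "(\<Sum>l\<in>I. c l *\<^sub>C e l) x = (\<Sum>l\<in>I. if l = label x then c l else 0)"
          using True by (auto simp: sum_fun_apply scaleC_fun_def scaleC_complex_def e_def intro!: sum.cong)
        ultimately show ?thesis using label[OF True] finite_index by simp
      qed (simp add: w_space i sum_fun_apply scaleC_fun_def scaleC_complex_def e_def)
    qed
    then show ?thesis
      by (auto intro: complex_vector.span_sum complex_vector.span_scale complex_vector.span_base)
  qed
  then have w_span: "w ` I \<subseteq> cspan (e ` I)" by blast
  have e_span: "e ` I \<subseteq> cspan (w ` I)"
  proof (rule subsetI, rule ccontr)
    fix a assume a: "a \<in> e ` I" "a \<notin> cspan (w ` I)"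
    then have "complex_vector.independent (insert a (w ` I))"
      using indep by (simp add: complex_vector.independent_insert)
    moreover have "insert a (w ` I) \<subseteq> cspan (e ` I)"
      using w_span a(1) complex_vector.span_base by blast
    ultimately have "card (insert a (w ` I)) \<le> card (e ` I)"
      using complex_vector.independent_span_bound finite_index by blast
    moreover have "a \<notin> w ` I" using a(2) complex_vector.span_base by blast
    ultimately show False
      using card_image_le[OF finite_index, of e] card_image[OF inj] finite_index by simp
  qed
  define X where "X = total ` rep_space (direct_sum I L)"
  have X: "subrep G (perm_rep S act) X"
    unfolding X_def by (rule subrep_image[OF is_rep_direct_sum is_rep total_hom])
  then have X_sub: "csubspace X" by (simp add: subrep_def)
  have "w i \<in> X" if i: "i \<in> I" for i
  proof -
    have "(\<Sum>l\<in>I. \<phi> l (if l = i then z i else 0)) = (\<Sum>l\<in>I. if l = i then w i else 0)"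
      by (intro sum.cong refl) (auto simp: w_def rep_hom_zero[OF is_rep_L hom])
    then have "w i = total (\<lambda>l. if l = i then z i else 0)"
      using i finite_index by (simp add: total_def)
    moreover have "(\<lambda>l. if l = i then z i else 0) \<in> rep_space (direct_sum I L)"
      using i z(1) is_rep_space(1)[OF is_rep_L] by (auto simp: space_direct_sum)
    ultimately show ?thesis by (simp add: X_def)
  qed
  then have "e ` I \<subseteq> X"
    using e_span complex_vector.span_minimal[OF _ X_sub, of "w ` I"] by blast
  moreover have "basis_vec x\<^sub>0 = e (label x\<^sub>0)"
  proof
    fix x
    have "x = x\<^sub>0" if "x \<in> S" "label x = label x\<^sub>0"
      using orbit[OF base that(1)] that(2) by (auto simp: stab_def)
    then show "basis_vec x\<^sub>0 x = e (label x\<^sub>0) x" using base by (auto simp: basis_vec_def e_def)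
  qed
  ultimately have base_X: "basis_vec x\<^sub>0 \<in> X"
    using label[OF base] by auto
  have all_X: "basis_vec y \<in> X" if y: "y \<in> S" for y
  proof -
    obtain g where g: "g \<in> carrier G" "act g x\<^sub>0 = y" using transitive[OF y] by blast
    have "rep_act (perm_rep S act) g (basis_vec x\<^sub>0) \<in> X"
      using X g(1) base_X by (simp add: subrep_def)
    then show ?thesis
      by (simp add: rep_act_perm_rep_basis_vec[OF finite_set base] g(2))
  qed
  show ?thesis
  proof
    show "rep_space (perm_rep S act) \<subseteq> total ` rep_space (direct_sum I L)"
    proof
      fix f assume f: "f \<in> rep_space (perm_rep S act)"
      have "f = (\<Sum>y\<in>S. f y *\<^sub>C basis_vec y)" by (rule perm_rep_expand[OF f])
      also have "\<dots> \<in> X"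
        by (intro complex_vector.subspace_sum[OF X_sub] complex_vector.subspace_scale[OF X_sub] all_X)
      finally show "f \<in> total ` rep_space (direct_sum I L)" unfolding X_def .
    qed
  qed
qed

end

section \<open>Antisymmetrizers\<close>
text \<open>For \<open>C\<close> the column stabilizer of a tableau this is the action of the Young antisymmetrizer, which turns
the tabloid of the tableau into its polytabloid.\<close>
definition antisymmetrize :: "('a \<Rightarrow> 'a) set \<Rightarrow> ('a \<Rightarrow> 'a, 'v::complex_vector) crep \<Rightarrow> 'v \<Rightarrow> 'v" where
  "antisymmetrize C M u = (\<Sum>\<sigma>\<in>C. of_int (sign \<sigma>) *\<^sub>C rep_act M \<sigma> u)"

lemma antisymmetrize_in_subrep:
  assumes "subrep G M U" "C \<subseteq> carrier G" "u \<in> U"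
  shows "antisymmetrize C M u \<in> U"
  using assms unfolding antisymmetrize_def subrep_def
  by (auto intro!: complex_vector.subspace_sum complex_vector.subspace_scale)

lemma rep_hom_antisymmetrize:
  assumes M: "is_rep G M" and \<phi>: "rep_hom G M N \<phi>" and C: "C \<subseteq> carrier G" and u: "u \<in> rep_space M"
  shows "\<phi> (antisymmetrize C M u) = antisymmetrize C N (\<phi> u)"
proof -
  have "rep_act M \<sigma> u \<in> rep_space M" if "\<sigma> \<in> C" for \<sigma>
    using is_repD(3)[OF M _ u] C that by blast
  then show ?thesis
    using C u unfolding antisymmetrize_def
    by (subst rep_hom_sum[OF M \<phi>])
      (auto simp: rep_homD(3,4)[OF \<phi>] is_rep_space(4)[OF M] subset_iff intro!: sum.cong)
qed

lemma antisymmetrize_sum: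
  assumes M: "is_rep G M" and C: "C \<subseteq> carrier G" and f: "\<And>i. i \<in> A \<Longrightarrow> f i \<in> rep_space M"
  shows "antisymmetrize C M (\<Sum>i\<in>A. c i *\<^sub>C f i) = (\<Sum>i\<in>A. c i *\<^sub>C antisymmetrize C M (f i))"
proof -
  have "antisymmetrize C M (\<Sum>i\<in>A. c i *\<^sub>C f i) =
      (\<Sum>\<sigma>\<in>C. \<Sum>i\<in>A. (of_int (sign \<sigma>) * c i) *\<^sub>C rep_act M \<sigma> (f i))"
    unfolding antisymmetrize_def
  proof (intro sum.cong refl)
    fix \<sigma> assume "\<sigma> \<in> C"
    then have \<sigma>: "\<sigma> \<in> carrier G" using C by blast
    show "of_int (sign \<sigma>) *\<^sub>C rep_act M \<sigma> (\<Sum>i\<in>A. c i *\<^sub>C f i) =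
        (\<Sum>i\<in>A. (of_int (sign \<sigma>) * c i) *\<^sub>C rep_act M \<sigma> (f i))"
      using f by (simp add: rep_act_sum[OF M \<sigma>] is_rep_space(4)[OF M] is_repD(5)[OF M \<sigma>]
          complex_vector.scale_sum_right)
  qed
  also have "\<dots> = (\<Sum>i\<in>A. c i *\<^sub>C antisymmetrize C M (f i))"
    by (subst sum.swap) (simp add: antisymmetrize_def complex_vector.scale_sum_right mult.commute)
  finally show ?thesis .
qed

lemma antisymmetrize_act:
  assumes M: "is_rep (sym_group n) M" and u: "u \<in> rep_space M"
    and C: "C \<subseteq> carrier (sym_group n)" and \<rho>: "\<rho> permutes {1..n}" and bij: "bij_betw (\<lambda>\<sigma>. \<sigma> \<circ> \<rho>) C C"
  shows "antisymmetrize C M (rep_act M \<rho> u) = of_int (sign \<rho>) *\<^sub>C antisymmetrize C M u"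
proof -
  have perm: "permutation \<sigma>" if "\<sigma> permutes {1..n}" for \<sigma>
    using that by (auto simp: permutation_permutes)
  have "of_int (sign \<rho>) *\<^sub>C antisymmetrize C M u =
      of_int (sign \<rho>) *\<^sub>C (\<Sum>\<sigma>\<in>C. of_int (sign (\<sigma> \<circ> \<rho>)) *\<^sub>C rep_act M (\<sigma> \<circ> \<rho>) u)"
    unfolding antisymmetrize_def
    by (subst sum.reindex_bij_betw[OF bij, of "\<lambda>\<sigma>. of_int (sign \<sigma>) *\<^sub>C rep_act M \<sigma> u"]) (rule refl)
  also have "\<dots> = (\<Sum>\<sigma>\<in>C. of_int (sign \<sigma>) *\<^sub>C rep_act M \<sigma> (rep_act M \<rho> u))"
    unfolding complex_vector.scale_sum_right
  proof (intro sum.cong refl)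
    fix \<sigma> assume "\<sigma> \<in> C"
    then have \<sigma>: "\<sigma> permutes {1..n}" using C by (auto simp: sym_group_carrier)
    have "sign \<rho> * sign (\<sigma> \<circ> \<rho>) = sign \<sigma>"
      using sign_compose[OF perm[OF \<sigma>] perm[OF \<rho>]] by (simp add: sign_def)
    then have "complex_of_int (sign \<rho>) * of_int (sign (\<sigma> \<circ> \<rho>)) = of_int (sign \<sigma>)"
      by (metis of_int_mult)
    moreover have "rep_act M (\<sigma> \<circ> \<rho>) u = rep_act M \<sigma> (rep_act M \<rho> u)"
      using is_repD(7)[OF M, of \<sigma> \<rho> u] u \<sigma> \<rho> by (simp add: sym_group_def)
    ultimately show "of_int (sign \<rho>) *\<^sub>C of_int (sign (\<sigma> \<circ> \<rho>)) *\<^sub>C rep_act M (\<sigma> \<circ> \<rho>) u =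
        of_int (sign \<sigma>) *\<^sub>C rep_act M \<sigma> (rep_act M \<rho> u)"
      by (simp add: complex_vector.scale_scale)
  qed
  finally show ?thesis unfolding antisymmetrize_def by simp
qed

text \<open>Replacing \<open>\<sigma>\<close> by \<open>\<sigma> \<circ> \<rho>\<close> changes the sign of every term and nothing else.\<close>
lemma antisymmetrize_eq_0:
  assumes "is_rep (sym_group n) M" "u \<in> rep_space M"
    and "C \<subseteq> carrier (sym_group n)" "\<rho> permutes {1..n}" "bij_betw (\<lambda>\<sigma>. \<sigma> \<circ> \<rho>) C C"
    and "sign \<rho> = -1" "rep_act M \<rho> u = u"
  shows "antisymmetrize C M u = 0"
proof -
  have "antisymmetrize C M u = - antisymmetrize C M u"
    using antisymmetrize_act[OF assms(1-5)] assms(6,7) by simp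
  then have "2 *\<^sub>C antisymmetrize C M u = 0"
    using complex_vector.scale_left_distrib[of 1 1 "antisymmetrize C M u"]
    by (simp add: eq_neg_iff_add_eq_0)
  then show ?thesis by simp
qed

section \<open>Diagrams, tableaux and column stabilizers\<close>
lemma perm_action_tabloids: "perm_action (sym_group (sum_list \<mu>)) (tabloids \<mu>) tabloid_act"
proof (rule perm_action.intro)
  fix g s assume "g \<in> carrier (sym_group (sum_list \<mu>))" "s \<in> tabloids \<mu>"
  then obtain t where "g permutes {1..sum_list \<mu>}" "tableau \<mu> t" "s = tabloid \<mu> t"
    by (auto simp: tabloids_def sym_group_def)
  then show "tabloid_act g s \<in> tabloids \<mu>"
    by (simp only: tabloid_act_tabloid tabloid_comp_in_tabloids)
qed (rule sym_group_is_group finite_tabloids | simp add: tabloid_act_def sym_group_def image_image)+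

lemma mem_diagram: "(i, j) \<in> diagram \<mu> \<longleftrightarrow> i < length \<mu> \<and> j < \<mu> ! i"
  by (simp add: diagram_def)

lemma diagram_eq_Sigma: "diagram \<mu> = (SIGMA i:{..<length \<mu>}. {..<\<mu> ! i})"
  by (auto simp: diagram_def)

lemma finite_diagram: "finite (diagram \<mu>)"
  by (simp add: diagram_eq_Sigma)

lemma card_diagram: "card (diagram \<mu>) = sum_list \<mu>"
  by (simp add: diagram_eq_Sigma sum_list_sum_nth atLeast0LessThan)

lemma diagram_column_bound: "(i, j) \<in> diagram \<mu> \<Longrightarrow> j < sum_list \<mu>"
  using member_le_sum_list[of "\<mu> ! i" \<mu>] by (auto simp: diagram_def)

lemma diagram_upward_closed:
  assumes "sorted_wrt (\<ge>) \<mu>" "(i, j) \<in> diagram \<mu>" "i' \<le> i"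
  shows "(i', j) \<in> diagram \<mu>"
  using assms sorted_wrt_nth_less[OF assms(1), of i' i] by (cases "i' = i") (auto simp: diagram_def)

lemma exists_tableau: "\<exists>t. tableau \<mu> t"
  unfolding tableau_def by (rule finite_same_card_bij) (simp_all add: finite_diagram card_diagram)

lemma tableau_transitive:
  assumes t: "tableau \<mu> t" and u: "tableau \<mu> u"
  obtains \<pi> where "\<pi> permutes {1..sum_list \<mu>}" "\<And>c. c \<in> diagram \<mu> \<Longrightarrow> \<pi> (t c) = u c"
proof
  let ?\<pi> = "\<lambda>x. if x \<in> {1..sum_list \<mu>} then u (inv_into (diagram \<mu>) t x) else x"
  show "?\<pi> permutes {1..sum_list \<mu>}"
  proof (rule bij_imp_permutes)
    have "bij_betw (u \<circ> inv_into (diagram \<mu>) t) {1..sum_list \<mu>} {1..sum_list \<mu>}"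
      using t u unfolding tableau_def by (blast intro: bij_betw_trans bij_betw_inv_into)
    then show "bij_betw ?\<pi> {1..sum_list \<mu>} {1..sum_list \<mu>}"
      by (rule bij_betw_cong[THEN iffD1, rotated]) simp
  qed auto
  show "?\<pi> (t c) = u c" if "c \<in> diagram \<mu>" for c
    using that t by (auto simp: tableau_def bij_betw_def)
qed

lemma tabloid_cong: "(\<And>c. c \<in> diagram \<mu> \<Longrightarrow> t c = u c) \<Longrightarrow> tabloid \<mu> t = tabloid \<mu> u"
  unfolding tabloid_def by (intro map_cong refl Collect_cong) metis

lemma column_stabilizer_subset: "column_stabilizer \<mu> t \<subseteq> carrier (sym_group (sum_list \<mu>))"
  by (auto simp: column_stabilizer_def sym_group_carrier)

lemma finite_column_stabilizer: "finite (column_stabilizer \<mu> t)"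
  by (rule finite_subset[OF _ finite_permutations[of "{1..sum_list \<mu>}"]])
    (auto simp: column_stabilizer_def)

lemma id_in_column_stabilizer: "id \<in> column_stabilizer \<mu> t"
  by (simp add: column_stabilizer_def permutes_id)

lemma column_stabilizer_compose:
  "\<sigma> \<in> column_stabilizer \<mu> t \<Longrightarrow> \<tau> \<in> column_stabilizer \<mu> t \<Longrightarrow> \<sigma> \<circ> \<tau> \<in> column_stabilizer \<mu> t"
  unfolding column_stabilizer_def by (simp only: mem_Collect_eq image_comp [symmetric] permutes_compose) simp

lemma column_stabilizer_inv:
  assumes "\<sigma> \<in> column_stabilizer \<mu> t"
  shows "inv_into UNIV \<sigma> \<in> column_stabilizer \<mu> t"
proof -
  have \<sigma>: "\<sigma> permutes {1..sum_list \<mu>}" "\<And>j. \<sigma> ` column \<mu> t j = column \<mu> t j"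
    using assms by (auto simp: column_stabilizer_def)
  have "inv_into UNIV \<sigma> ` column \<mu> t j = column \<mu> t j" for j
  proof -
    have "inv_into UNIV \<sigma> ` column \<mu> t j = inv_into UNIV \<sigma> ` \<sigma> ` column \<mu> t j" by (simp only: \<sigma>(2))
    then show ?thesis by (simp add: image_image permutes_inverses[OF \<sigma>(1)])
  qed
  then show ?thesis using permutes_inv[OF \<sigma>(1)] by (simp add: column_stabilizer_def)
qed

lemma bij_betw_column_stabilizer_compose:
  assumes \<tau>: "\<tau> \<in> column_stabilizer \<mu> t"
  shows "bij_betw (\<lambda>\<sigma>. \<sigma> \<circ> \<tau>) (column_stabilizer \<mu> t) (column_stabilizer \<mu> t)"
proof (rule bij_betw_byWitness[where f' = "\<lambda>\<sigma>. \<sigma> \<circ> inv_into UNIV \<tau>"])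
  have "\<tau> permutes {1..sum_list \<mu>}" using \<tau> by (simp add: column_stabilizer_def)
  note inv = permutes_inv_o[OF this]
  show "\<forall>\<sigma>\<in>column_stabilizer \<mu> t. \<sigma> \<circ> \<tau> \<circ> inv_into UNIV \<tau> = \<sigma>"
    "\<forall>\<sigma>\<in>column_stabilizer \<mu> t. \<sigma> \<circ> inv_into UNIV \<tau> \<circ> \<tau> = \<sigma>"
    by (simp_all add: comp_assoc inv)
qed (use \<tau> column_stabilizer_compose column_stabilizer_inv in auto)

lemma column_stabilizer_cell:
  assumes "\<sigma> \<in> column_stabilizer \<mu> t" "(i, j) \<in> diagram \<mu>"
  obtains i' where "(i', j) \<in> diagram \<mu>" "\<sigma> (t (i, j)) = t (i', j)"
proof -
  have "t (i, j) \<in> column \<mu> t j" using assms(2) by (auto simp: column_def)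
  then have "\<sigma> (t (i, j)) \<in> column \<mu> t j" using assms(1) by (auto simp: column_stabilizer_def)
  then show ?thesis using that by (auto simp: column_def)
qed

lemma column_stabilizerI:
  assumes \<sigma>: "\<sigma> permutes {1..sum_list \<mu>}"
    and cell: "\<And>i j. (i, j) \<in> diagram \<mu> \<Longrightarrow> \<exists>i'. (i', j) \<in> diagram \<mu> \<and> \<sigma> (t (i, j)) = t (i', j)"
  shows "\<sigma> \<in> column_stabilizer \<mu> t"
proof -
  have "\<sigma> ` column \<mu> t j = column \<mu> t j" for j
  proof (rule card_subset_eq)
    have "column \<mu> t j \<subseteq> t ` diagram \<mu>" by (auto simp: column_def)
    then show "finite (column \<mu> t j)" using finite_diagram finite_subset by blast
    show "\<sigma> ` column \<mu> t j \<subseteq> column \<mu> t j" using cell by (fastforce simp: column_def)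
    show "card (\<sigma> ` column \<mu> t j) = card (column \<mu> t j)"
      by (rule card_image[OF inj_on_subset[OF permutes_inj[OF \<sigma>] subset_UNIV]])
  qed
  then show ?thesis using \<sigma> by (simp add: column_stabilizer_def)
qed

section \<open>Comparing shapes through a column-separating tabloid\<close>
text \<open>These are the partial sums of the parts; comparing them for all \<open>r\<close> is the dominance order.\<close>
definition cells_above :: "nat list \<Rightarrow> nat \<Rightarrow> nat" where
  "cells_above \<mu> r = card {c \<in> diagram \<mu>. fst c < r}"

lemma cells_above_Suc: "cells_above \<mu> (Suc r) = cells_above \<mu> r + (if r < length \<mu> then \<mu> ! r else 0)"
proof -
  have split: "{c \<in> diagram \<mu>. fst c < Suc r} = {c \<in> diagram \<mu>. fst c < r} \<union> {c \<in> diagram \<mu>. fst c = r}"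
    by auto
  have "{c \<in> diagram \<mu>. fst c = r} = (if r < length \<mu> then {r} \<times> {..<\<mu> ! r} else {})"
    by (auto simp: diagram_def)
  then have "card {c \<in> diagram \<mu>. fst c = r} = (if r < length \<mu> then \<mu> ! r else 0)" by simp
  then show ?thesis
    unfolding cells_above_def split by (subst card_Un_disjoint) (auto simp: finite_diagram)
qed

lemma eq_if_cells_above_eq:
  assumes "0 \<notin> set \<nu>" "0 \<notin> set \<mu>" and eq: "\<And>r. cells_above \<nu> r = cells_above \<mu> r"
  shows "\<nu> = \<mu>"
proof -
  have row: "(if r < length \<nu> then \<nu> ! r else 0) = (if r < length \<mu> then \<mu> ! r else 0)" for r
    using eq[of "Suc r"] eq[of r] by (simp add: cells_above_Suc)
  have pos: "r < length \<nu> \<Longrightarrow> \<nu> ! r \<noteq> 0" "r < length \<mu> \<Longrightarrow> \<mu> ! r \<noteq> 0" for r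
    using assms(1,2) nth_mem by metis+
  have "r < length \<nu> \<longleftrightarrow> r < length \<mu>" for r
    using row[of r] pos[of r] by (auto split: if_splits)
  then have "length \<nu> = length \<mu>" by (metis nat_neq_iff)
  then show ?thesis
  proof (rule nth_equalityI)
    show "\<nu> ! i = \<mu> ! i" if "i < length \<nu>" for i
      using row[of i] that \<open>length \<nu> = length \<mu>\<close> by simp
  qed
qed

lemma card_diagram_columns:
  "card {c \<in> diagram \<nu>. P c} = (\<Sum>j<sum_list \<nu>. card {i. (i, j) \<in> diagram \<nu> \<and> P (i, j)})"
proof -
  have fin: "finite {i. (i, j) \<in> diagram \<nu> \<and> P (i, j)}" for j
    by (rule finite_subset[of _ "{..<length \<nu>}"]) (auto simp: diagram_def)
  have "bij_betw (\<lambda>(j, i). (i, j)) (SIGMA j:{..<sum_list \<nu>}. {i. (i, j) \<in> diagram \<nu> \<and> P (i, j)})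
      {c \<in> diagram \<nu>. P c}"
    by (rule bij_betw_byWitness[where f' = "\<lambda>(i, j). (j, i)"]) (auto dest: diagram_column_bound)
  from bij_betw_same_card[OF this] show ?thesis by (simp add: fin)
qed

text \<open>In the applications \<open>p\<close> gives the row, in a second tableau, of the entry that a tableau of shape \<open>\<nu>\<close>
has in the given cell; the two tableaux may have different shapes.\<close>
locale column_separated =
  fixes \<nu> :: "nat list" and p :: "nat \<times> nat \<Rightarrow> nat"
  assumes sorted: "sorted_wrt (\<ge>) \<nu>"
    and separated: "(i, j) \<in> diagram \<nu> \<Longrightarrow> (i', j) \<in> diagram \<nu> \<Longrightarrow> p (i, j) = p (i', j) \<Longrightarrow> i = i'"
begin

text \<open>A column either lies completely above row \<open>r\<close>, or has \<open>r\<close> cells above row \<open>r\<close>. In the second case the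
values of \<open>p\<close> below \<open>r\<close> are distinct on the column, so there are at most \<open>r\<close> of them.\<close>
lemma card_column_above_le:
  "card {i. (i, j) \<in> diagram \<nu> \<and> p (i, j) < r} \<le> card {i. (i, j) \<in> diagram \<nu> \<and> i < r}"
proof (cases "{i. (i, j) \<in> diagram \<nu>} \<subseteq> {..<r}")
  case True
  show ?thesis
    by (rule card_mono) (use True finite_subset in auto)
next
  case False
  then obtain k where "(k, j) \<in> diagram \<nu>" "r \<le> k"
    by (metis (no_types, lifting) lessThan_iff mem_Collect_eq not_less subsetI)
  then have "{i. (i, j) \<in> diagram \<nu> \<and> i < r} = {..<r}"
    using diagram_upward_closed[OF sorted] by (auto intro: order.strict_implies_order)
  moreover have "inj_on (\<lambda>i. p (i, j)) {i. (i, j) \<in> diagram \<nu> \<and> p (i, j) < r}"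
    using separated by (auto intro!: inj_onI)
  then have "card {i. (i, j) \<in> diagram \<nu> \<and> p (i, j) < r} \<le> card {..<r}"
    by (rule card_inj_on_le) auto
  ultimately show ?thesis by simp
qed

lemma card_above_le: "card {c \<in> diagram \<nu>. p c < r} \<le> cells_above \<nu> r"
  unfolding cells_above_def card_diagram_columns fst_conv by (intro sum_mono card_column_above_le)

text \<open>Equality of the totals forces equality in every column. So, as far as the column reaches, raising the
bound \<open>r\<close> by one must add exactly one cell.\<close>
lemma row_in_column:
  assumes eq: "\<And>r. card {c \<in> diagram \<nu>. p c < r} = cells_above \<nu> r" and r: "(r, j) \<in> diagram \<nu>"
  shows "\<exists>i. (i, j) \<in> diagram \<nu> \<and> p (i, j) = r"
proof -
  have col: "card {i. (i, j) \<in> diagram \<nu> \<and> p (i, j) < s} = s" if "s \<le> Suc r" for s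
  proof -
    have "card {i. (i, k) \<in> diagram \<nu> \<and> p (i, k) < s} = card {i. (i, k) \<in> diagram \<nu> \<and> i < s}"
      if "k < sum_list \<nu>" for k
    proof (rule antisym[OF card_column_above_le], rule ccontr)
      assume "\<not> card {i. (i, k) \<in> diagram \<nu> \<and> i < s} \<le> card {i. (i, k) \<in> diagram \<nu> \<and> p (i, k) < s}"
      then have "(\<Sum>j<sum_list \<nu>. card {i. (i, j) \<in> diagram \<nu> \<and> p (i, j) < s}) <
          (\<Sum>j<sum_list \<nu>. card {i. (i, j) \<in> diagram \<nu> \<and> i < s})"
        using that
        by (intro sum_strict_mono_ex1) (auto simp: card_column_above_le not_le intro!: bexI[of _ k])
      then show False
        using eq[of s] unfolding cells_above_def card_diagram_columns by simp
    qed
    moreover have "{i. (i, j) \<in> diagram \<nu> \<and> i < s} = {..<s}"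
      using diagram_upward_closed[OF sorted r] that by auto
    ultimately show ?thesis using diagram_column_bound[OF r] by simp
  qed
  have "{i. (i, j) \<in> diagram \<nu> \<and> p (i, j) < Suc r} \<noteq> {i. (i, j) \<in> diagram \<nu> \<and> p (i, j) < r}"
    using col[of r] col[of "Suc r"] by force
  then show ?thesis by (auto simp: less_Suc_eq)
qed

end

abbreviation tabloid_rep :: "nat list \<Rightarrow> (nat \<Rightarrow> nat, nat set list \<Rightarrow> complex) crep" where
  "tabloid_rep \<mu> \<equiv> perm_rep (tabloids \<mu>) tabloid_act"

abbreviation column_antisymmetrize :: "nat list \<Rightarrow> (nat \<times> nat \<Rightarrow> nat) \<Rightarrow>
    (nat \<Rightarrow> nat, 'v::complex_vector) crep \<Rightarrow> 'v \<Rightarrow> 'v" where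
  "column_antisymmetrize \<mu> t \<equiv> antisymmetrize (column_stabilizer \<mu> t)"

definition row_of :: "nat list \<Rightarrow> (nat \<times> nat \<Rightarrow> nat) \<Rightarrow> nat \<Rightarrow> nat" where
  "row_of \<mu> u x = fst (inv_into (diagram \<mu>) u x)"

lemma row_of_cell: "tableau \<mu> u \<Longrightarrow> (i, j) \<in> diagram \<mu> \<Longrightarrow> row_of \<mu> u (u (i, j)) = i"
  by (simp add: row_of_def tableau_def bij_betw_def inv_into_f_f)

lemma tabloid_eq_rows:
  assumes u: "tableau \<mu> u"
  shows "tabloid \<mu> u = map (\<lambda>i. {x \<in> {1..sum_list \<mu>}. row_of \<mu> u x = i}) [0..<length \<mu>]"
proof -
  have "{u (i, j) |j. (i, j) \<in> diagram \<mu>} = {x \<in> {1..sum_list \<mu>}. row_of \<mu> u x = i}" for i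
  proof (intro equalityI subsetI)
    fix x assume "x \<in> {u (i, j) |j. (i, j) \<in> diagram \<mu>}"
    then show "x \<in> {x \<in> {1..sum_list \<mu>}. row_of \<mu> u x = i}"
      using u row_of_cell[OF u] by (auto simp: tableau_def dest: bij_betwE)
  next
    fix x assume x: "x \<in> {x \<in> {1..sum_list \<mu>}. row_of \<mu> u x = i}"
    then have "x \<in> u ` diagram \<mu>" using u by (simp add: tableau_def bij_betw_def)
    then obtain c where "c \<in> diagram \<mu>" "x = u c" by blast
    then show "x \<in> {u (i, j) |j. (i, j) \<in> diagram \<mu>}"
      using x row_of_cell[OF u] by (cases c) auto
  qed
  then show ?thesis by (simp add: tabloid_def)
qed

lemma tabloid_act_transpose:
  assumes u: "tableau \<mu> u" and ab: "a \<in> {1..sum_list \<mu>}" "b \<in> {1..sum_list \<mu>}"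
    and row: "row_of \<mu> u a = row_of \<mu> u b"
  shows "tabloid_act (transpose a b) (tabloid \<mu> u) = tabloid \<mu> u"
proof -
  have "transpose a b ` A = A" if "a \<in> A \<longleftrightarrow> b \<in> A" for A
    using that by (cases "a \<in> A") (auto simp: transpose_image_eq)
  then show ?thesis
    using ab row by (simp add: tabloid_eq_rows[OF u] tabloid_act_def)
qed

lemma polytabloid_eq_antisymmetrize:
  assumes "tableau \<mu> t"
  shows "polytabloid \<mu> t = column_antisymmetrize \<mu> t (tabloid_rep \<mu>) (basis_vec (tabloid \<mu> t))"
proof -
  have "tabloid \<mu> t \<in> tabloids \<mu>" using assms by (auto simp: tabloids_def)
  then show ?thesis
    by (simp add: polytabloid_def antisymmetrize_def rep_act_perm_rep_basis_vec finite_tabloids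
        tabloid_act_tabloid)
qed

text \<open>Two entries of one column of \<open>t\<close> that share a row of \<open>u\<close> are exchanged by a transposition in the column
stabilizer that fixes the tabloid of \<open>u\<close>; then the antisymmetrizer kills that tabloid.\<close>
lemma separated_if_antisymmetrize_nonzero:
  assumes t: "tableau \<nu> t" and u: "tableau \<mu> u" and size: "sum_list \<mu> = sum_list \<nu>"
    and nz: "column_antisymmetrize \<nu> t (tabloid_rep \<mu>) (basis_vec (tabloid \<mu> u)) \<noteq> 0"
    and cells: "(i, j) \<in> diagram \<nu>" "(i', j) \<in> diagram \<nu>"
    and row: "row_of \<mu> u (t (i, j)) = row_of \<mu> u (t (i', j))"
  shows "i = i'"
proof (rule ccontr)
  assume "i \<noteq> i'"
  let ?n = "sum_list \<nu>" and ?a = "t (i, j)" and ?b = "t (i', j)" and ?s = "tabloid \<mu> u"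
  let ?\<tau> = "transpose ?a ?b"
  interpret perm_action "sym_group ?n" "tabloids \<mu>" tabloid_act
    using perm_action_tabloids[of \<mu>] size by simp
  have inj: "inj_on t (diagram \<nu>)" using t by (simp add: tableau_def bij_betw_def)
  have ne: "?a \<noteq> ?b" using inj cells \<open>i \<noteq> i'\<close> by (auto dest: inj_onD)
  have ab: "?a \<in> {1..?n}" "?b \<in> {1..?n}" using t cells by (auto simp: tableau_def dest: bij_betwE)
  have perm: "?\<tau> permutes {1..?n}" using ab by (rule permutes_swap_id)
  have "?\<tau> \<in> column_stabilizer \<nu> t"
  proof (rule column_stabilizerI[OF perm])
    fix k l assume kl: "(k, l) \<in> diagram \<nu>"
    consider "t (k, l) = ?a" | "t (k, l) = ?b" | "?\<tau> (t (k, l)) = t (k, l)"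
      by (metis transpose_apply_other)
    then show "\<exists>k'. (k', l) \<in> diagram \<nu> \<and> ?\<tau> (t (k, l)) = t (k', l)"
      using inj_onD[OF inj _ kl cells(1)] inj_onD[OF inj _ kl cells(2)] cells kl
      by cases auto
  qed
  then have bij: "bij_betw (\<lambda>\<sigma>. \<sigma> \<circ> ?\<tau>) (column_stabilizer \<nu> t) (column_stabilizer \<nu> t)"
    by (rule bij_betw_column_stabilizer_compose)
  have s: "?s \<in> tabloids \<mu>" using u by (auto simp: tabloids_def)
  have "rep_act (tabloid_rep \<mu>) ?\<tau> (basis_vec ?s) = basis_vec ?s"
    using tabloid_act_transpose[OF u _ _ row] ab size
    by (simp add: rep_act_perm_rep_basis_vec[OF finite_tabloids s])
  moreover have "sign ?\<tau> = -1" using ne by (simp add: sign_swap_id)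
  ultimately show False
    using antisymmetrize_eq_0[OF is_rep basis_vec_in_perm_rep[OF s] column_stabilizer_subset perm bij] nz
    by simp
qed

lemma card_bij_betw_Collect:
  assumes "bij_betw f A B"
  shows "card {x \<in> A. P (f x)} = card {y \<in> B. P y}"
proof -
  have "bij_betw f {x \<in> A. P (f x)} {y \<in> B. P y}"
    using assms by (auto simp: bij_betw_def inj_on_def)
  then show ?thesis by (rule bij_betw_same_card)
qed

lemma card_cells_row_of:
  assumes t: "tableau \<nu> t" and u: "tableau \<mu> u" and size: "sum_list \<mu> = sum_list \<nu>"
  shows "card {c \<in> diagram \<nu>. row_of \<mu> u (t c) < r} = cells_above \<mu> r"
proof -
  have "bij_betw (inv_into (diagram \<mu>) u \<circ> t) (diagram \<nu>) (diagram \<mu>)"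
    using t u size unfolding tableau_def by (metis bij_betw_inv_into bij_betw_trans)
  from card_bij_betw_Collect[OF this, of "\<lambda>c. fst c < r"] show ?thesis
    by (simp add: row_of_def cells_above_def)
qed

lemma cells_above_le_if_antisymmetrize_nonzero:
  assumes t: "tableau \<nu> t" and s: "s \<in> tabloids \<mu>" and size: "sum_list \<mu> = sum_list \<nu>"
    and sorted: "sorted_wrt (\<ge>) \<nu>"
    and nz: "column_antisymmetrize \<nu> t (tabloid_rep \<mu>) (basis_vec s) \<noteq> 0"
  shows "cells_above \<mu> r \<le> cells_above \<nu> r"
proof -
  obtain u where u: "tableau \<mu> u" "s = tabloid \<mu> u" using s by (auto simp: tabloids_def)
  interpret column_separated \<nu> "\<lambda>c. row_of \<mu> u (t c)"
    using sorted separated_if_antisymmetrize_nonzero[OF t u(1) size nz[unfolded u(2)]]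
    by unfold_locales
  show ?thesis using card_above_le[of r] card_cells_row_of[OF t u(1) size] by simp
qed

text \<open>Each column of \<open>t\<close> meets every row of \<open>u\<close> that it reaches exactly once, so its entries can be
rearranged within the column until each one lies in the row in which \<open>u\<close> has it. The map \<open>\<beta>\<close> sends the
cell of an entry of \<open>t\<close> to the cell where it has to go.\<close>
lemma tabloid_eq_column_permuted:
  assumes t: "tableau \<mu> t" and u: "tableau \<mu> u" and sorted: "sorted_wrt (\<ge>) \<mu>"
    and sep: "\<And>i i' j. (i, j) \<in> diagram \<mu> \<Longrightarrow> (i', j) \<in> diagram \<mu> \<Longrightarrow>
      row_of \<mu> u (t (i, j)) = row_of \<mu> u (t (i', j)) \<Longrightarrow> i = i'"
  shows "\<exists>\<sigma>\<in>column_stabilizer \<mu> t. tabloid \<mu> (\<sigma> \<circ> t) = tabloid \<mu> u"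
proof -
  let ?D = "diagram \<mu>"
  interpret column_separated \<mu> "\<lambda>c. row_of \<mu> u (t c)"
    using sorted sep by unfold_locales
  define \<beta> where "\<beta> c = (row_of \<mu> u (t c), snd c)" for c
  have inj: "inj_on \<beta> ?D"
    by (rule inj_onI) (use sep in \<open>force simp: \<beta>_def\<close>)
  have "?D \<subseteq> \<beta> ` ?D"
  proof
    fix c assume "c \<in> ?D"
    then obtain i where "(i, snd c) \<in> ?D" "row_of \<mu> u (t (i, snd c)) = fst c"
      using row_in_column[of "fst c" "snd c"] card_cells_row_of[OF t u] by auto
    then have "c = \<beta> (i, snd c)" by (simp add: \<beta>_def)
    then show "c \<in> \<beta> ` ?D" using \<open>(i, snd c) \<in> ?D\<close> by blast
  qed
  then have "?D = \<beta> ` ?D"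
    by (intro card_subset_eq) (simp_all add: finite_diagram card_image[OF inj])
  then have \<beta>: "bij_betw \<beta> ?D ?D" using inj by (simp add: bij_betw_def)
  define t' where "t' = t \<circ> inv_into ?D \<beta>"
  have t': "tableau \<mu> t'"
    using t bij_betw_inv_into[OF \<beta>] unfolding tableau_def t'_def by (rule bij_betw_trans[rotated])
  have t'_\<beta>: "t' (\<beta> c) = t c" if "c \<in> ?D" for c
    using that inj by (simp add: t'_def inv_into_f_f)
  obtain \<sigma> where \<sigma>: "\<sigma> permutes {1..sum_list \<mu>}" "\<And>c. c \<in> ?D \<Longrightarrow> \<sigma> (t c) = t' c"
    using tableau_transitive[OF t t'] by blast
  show ?thesis
  proof (rule bexI[of _ \<sigma>])
    show "\<sigma> \<in> column_stabilizer \<mu> t"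
    proof (rule column_stabilizerI[OF \<sigma>(1)])
      fix i j assume ij: "(i, j) \<in> ?D"
      then obtain c where c: "c \<in> ?D" "(i, j) = \<beta> c" using \<open>?D = \<beta> ` ?D\<close> by blast
      then have "c = (fst c, j)" by (auto simp: \<beta>_def prod_eq_iff)
      then show "\<exists>i'. (i', j) \<in> ?D \<and> \<sigma> (t (i, j)) = t (i', j)"
        using c \<sigma>(2)[OF ij] t'_\<beta>[OF c(1)] by metis
    qed
    have "tabloid \<mu> (\<sigma> \<circ> t) = tabloid \<mu> t'" by (rule tabloid_cong) (simp add: \<sigma>(2))
    moreover have "row_of \<mu> t' x = row_of \<mu> u x" if "x \<in> {1..sum_list \<mu>}" for x
    proof -
      have "x \<in> t ` ?D" using that t by (simp add: tableau_def bij_betw_def)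
      then obtain c where c: "c \<in> ?D" "x = t c" by blast
      then have "\<beta> c \<in> ?D" using \<open>?D = \<beta> ` ?D\<close> by blast
      then show ?thesis
        using row_of_cell[OF t', of "fst (\<beta> c)" "snd (\<beta> c)"] t'_\<beta>[OF c(1)] c(2) by (simp add: \<beta>_def)
    qed
    then have "tabloid \<mu> t' = tabloid \<mu> u"
      by (auto simp: tabloid_eq_rows[OF t'] tabloid_eq_rows[OF u])
    ultimately show "tabloid \<mu> (\<sigma> \<circ> t) = tabloid \<mu> u" by simp
  qed
qed

text \<open>A tabloid is either killed, or it is a column permutation of the tabloid of \<open>t\<close> and then yields the
polytabloid of \<open>t\<close> up to sign.\<close>
lemma column_antisymmetrize_multiple:
  assumes t: "tableau \<mu> t" and sorted: "sorted_wrt (\<ge>) \<mu>" and f: "f \<in> rep_space (tabloid_rep \<mu>)"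
  shows "\<exists>c. column_antisymmetrize \<mu> t (tabloid_rep \<mu>) f = c *\<^sub>C polytabloid \<mu> t"
proof -
  interpret perm_action "sym_group (sum_list \<mu>)" "tabloids \<mu>" tabloid_act
    by (rule perm_action_tabloids)
  have "\<exists>c. column_antisymmetrize \<mu> t (tabloid_rep \<mu>) (basis_vec s) = c *\<^sub>C polytabloid \<mu> t"
    if s: "s \<in> tabloids \<mu>" for s
  proof (cases "column_antisymmetrize \<mu> t (tabloid_rep \<mu>) (basis_vec s) = 0")
    case True
    then show ?thesis by (intro exI[of _ 0]) simp
  next
    case False
    obtain u where u: "tableau \<mu> u" "s = tabloid \<mu> u" using s by (auto simp: tabloids_def)
    have sep: "i = i'" if "(i, j) \<in> diagram \<mu>" "(i', j) \<in> diagram \<mu>"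
      "row_of \<mu> u (t (i, j)) = row_of \<mu> u (t (i', j))" for i i' j
      by (rule separated_if_antisymmetrize_nonzero[OF t u(1) refl False[unfolded u(2)] that])
    obtain \<sigma> where \<sigma>: "\<sigma> \<in> column_stabilizer \<mu> t" "tabloid \<mu> (\<sigma> \<circ> t) = s"
    proof -
      have "\<exists>\<sigma>\<in>column_stabilizer \<mu> t. tabloid \<mu> (\<sigma> \<circ> t) = tabloid \<mu> u"
        by (rule tabloid_eq_column_permuted[OF t u(1) sorted]) (rule sep)
      then show ?thesis using that u(2) by blast
    qed
    have perm: "\<sigma> permutes {1..sum_list \<mu>}" using \<sigma>(1) by (simp add: column_stabilizer_def)
    have ts: "tabloid \<mu> t \<in> tabloids \<mu>" using t by (auto simp: tabloids_def)
    have "basis_vec s = rep_act (tabloid_rep \<mu>) \<sigma> (basis_vec (tabloid \<mu> t))"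
      by (simp add: rep_act_perm_rep_basis_vec[OF finite_tabloids ts] tabloid_act_tabloid \<sigma>(2))
    then show ?thesis
      using antisymmetrize_act[OF is_rep basis_vec_in_perm_rep[OF ts] column_stabilizer_subset perm
          bij_betw_column_stabilizer_compose[OF \<sigma>(1)]] polytabloid_eq_antisymmetrize[OF t] by auto
  qed
  then obtain c where c: "\<And>s. s \<in> tabloids \<mu> \<Longrightarrow>
      column_antisymmetrize \<mu> t (tabloid_rep \<mu>) (basis_vec s) = c s *\<^sub>C polytabloid \<mu> t"
    by metis
  have "column_antisymmetrize \<mu> t (tabloid_rep \<mu>) f =
      column_antisymmetrize \<mu> t (tabloid_rep \<mu>) (\<Sum>s\<in>tabloids \<mu>. f s *\<^sub>C basis_vec s)"
    using perm_rep_expand[OF f] by simp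
  also have "\<dots> = (\<Sum>s\<in>tabloids \<mu>. f s *\<^sub>C c s *\<^sub>C polytabloid \<mu> t)"
    by (subst antisymmetrize_sum[OF is_rep column_stabilizer_subset basis_vec_in_perm_rep])
      (simp_all add: c)
  also have "\<dots> = (\<Sum>s\<in>tabloids \<mu>. f s * c s) *\<^sub>C polytabloid \<mu> t"
    by (simp add: complex_vector.scale_sum_left)
  finally show ?thesis by blast
qed

section \<open>Specht modules are irreducible and pairwise nonisomorphic\<close>
lemma specht_space: "rep_space (specht \<mu>) = cspan {polytabloid \<mu> t | t. tableau \<mu> t}"
  by (simp add: specht_def)

lemma specht_act: "rep_act (specht \<mu>) = rep_act (tabloid_rep \<mu>)"
  by (simp add: specht_def)

lemma antisymmetrize_specht: "antisymmetrize C (specht \<mu>) = antisymmetrize C (tabloid_rep \<mu>)"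
  by (intro ext) (simp add: antisymmetrize_def specht_act)

lemma polytabloid_in_specht: "tableau \<mu> t \<Longrightarrow> polytabloid \<mu> t \<in> rep_space (specht \<mu>)"
  unfolding specht_space by (rule complex_vector.span_base) blast

lemma polytabloid_in_tabloid_rep:
  assumes t: "tableau \<mu> t"
  shows "polytabloid \<mu> t \<in> rep_space (tabloid_rep \<mu>)"
proof -
  interpret perm_action "sym_group (sum_list \<mu>)" "tabloids \<mu>" tabloid_act
    by (rule perm_action_tabloids)
  have ts: "tabloid \<mu> t \<in> tabloids \<mu>" using t by (auto simp: tabloids_def)
  have "subrep (sym_group (sum_list \<mu>)) (tabloid_rep \<mu>) (rep_space (tabloid_rep \<mu>))"
    using is_repD(2,3)[OF is_rep] by (simp add: subrep_def)
  then show ?thesis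
    unfolding polytabloid_eq_antisymmetrize[OF t]
    by (rule antisymmetrize_in_subrep[OF _ column_stabilizer_subset basis_vec_in_perm_rep[OF ts]])
qed

lemma specht_subset_tabloid_rep: "rep_space (specht \<mu>) \<subseteq> rep_space (tabloid_rep \<mu>)"
  unfolding specht_space
  using is_repD(2)[OF is_rep_tabloids] polytabloid_in_tabloid_rep
  by (intro complex_vector.span_minimal) auto

lemma rep_hom_specht_inclusion:
  "rep_hom (sym_group (sum_list \<mu>)) (specht \<mu>) (tabloid_rep \<mu>) (\<lambda>v. v)"
  by (rule rep_homI) (use specht_subset_tabloid_rep in \<open>auto simp: specht_act\<close>)

lemma polytabloid_apply:
  assumes t: "tableau \<mu> t"
  shows "polytabloid \<mu> t s =
    (\<Sum>\<sigma>\<in>column_stabilizer \<mu> t. if tabloid \<mu> (\<sigma> \<circ> t) = s then of_int (sign \<sigma>) else 0)"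
  unfolding polytabloid_def
  by (auto simp: sum_fun_apply scaleC_fun_def scaleC_complex_def basis_vec_def intro!: sum.cong)

text \<open>A column permutation that also preserves the rows fixes every cell, so only the identity contributes.\<close>
lemma polytabloid_nonzero:
  assumes t: "tableau \<mu> t"
  shows "polytabloid \<mu> t (tabloid \<mu> t) = 1"
proof -
  have "\<sigma> = id" if \<sigma>: "\<sigma> \<in> column_stabilizer \<mu> t" and eq: "tabloid \<mu> (\<sigma> \<circ> t) = tabloid \<mu> t" for \<sigma>
  proof
    fix x
    have perm: "\<sigma> permutes {1..sum_list \<mu>}" using \<sigma> by (simp add: column_stabilizer_def)
    show "\<sigma> x = id x"
    proof (cases "x \<in> {1..sum_list \<mu>}")
      case True
      then have "x \<in> t ` diagram \<mu>" using t by (simp add: tableau_def bij_betw_def)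
      then obtain i j where c: "(i, j) \<in> diagram \<mu>" "x = t (i, j)" by auto
      obtain i' where i': "(i', j) \<in> diagram \<mu>" "\<sigma> (t (i, j)) = t (i', j)"
        using column_stabilizer_cell[OF \<sigma> c(1)] by blast
      have len: "i < length \<mu>" using c(1) by (simp add: mem_diagram)
      have "\<sigma> (t (i, j)) \<in> tabloid \<mu> (\<sigma> \<circ> t) ! i"
        using c(1) len by (auto simp: tabloid_def)
      then have "row_of \<mu> t (\<sigma> (t (i, j))) = i"
        using len by (simp add: eq tabloid_eq_rows[OF t])
      then have "i' = i" using row_of_cell[OF t i'(1)] i'(2) by simp
      then show ?thesis using i'(2) c(2) by simp
    qed (use perm in \<open>simp add: permutes_not_in\<close>)
  qed
  then have "polytabloid \<mu> t (tabloid \<mu> t) =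
      (\<Sum>\<sigma>\<in>column_stabilizer \<mu> t. if \<sigma> = id then 1 else 0)"
    unfolding polytabloid_apply[OF t] by (intro sum.cong refl) (auto simp: sign_id)
  then show ?thesis
    using id_in_column_stabilizer finite_column_stabilizer by simp
qed

lemma antisymmetrize_polytabloid:
  assumes t: "tableau \<mu> t"
  shows "column_antisymmetrize \<mu> t (tabloid_rep \<mu>) (polytabloid \<mu> t) =
    of_nat (card (column_stabilizer \<mu> t)) *\<^sub>C polytabloid \<mu> t"
proof -
  interpret perm_action "sym_group (sum_list \<mu>)" "tabloids \<mu>" tabloid_act
    by (rule perm_action_tabloids)
  let ?C = "column_stabilizer \<mu> t" and ?b = "basis_vec (tabloid \<mu> t)"
  have b: "?b \<in> rep_space (tabloid_rep \<mu>)"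
    using t by (intro basis_vec_in_perm_rep) (auto simp: tabloids_def)
  have "column_antisymmetrize \<mu> t (tabloid_rep \<mu>) (polytabloid \<mu> t) =
      (\<Sum>\<sigma>\<in>?C. of_int (sign \<sigma>) *\<^sub>C antisymmetrize ?C (tabloid_rep \<mu>) (rep_act (tabloid_rep \<mu>) \<sigma> ?b))"
    unfolding polytabloid_eq_antisymmetrize[OF t]
    unfolding antisymmetrize_def[of _ _ ?b]
    by (rule antisymmetrize_sum[OF is_rep column_stabilizer_subset])
      (use column_stabilizer_subset is_repD(3)[OF is_rep _ b] in blast)
  also have "\<dots> = (\<Sum>\<sigma>\<in>?C. polytabloid \<mu> t)"
  proof (intro sum.cong refl)
    fix \<sigma> assume \<sigma>: "\<sigma> \<in> ?C"
    then have perm: "\<sigma> permutes {1..sum_list \<mu>}" by (simp add: column_stabilizer_def)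
    have "complex_of_int (sign \<sigma>) * of_int (sign \<sigma>) = 1" by (simp add: sign_def)
    then show "of_int (sign \<sigma>) *\<^sub>C antisymmetrize ?C (tabloid_rep \<mu>) (rep_act (tabloid_rep \<mu>) \<sigma> ?b) =
        polytabloid \<mu> t"
      by (simp add: antisymmetrize_act[OF is_rep b column_stabilizer_subset perm
            bij_betw_column_stabilizer_compose[OF \<sigma>]] polytabloid_eq_antisymmetrize[OF t])
  qed
  also have "\<dots> = of_nat (card ?C) *\<^sub>C polytabloid \<mu> t"
    by (subst complex_vector.sum_constant_scale) (rule refl)
  finally show ?thesis .
qed

text \<open>The antisymmetrizer is self-adjoint for the bilinear form in which the tabloids are orthonormal, so this
is the pairing of \<open>f\<close> with the polytabloid of \<open>t\<close>.\<close>
lemma antisymmetrize_apply_tabloid: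
  assumes t: "tableau \<mu> t" and f: "f \<in> rep_space (tabloid_rep \<mu>)"
  shows "column_antisymmetrize \<mu> t (tabloid_rep \<mu>) f (tabloid \<mu> t) =
    (\<Sum>s\<in>tabloids \<mu>. f s * polytabloid \<mu> t s)"
proof -
  interpret perm_action "sym_group (sum_list \<mu>)" "tabloids \<mu>" tabloid_act
    by (rule perm_action_tabloids)
  let ?C = "column_stabilizer \<mu> t" and ?s = "tabloid \<mu> t"
  have s: "?s \<in> tabloids \<mu>" using t by (auto simp: tabloids_def)
  have bij: "bij_betw (inv_into UNIV) ?C ?C"
    by (rule bij_betw_byWitness[where f' = "inv_into UNIV"])
      (auto simp: column_stabilizer_inv, auto simp: column_stabilizer_def permutes_inv_inv)
  have "column_antisymmetrize \<mu> t (tabloid_rep \<mu>) f ?s =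
      (\<Sum>\<sigma>\<in>?C. of_int (sign (inv_into UNIV \<sigma>)) * f (tabloid_act (inv_into UNIV \<sigma>) ?s))"
    unfolding antisymmetrize_def sum_fun_apply
  proof (intro sum.cong refl)
    fix \<sigma> assume "\<sigma> \<in> ?C"
    then have \<sigma>: "\<sigma> permutes {1..sum_list \<mu>}" by (simp add: column_stabilizer_def)
    then have \<sigma>G: "\<sigma> \<in> carrier (sym_group (sum_list \<mu>))" by (simp add: sym_group_carrier)
    have "inv\<^bsub>sym_group (sum_list \<mu>)\<^esub> \<sigma> = inv_into UNIV \<sigma>"
      by (rule group.inv_equality[OF group])
        (use \<sigma> permutes_inv_o[OF \<sigma>] permutes_inv[OF \<sigma>] in \<open>simp_all add: sym_group_def\<close>)
    moreover have "sign (inv_into UNIV \<sigma>) = sign \<sigma>"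
      using \<sigma> by (intro sign_inverse) (auto simp: permutation_permutes)
    ultimately show "(of_int (sign \<sigma>) *\<^sub>C rep_act (tabloid_rep \<mu>) \<sigma> f) ?s =
        of_int (sign (inv_into UNIV \<sigma>)) * f (tabloid_act (inv_into UNIV \<sigma>) ?s)"
      by (simp add: scaleC_fun_def scaleC_complex_def perm_rep_apply[OF \<sigma>G] s)
  qed
  also have "\<dots> = (\<Sum>\<sigma>\<in>?C. of_int (sign \<sigma>) * f (tabloid \<mu> (\<sigma> \<circ> t)))"
    unfolding tabloid_act_tabloid
    by (rule sum.reindex_bij_betw[OF bij, of "\<lambda>\<sigma>. of_int (sign \<sigma>) * f (tabloid \<mu> (\<sigma> \<circ> t))"])
  also have "\<dots> = (\<Sum>\<sigma>\<in>?C. \<Sum>s\<in>tabloids \<mu>. if tabloid \<mu> (\<sigma> \<circ> t) = s then of_int (sign \<sigma>) * f s else 0)"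
  proof (intro sum.cong refl)
    fix \<sigma> assume "\<sigma> \<in> ?C"
    then have "tabloid \<mu> (\<sigma> \<circ> t) \<in> tabloids \<mu>"
      using tabloid_comp_in_tabloids[OF _ t] by (simp add: column_stabilizer_def)
    then show "of_int (sign \<sigma>) * f (tabloid \<mu> (\<sigma> \<circ> t)) =
        (\<Sum>s\<in>tabloids \<mu>. if tabloid \<mu> (\<sigma> \<circ> t) = s then of_int (sign \<sigma>) * f s else 0)"
      by (simp add: sum.delta' finite_set)
  qed
  also have "\<dots> = (\<Sum>s\<in>tabloids \<mu>. f s * polytabloid \<mu> t s)"
    by (subst sum.swap) (auto simp: polytabloid_apply[OF t] sum_distrib_left intro!: sum.cong)
  finally show ?thesis .
qed

text \<open>Such an \<open>f\<close> is orthogonal to all polytabloids. As their coefficients are real, it is so for the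
Hermitian form too, hence orthogonal to the module that they span and in particular to itself.\<close>
lemma specht_eq_0_if_antisymmetrizers_vanish:
  assumes f: "f \<in> rep_space (specht \<mu>)"
    and van: "\<And>t. tableau \<mu> t \<Longrightarrow> column_antisymmetrize \<mu> t (tabloid_rep \<mu>) f = 0"
  shows "f = 0"
proof -
  have fM: "f \<in> rep_space (tabloid_rep \<mu>)" using f specht_subset_tabloid_rep by blast
  let ?W = "{g. (\<Sum>s\<in>tabloids \<mu>. f s * cnj (g s)) = 0}"
  have "csubspace ?W"
  proof (rule complex_vector.subspaceI)
    fix c g assume "g \<in> ?W"
    moreover have "(\<Sum>s\<in>tabloids \<mu>. f s * cnj ((c *\<^sub>C g) s)) = cnj c * (\<Sum>s\<in>tabloids \<mu>. f s * cnj (g s))"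
      by (simp add: sum_distrib_left scaleC_fun_def scaleC_complex_def mult_ac)
    ultimately show "c *\<^sub>C g \<in> ?W" by simp
  qed (simp_all add: distrib_left sum.distrib)
  moreover have "polytabloid \<mu> t \<in> ?W" if t: "tableau \<mu> t" for t
  proof -
    have "cnj (polytabloid \<mu> t s) = polytabloid \<mu> t s" for s
      by (auto simp: polytabloid_apply[OF t] intro!: sum.cong)
    then show ?thesis
      using antisymmetrize_apply_tabloid[OF t fM] van[OF t] by simp
  qed
  ultimately have "rep_space (specht \<mu>) \<subseteq> ?W"
    unfolding specht_space by (intro complex_vector.span_minimal) auto
  then have "(\<Sum>s\<in>tabloids \<mu>. f s * cnj (f s)) = 0" using f by blast
  then have "complex_of_real (\<Sum>s\<in>tabloids \<mu>. (cmod (f s))\<^sup>2) = 0"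
    by (simp only: of_real_sum complex_norm_square)
  then have "(\<Sum>s\<in>tabloids \<mu>. (cmod (f s))\<^sup>2) = 0" by (simp only: of_real_eq_0_iff)
  then have "\<forall>s\<in>tabloids \<mu>. f s = 0"
    by (simp add: sum_nonneg_eq_0_iff finite_tabloids)
  then show ?thesis
    using fM by (auto simp: perm_action.perm_rep_space[OF perm_action_tabloids] fun_eq_iff)
qed

text \<open>Let \<open>U\<close> be a nonzero submodule. Some antisymmetrizer does not vanish on \<open>U\<close>; its value is a
nonzero multiple of a polytabloid, which therefore belongs to \<open>U\<close>. The symmetric group permutes the
polytabloids transitively, so \<open>U\<close> contains them all.\<close>
theorem irreducible_specht:
  assumes sorted: "sorted_wrt (\<ge>) \<mu>"
  shows "irreducible_rep (sym_group (sum_list \<mu>)) (specht \<mu>)"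
  unfolding irreducible_rep_def
proof (intro conjI allI impI)
  let ?G = "sym_group (sum_list \<mu>)"
  show "is_rep ?G (specht \<mu>)" by (rule is_rep_specht)
  obtain t where t: "tableau \<mu> t" using exists_tableau by blast
  have "polytabloid \<mu> t \<noteq> 0" using polytabloid_nonzero[OF t] by auto
  then show "rep_space (specht \<mu>) \<noteq> {0}" using polytabloid_in_specht[OF t] by blast
  fix U assume U: "subrep ?G (specht \<mu>) U"
  then have U_sub: "csubspace U" "U \<subseteq> rep_space (specht \<mu>)" by (auto simp: subrep_def)
  show "U = {0} \<or> U = rep_space (specht \<mu>)"
  proof (cases "\<forall>f\<in>U. \<forall>t. tableau \<mu> t \<longrightarrow> column_antisymmetrize \<mu> t (tabloid_rep \<mu>) f = 0")
    case True
    then have "U \<subseteq> {0}"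
      using U_sub(2) specht_eq_0_if_antisymmetrizers_vanish by blast
    then show ?thesis using complex_vector.subspace_0[OF U_sub(1)] by blast
  next
    case False
    then obtain f t where f: "f \<in> U" and t: "tableau \<mu> t"
      and nz: "column_antisymmetrize \<mu> t (tabloid_rep \<mu>) f \<noteq> 0" by blast
    obtain c where c: "column_antisymmetrize \<mu> t (tabloid_rep \<mu>) f = c *\<^sub>C polytabloid \<mu> t"
      using column_antisymmetrize_multiple[OF t sorted] f U_sub(2) specht_subset_tabloid_rep by blast
    have "c *\<^sub>C polytabloid \<mu> t \<in> U"
      using antisymmetrize_in_subrep[OF U column_stabilizer_subset f, of t] c
      by (simp add: antisymmetrize_specht)
    moreover have "c \<noteq> 0" using nz c by auto
    ultimately have et: "polytabloid \<mu> t \<in> U"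
      using complex_vector.subspace_scale[OF U_sub(1), of "c *\<^sub>C polytabloid \<mu> t" "inverse c"] by simp
    have "polytabloid \<mu> u \<in> U" if u: "tableau \<mu> u" for u
    proof -
      obtain \<pi> where \<pi>: "\<pi> permutes {1..sum_list \<mu>}" "\<And>c. c \<in> diagram \<mu> \<Longrightarrow> \<pi> (t c) = u c"
        using tableau_transitive[OF t u] by blast
      have "rep_act (specht \<mu>) \<pi> (polytabloid \<mu> t) \<in> U"
        using U et \<pi>(1) by (simp add: subrep_def sym_group_carrier)
      then have "polytabloid \<mu> (\<pi> \<circ> t) \<in> U" by (simp add: specht_act rep_act_polytabloid[OF \<pi>(1) t])
      moreover have "polytabloid \<mu> (\<pi> \<circ> t) = polytabloid \<mu> u"
      proof -
        have "column \<mu> (\<pi> \<circ> t) j = column \<mu> u j" for j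
          unfolding column_def using \<pi>(2) by (intro Collect_cong) (metis comp_apply)
        then have "column_stabilizer \<mu> (\<pi> \<circ> t) = column_stabilizer \<mu> u"
          by (simp add: column_stabilizer_def)
        moreover have "tabloid \<mu> (\<sigma> \<circ> (\<pi> \<circ> t)) = tabloid \<mu> (\<sigma> \<circ> u)" for \<sigma>
          by (rule tabloid_cong) (simp add: \<pi>(2))
        ultimately show ?thesis by (simp add: polytabloid_def)
      qed
      ultimately show ?thesis by simp
    qed
    then have "rep_space (specht \<mu>) \<subseteq> U"
      unfolding specht_space by (intro complex_vector.span_minimal[OF _ U_sub(1)]) auto
    then show ?thesis using U_sub(2) by blast
  qed
qed

text \<open>The antisymmetrizer of \<open>t\<close> multiplies the polytabloid of \<open>t\<close> by a positive integer. Carried over by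
the isomorphism, it does not vanish on the tabloids of shape \<open>\<mu>\<close>, so \<open>\<nu>\<close> dominates \<open>\<mu>\<close>.\<close>
lemma cells_above_le_if_rep_iso:
  assumes sorted: "sorted_wrt (\<ge>) \<nu>" and size: "sum_list \<mu> = sum_list \<nu>"
    and iso: "rep_iso (sym_group (sum_list \<nu>)) (specht \<nu>) (specht \<mu>)"
  shows "cells_above \<mu> r \<le> cells_above \<nu> r"
proof -
  let ?G = "sym_group (sum_list \<nu>)"
  interpret perm_action ?G "tabloids \<mu>" tabloid_act
    using perm_action_tabloids[of \<mu>] size by simp
  obtain \<phi> where \<phi>: "rep_hom ?G (specht \<nu>) (specht \<mu>) \<phi>"
    and inj: "inj_on \<phi> (rep_space (specht \<nu>))"
    using iso unfolding rep_iso_iff_bij_rep_hom bij_betw_def by blast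
  obtain t where t: "tableau \<nu> t" using exists_tableau by blast
  let ?e = "polytabloid \<nu> t" and ?m = "of_nat (card (column_stabilizer \<nu> t)) :: complex"
  note e = polytabloid_in_specht[OF t]
  have "?e \<noteq> 0" using polytabloid_nonzero[OF t] by auto
  moreover have "0 \<in> rep_space (specht \<nu>)" by (rule is_rep_space(1)[OF is_rep_specht])
  ultimately have "\<phi> ?e \<noteq> 0"
    using inj_onD[OF inj _ e] rep_hom_zero[OF is_rep_specht \<phi>] by metis
  have \<phi>e: "\<phi> ?e \<in> rep_space (tabloid_rep \<mu>)"
    using rep_homD(1)[OF \<phi> e] specht_subset_tabloid_rep by blast
  have "column_antisymmetrize \<nu> t (tabloid_rep \<mu>) (\<phi> ?e) = \<phi> (?m *\<^sub>C ?e)"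
    using rep_hom_antisymmetrize[OF is_rep_specht \<phi> column_stabilizer_subset e, of t]
    by (simp add: antisymmetrize_specht antisymmetrize_polytabloid[OF t])
  also have "\<dots> = ?m *\<^sub>C \<phi> ?e" by (rule rep_homD(3)[OF \<phi> e])
  finally have "column_antisymmetrize \<nu> t (tabloid_rep \<mu>) (\<phi> ?e) = ?m *\<^sub>C \<phi> ?e" .
  moreover have "?m *\<^sub>C \<phi> ?e \<noteq> 0"
    using \<open>\<phi> ?e \<noteq> 0\<close> finite_column_stabilizer id_in_column_stabilizer[of \<nu> t] by auto
  ultimately have "column_antisymmetrize \<nu> t (tabloid_rep \<mu>)
      (\<Sum>s\<in>tabloids \<mu>. \<phi> ?e s *\<^sub>C basis_vec s) \<noteq> 0"
    using perm_rep_expand[OF \<phi>e] by simp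
  moreover have "column_antisymmetrize \<nu> t (tabloid_rep \<mu>) (\<Sum>s\<in>tabloids \<mu>. \<phi> ?e s *\<^sub>C basis_vec s) =
      (\<Sum>s\<in>tabloids \<mu>. \<phi> ?e s *\<^sub>C column_antisymmetrize \<nu> t (tabloid_rep \<mu>) (basis_vec s))"
    by (rule antisymmetrize_sum[OF is_rep column_stabilizer_subset basis_vec_in_perm_rep])
  ultimately obtain s where "s \<in> tabloids \<mu>"
    "column_antisymmetrize \<nu> t (tabloid_rep \<mu>) (basis_vec s) \<noteq> 0"
    by (metis (no_types, lifting) complex_vector.scale_zero_right sum.neutral)
  then show ?thesis
    using cells_above_le_if_antisymmetrize_nonzero[OF t _ size sorted] by blast
qed

theorem specht_iso_imp_eq:
  assumes "\<nu> \<in> partitions_of n" "\<mu> \<in> partitions_of n"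
    and iso: "rep_iso (sym_group n) (specht \<nu>) (specht \<mu>)"
  shows "\<nu> = \<mu>"
proof (rule eq_if_cells_above_eq)
  have n: "sum_list \<nu> = n" "sum_list \<mu> = n" and sorted: "sorted_wrt (\<ge>) \<nu>" "sorted_wrt (\<ge>) \<mu>"
    using assms by (auto simp: partitions_of_def)
  have "rep_iso (sym_group n) (specht \<mu>) (specht \<nu>)"
    using rep_iso_sym[OF _ iso] is_rep_specht[of \<nu>] n by simp
  then show "cells_above \<nu> r = cells_above \<mu> r" for r
    using cells_above_le_if_rep_iso[of \<nu> \<mu>] cells_above_le_if_rep_iso[of \<mu> \<nu>] iso sorted n
    by (simp add: antisym)
qed (use assms in \<open>auto simp: partitions_of_def\<close>)

section \<open>Perfect matchings and tableaux of even shape\<close>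
abbreviation perfect_matchings :: "nat \<Rightarrow> nat set set set" where
  "perfect_matchings k \<equiv> matchings k (complete_graph_edges (2 * k))"

lemma perm_action_matchings: "perm_action (sym_group n) (matchings k (complete_graph_edges n)) matching_act"
proof (rule perm_action.intro)
  show "finite (matchings k (complete_graph_edges n))"
    by (rule finite_subset[of _ "Pow (Pow {1..n})"])
      (auto simp: matchings_def complete_graph_edges_def)
next
  fix g M assume "g \<in> carrier (sym_group n)" and M: "M \<in> matchings k (complete_graph_edges n)"
  then have g: "g permutes {1..n}" by (simp add: sym_group_def)
  have inj: "inj g" using g by (rule permutes_inj)
  have "g ` e \<in> complete_graph_edges n" if "e \<in> complete_graph_edges n" for e
    using that permutes_image[OF g] image_mono[of e "{1..n}" g]
    by (auto simp: complete_graph_edges_def card_image[OF inj_on_subset[OF inj]])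
  moreover have "card (matching_act g M) = card M"
    unfolding matching_act_def using inj by (intro card_image) (auto simp: inj_on_def inj_image_eq_iff)
  ultimately show "matching_act g M \<in> matchings k (complete_graph_edges n)"
    using M unfolding matchings_def matching_act_def
    by (auto simp: pairwise_def disjnt_def inj_eq[OF inj]) blast+
qed (rule sym_group_is_group | simp add: sym_group_def matching_act_def image_comp comp_def)+

lemma card_Union_matching:
  assumes "M \<subseteq> complete_graph_edges n" "pairwise disjnt M"
  shows "card (\<Union>M) = 2 * card M"
proof -
  have "card (\<Union>M) = sum card M"
    using assms finite_subset[OF _ finite_atLeastAtMost[of 1 n]]
    by (intro card_Union_disjoint) (auto simp: complete_graph_edges_def)
  also have "\<dots> = (\<Sum>e\<in>M. 2)"
    using assms(1) by (intro sum.cong refl) (auto simp: complete_graph_edges_def)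
  finally show ?thesis by simp
qed

lemma perfect_matchingI:
  assumes M: "M \<subseteq> complete_graph_edges (2 * k)" "pairwise disjnt M" and cover: "\<Union>M = {1..2 * k}"
  shows "M \<in> perfect_matchings k"
proof -
  have "finite M" using finite_subset[OF M(1)] by (simp add: complete_graph_edges_def)
  moreover have "card M = k" using card_Union_matching[OF M] cover by simp
  ultimately show ?thesis using M by (simp add: matchings_def)
qed

lemma perfect_matching_partner:
  assumes M: "M \<in> perfect_matchings k"
  obtains f where "\<And>x. x \<in> {1..2 * k} \<Longrightarrow> f x \<in> {1..2 * k}"
    "\<And>x. x \<in> {1..2 * k} \<Longrightarrow> f (f x) = x" "\<And>x. x \<in> {1..2 * k} \<Longrightarrow> f x \<noteq> x"
    "M = {{x, f x} |x. x \<in> {1..2 * k}}"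
proof -
  have edges: "M \<subseteq> complete_graph_edges (2 * k)" and disj: "pairwise disjnt M" and card: "card M = k"
    using M by (auto simp: matchings_def)
  have sub: "e \<subseteq> {1..2 * k}" "card e = 2" if "e \<in> M" for e
    using edges that by (auto simp: complete_graph_edges_def)
  have uniq: "e = e'" if "e \<in> M" "e' \<in> M" "x \<in> e" "x \<in> e'" for e e' x
    using disj that by (auto simp: pairwise_def disjnt_def)
  have cover: "\<Union>M = {1..2 * k}"
    by (rule card_subset_eq) (use sub(1) card_Union_matching[OF edges disj] card in auto)
  have "\<exists>y. {x, y} \<in> M \<and> y \<noteq> x" if x: "x \<in> {1..2 * k}" for x
  proof -
    obtain e where e: "e \<in> M" "x \<in> e" using x cover by blast
    then obtain y where "e = {x, y}" "y \<noteq> x"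
      using sub(2)[OF e(1)] by (auto simp: card_2_iff)
    then show ?thesis using e by blast
  qed
  then obtain f where f: "\<And>x. x \<in> {1..2 * k} \<Longrightarrow> {x, f x} \<in> M" "\<And>x. x \<in> {1..2 * k} \<Longrightarrow> f x \<noteq> x"
    by metis
  have fX: "f x \<in> {1..2 * k}" if "x \<in> {1..2 * k}" for x using sub(1)[OF f(1)[OF that]] by simp
  show ?thesis
  proof
    show "f (f x) = x" if x: "x \<in> {1..2 * k}" for x
      using uniq[OF f(1)[OF x] f(1)[OF fX[OF x]], of "f x"] f(2)[OF x] f(2)[OF fX[OF x]]
      by (auto simp: doubleton_eq_iff)
    show "M = {{x, f x} |x. x \<in> {1..2 * k}}"
    proof (intro equalityI subsetI)
      fix e assume e: "e \<in> M"
      then obtain x where x: "x \<in> e" using sub(2)[OF e] by fastforce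
      then have xX: "x \<in> {1..2 * k}" using sub(1)[OF e] by blast
      then have "e = {x, f x}" using uniq[OF e f(1)[OF xX] x] by simp
      then show "e \<in> {{x, f x} |x. x \<in> {1..2 * k}}" using xX by blast
    qed (use f(1) in auto)
  qed (use f fX in auto)
qed

definition row_matching :: "nat list \<Rightarrow> (nat \<times> nat \<Rightarrow> nat) \<Rightarrow> nat set set" where
  "row_matching \<mu> t = (\<lambda>(i, j). {t (i, j), t (i, Suc j)}) ` {(i, j). even j \<and> (i, j) \<in> diagram \<mu>}"

lemma matching_act_row_matching: "matching_act \<pi> (row_matching \<mu> t) = row_matching \<mu> (\<pi> \<circ> t)"
  by (simp add: matching_act_def row_matching_def image_image case_prod_unfold)

text \<open>The row matchings of \<open>t\<close> and of \<open>t \<circ> rotate_rows \<mu>\<close> together turn each row of \<open>t\<close> into a closed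
cycle whose edges belong to the two matchings alternately (a doubled edge for a row of length two).\<close>
definition rotate_rows :: "nat list \<Rightarrow> nat \<times> nat \<Rightarrow> nat \<times> nat" where
  "rotate_rows \<mu> = (\<lambda>(i, j). (i, Suc j mod \<mu> ! i))"

locale even_shape =
  fixes \<mu> :: "nat list" and k :: nat
  assumes even_parts: "p \<in> set \<mu> \<Longrightarrow> even p" and size: "sum_list \<mu> = 2 * k"
begin

lemma Suc_in_diagram: "even j \<Longrightarrow> (i, j) \<in> diagram \<mu> \<Longrightarrow> (i, Suc j) \<in> diagram \<mu>"
  using even_parts[of "\<mu> ! i"] by (auto simp: mem_diagram) presburger

lemma pred_in_diagram: "(i, Suc j) \<in> diagram \<mu> \<Longrightarrow> (i, j) \<in> diagram \<mu>"
  by (auto simp: mem_diagram)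

lemma row_matching_cong:
  assumes eq: "\<And>c. c \<in> diagram \<mu> \<Longrightarrow> t c = u c"
  shows "row_matching \<mu> t = row_matching \<mu> u"
proof -
  show ?thesis
    unfolding row_matching_def by (rule image_cong) (use eq Suc_in_diagram in auto)
qed

lemma row_matching_perfect:
  assumes t: "tableau \<mu> t"
  shows "row_matching \<mu> t \<in> perfect_matchings k"
proof (rule perfect_matchingI)
  have inj: "inj_on t (diagram \<mu>)" and im: "t ` diagram \<mu> = {1..2 * k}"
    using t size by (auto simp: tableau_def bij_betw_def)
  have t_eq: "t c = t d \<longleftrightarrow> c = d" if "c \<in> diagram \<mu>" "d \<in> diagram \<mu>" for c d
    using inj that by (auto dest: inj_onD)
  show "row_matching \<mu> t \<subseteq> complete_graph_edges (2 * k)"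
  proof
    fix e assume "e \<in> row_matching \<mu> t"
    then obtain i j where e: "even j" "(i, j) \<in> diagram \<mu>" "e = {t (i, j), t (i, Suc j)}"
      by (auto simp: row_matching_def)
    note cells = e(2) Suc_in_diagram[OF e(1,2)]
    have "e \<subseteq> {1..2 * k}" using cells unfolding e(3) im[symmetric] by blast
    moreover have "card e = 2" unfolding e(3) using t_eq[OF cells] by simp
    ultimately show "e \<in> complete_graph_edges (2 * k)" by (simp add: complete_graph_edges_def)
  qed
  show "pairwise disjnt (row_matching \<mu> t)"
  proof (rule pairwiseI)
    fix e e' assume "e \<in> row_matching \<mu> t" "e' \<in> row_matching \<mu> t" and ne: "e \<noteq> e'"
    then obtain i j i' j' where e: "even j" "(i, j) \<in> diagram \<mu>" "e = {t (i, j), t (i, Suc j)}"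
      and e': "even j'" "(i', j') \<in> diagram \<mu>" "e' = {t (i', j'), t (i', Suc j')}"
      by (auto simp: row_matching_def)
    have "(i, j) \<noteq> (i', j')" using ne e(3) e'(3) by auto
    then show "disjnt e e'"
      using e e' Suc_in_diagram[OF e(1,2)] Suc_in_diagram[OF e'(1,2)]
      by (auto simp: disjnt_def t_eq)
  qed
  show "\<Union>(row_matching \<mu> t) = {1..2 * k}"
  proof (intro equalityI subsetI)
    fix x assume "x \<in> {1..2 * k}"
    then obtain i j where ij: "(i, j) \<in> diagram \<mu>" "x = t (i, j)" using im by (metis imageE surj_pair)
    show "x \<in> \<Union>(row_matching \<mu> t)"
    proof (cases "even j")
      case True
      then show ?thesis using ij by (auto simp: row_matching_def)
    next
      case False
      then obtain l where "j = Suc l" "even l" by (cases j) auto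
      then show ?thesis using ij pred_in_diagram by (auto simp: row_matching_def)
    qed
  next
    fix x assume "x \<in> \<Union>(row_matching \<mu> t)"
    then obtain i j where "even j" "(i, j) \<in> diagram \<mu>" "x = t (i, j) \<or> x = t (i, Suc j)"
      by (auto simp: row_matching_def)
    then show "x \<in> {1..2 * k}" using Suc_in_diagram unfolding im[symmetric] by blast
  qed
qed

lemma rotate_rows_bij: "bij_betw (rotate_rows \<mu>) (diagram \<mu>) (diagram \<mu>)"
proof -
  have sub: "rotate_rows \<mu> ` diagram \<mu> \<subseteq> diagram \<mu>"
    by (auto simp: rotate_rows_def mem_diagram)
  have "diagram \<mu> \<subseteq> rotate_rows \<mu> ` diagram \<mu>"
  proof
    fix c assume "c \<in> diagram \<mu>"
    then obtain i j where c: "c = (i, j)" "i < length \<mu>" "j < \<mu> ! i" by (cases c) (auto simp: mem_diagram)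
    show "c \<in> rotate_rows \<mu> ` diagram \<mu>"
    proof (cases j)
      case 0
      have "c = rotate_rows \<mu> (i, \<mu> ! i - 1)" using c 0 by (simp add: rotate_rows_def)
      then show ?thesis using c by (auto simp: mem_diagram)
    next
      case (Suc l)
      then have "c = rotate_rows \<mu> (i, l)" using c by (simp add: rotate_rows_def)
      then show ?thesis using c Suc by (auto simp: mem_diagram)
    qed
  qed
  with sub have im: "rotate_rows \<mu> ` diagram \<mu> = diagram \<mu>" by blast
  then have "inj_on (rotate_rows \<mu>) (diagram \<mu>)"
    by (intro eq_card_imp_inj_on finite_diagram) simp
  with im show ?thesis by (simp add: bij_betw_def)
qed

lemma tableau_rotate: "tableau \<mu> t \<Longrightarrow> tableau \<mu> (t \<circ> rotate_rows \<mu>)"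
  using rotate_rows_bij unfolding tableau_def by (rule bij_betw_trans)

definition partner :: "nat \<times> nat \<Rightarrow> nat \<times> nat" where
  "partner = (\<lambda>(i, j). (i, if even j then Suc j else j - 1))"

lemma partner_bij: "bij_betw partner (diagram \<mu>) (diagram \<mu>)"
  by (rule bij_betw_byWitness[where f' = partner])
    (use Suc_in_diagram in \<open>auto simp: partner_def mem_diagram\<close>)

end

section \<open>Specht modules of even shape in the matching module\<close>
text \<open>The restrictions of \<open>\<tau>\<close> to \<open>E\<close> and to its disjoint mirror image \<open>a ` E\<close> are conjugate by \<open>a\<close>, so they
have the same sign, and \<open>\<tau>\<close> is their product.\<close>
lemma sign_eq_1_if_commutes_with_swap:
  assumes fin: "finite E" and a: "permutation a" "\<And>x. a (a x) = x" and disj: "\<And>x. x \<in> E \<Longrightarrow> a x \<notin> E"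
    and \<tau>: "\<tau> permutes E \<union> a ` E" and stable: "\<tau> ` E = E"
    and comm: "\<And>x. x \<in> E \<Longrightarrow> \<tau> (a x) = a (\<tau> x)"
  shows "sign \<tau> = 1"
proof -
  define \<epsilon> where "\<epsilon> x = (if x \<in> E then \<tau> x else x)" for x
  have \<epsilon>: "\<epsilon> permutes E"
  proof (rule bij_imp_permutes)
    have "bij_betw \<tau> E E"
      using stable inj_on_subset[OF permutes_inj[OF \<tau>]] by (simp add: bij_betw_def)
    then show "bij_betw \<epsilon> E E" by (rule bij_betw_cong[THEN iffD1, rotated]) (simp add: \<epsilon>_def)
  qed (simp add: \<epsilon>_def)
  then have pe: "permutation \<epsilon>" using fin by (auto simp: permutation_permutes)
  have "\<tau> = \<epsilon> \<circ> (a \<circ> \<epsilon> \<circ> a)"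
  proof
    fix x
    consider "x \<in> E" | y where "y \<in> E" "x = a y" | "x \<notin> E" "x \<notin> a ` E" by blast
    then show "\<tau> x = (\<epsilon> \<circ> (a \<circ> \<epsilon> \<circ> a)) x"
    proof cases
      case 1
      then show ?thesis using disj a(2) by (simp add: \<epsilon>_def)
    next
      case 2
      then have "\<tau> y \<in> E" using stable by blast
      then show ?thesis using 2 disj a(2) comm by (simp add: \<epsilon>_def)
    next
      case 3
      then have "a x \<notin> E" using a(2) by (metis imageI)
      then show ?thesis using 3 a(2) permutes_not_in[OF \<tau>] by (simp add: \<epsilon>_def)
    qed
  qed
  then have "sign \<tau> = sign \<epsilon> * (sign a * sign \<epsilon> * sign a)"
    using pe a(1) by (simp add: sign_compose permutation_compose)
  then show ?thesis by (simp add: sign_def split: if_splits)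
qed

definition in_rows :: "nat set list \<Rightarrow> nat set set \<Rightarrow> bool" where
  "in_rows T M \<longleftrightarrow> (\<forall>e\<in>M. \<exists>A\<in>set T. e \<subseteq> A)"

lemma in_rows_act:
  assumes "in_rows T M"
  shows "in_rows (tabloid_act \<pi> T) (matching_act \<pi> M)"
  unfolding in_rows_def
proof
  fix e assume "e \<in> matching_act \<pi> M"
  then obtain e' where e': "e' \<in> M" "e = \<pi> ` e'" by (auto simp: matching_act_def)
  then obtain A where "A \<in> set T" "e' \<subseteq> A" using assms by (auto simp: in_rows_def)
  then show "\<exists>A\<in>set (tabloid_act \<pi> T). e \<subseteq> A"
    unfolding e'(2) by (intro bexI[of _ "\<pi> ` A"]) (auto simp: tabloid_act_def)
qed

context even_shape
begin

lemma row_matching_in_rows: "in_rows (tabloid \<mu> t) (row_matching \<mu> t)"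
proof -
  have "\<exists>A\<in>set (tabloid \<mu> t). {t (i, j), t (i, Suc j)} \<subseteq> A" if "even j" "(i, j) \<in> diagram \<mu>" for i j
    using that(2) Suc_in_diagram[OF that]
    by (intro bexI[of _ "{t (i, j) |j. (i, j) \<in> diagram \<mu>}"]) (auto simp: tabloid_def mem_diagram)
  then show ?thesis by (auto simp: in_rows_def row_matching_def)
qed

text \<open>Let \<open>\<tau>\<close> be the inverse of \<open>\<sigma>\<close>. As a column permutation it keeps the neighbours \<open>t (i, j)\<close> and
\<open>t (i, Suc j)\<close> with \<open>j\<close> even in their columns, and by \<open>rows\<close> it moves both to the same row. So \<open>\<tau>\<close>
commutes with the involution \<open>a\<close> that exchanges neighbours, and \<open>a\<close> exchanges the set \<open>E\<close> of entries
in columns of even index with the set of the other entries.\<close>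
lemma sign_eq_1_if_in_rows:
  assumes t: "tableau \<mu> t" and \<sigma>: "\<sigma> \<in> column_stabilizer \<mu> t"
    and rows: "in_rows (tabloid \<mu> (\<sigma> \<circ> t)) (row_matching \<mu> t)"
  shows "sign \<sigma> = 1"
proof -
  let ?D = "diagram \<mu>"
  define \<tau> where "\<tau> = inv_into UNIV \<sigma>"
  have perm: "\<sigma> permutes {1..2 * k}" using \<sigma> size by (simp add: column_stabilizer_def)
  have \<tau>: "\<tau> \<in> column_stabilizer \<mu> t" unfolding \<tau>_def by (rule column_stabilizer_inv[OF \<sigma>])
  have \<tau>_perm: "\<tau> permutes {1..2 * k}" unfolding \<tau>_def by (rule permutes_inv[OF perm])
  have \<tau>\<sigma>: "\<tau> (\<sigma> x) = x" for x unfolding \<tau>_def by (rule permutes_inverses(2)[OF perm])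
  have inj: "inj_on t ?D" and im: "t ` ?D = {1..2 * k}"
    using t size by (auto simp: tableau_def bij_betw_def)
  have same_row: "\<exists>r. (r, j) \<in> ?D \<and> \<tau> (t (i, j)) = t (r, j) \<and> \<tau> (t (i, Suc j)) = t (r, Suc j)"
    if ij: "even j" "(i, j) \<in> ?D" for i j
  proof -
    obtain r where r: "(r, j) \<in> ?D" "\<tau> (t (i, j)) = t (r, j)"
      using column_stabilizer_cell[OF \<tau> ij(2)] .
    obtain r' where r': "(r', Suc j) \<in> ?D" "\<tau> (t (i, Suc j)) = t (r', Suc j)"
      using column_stabilizer_cell[OF \<tau> Suc_in_diagram[OF ij]] .
    have "{t (i, j), t (i, Suc j)} \<in> row_matching \<mu> t" using ij by (auto simp: row_matching_def)
    then obtain A where A: "A \<in> set (tabloid \<mu> (\<sigma> \<circ> t))" "t (i, j) \<in> A" "t (i, Suc j) \<in> A"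
      using rows by (auto simp: in_rows_def)
    then obtain q l l' where q: "(q, l) \<in> ?D" "t (i, j) = \<sigma> (t (q, l))"
      "(q, l') \<in> ?D" "t (i, Suc j) = \<sigma> (t (q, l'))"
      by (auto simp: tabloid_def)
    then have "t (r, j) = t (q, l)" "t (r', Suc j) = t (q, l')" using r r' \<tau>\<sigma> by metis+
    then have "(r, j) = (q, l)" "(r', Suc j) = (q, l')" using inj_onD[OF inj] r r' q by metis+
    then show ?thesis using r r' by auto
  qed
  obtain a where a: "a permutes {1..2 * k}" "\<And>c. c \<in> ?D \<Longrightarrow> a (t c) = t (partner c)"
  proof -
    have "tableau \<mu> (t \<circ> partner)"
      using partner_bij t unfolding tableau_def by (rule bij_betw_trans)
    then show ?thesis using tableau_transitive[OF t, of "t \<circ> partner"] that size by auto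
  qed
  have partner_D: "partner c \<in> ?D" if "c \<in> ?D" for c using bij_betwE[OF partner_bij] that by blast
  have pp: "partner (partner c) = c" for c by (cases c) (auto simp: partner_def)
  have aa: "a (a x) = x" for x
  proof (cases "x \<in> {1..2 * k}")
    case True
    then obtain c where "c \<in> ?D" "x = t c" using im by (metis imageE)
    then show ?thesis using a(2) partner_D pp by simp
  next
    case False
    then show ?thesis using permutes_not_in[OF a(1)] by simp
  qed
  define E where "E = t ` {c \<in> ?D. even (snd c)}"
  have fin: "finite E" by (simp add: E_def finite_diagram)
  have aE: "a ` E = t ` {c \<in> ?D. odd (snd c)}"
  proof -
    have "{c \<in> ?D. odd (snd c)} = partner ` {c \<in> ?D. even (snd c)}"
    proof (intro equalityI subsetI)
      fix c assume c: "c \<in> {c \<in> ?D. odd (snd c)}"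
      then have "c = partner (partner c)" "partner c \<in> {c \<in> ?D. even (snd c)}"
        using partner_D pp by (auto simp: partner_def split: prod.splits)
      then show "c \<in> partner ` {c \<in> ?D. even (snd c)}" by (rule image_eqI)
    qed (use partner_D in \<open>auto simp: partner_def\<close>)
    moreover have "(\<lambda>c. a (t c)) ` {c \<in> ?D. even (snd c)} = (\<lambda>c. t (partner c)) ` {c \<in> ?D. even (snd c)}"
      by (rule image_cong) (simp_all add: a(2))
    ultimately show ?thesis by (simp add: E_def image_image)
  qed
  have "E \<union> a ` E = {1..2 * k}" unfolding aE unfolding E_def im[symmetric] by blast
  have "sign \<tau> = 1"
  proof (rule sign_eq_1_if_commutes_with_swap[OF fin _ aa])
    show "permutation a" using a(1) by (auto simp: permutation_permutes)
    show "\<tau> permutes E \<union> a ` E" using \<tau>_perm \<open>E \<union> a ` E = {1..2 * k}\<close> by simp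
    show "a x \<notin> E" if x: "x \<in> E" for x
    proof
      assume "a x \<in> E"
      moreover have "a x \<in> a ` E" using x by blast
      moreover have "E \<inter> a ` E = {}" unfolding aE unfolding E_def using inj by (auto dest: inj_onD)
      ultimately show False by blast
    qed
    show "\<tau> ` E = E"
    proof (rule endo_inj_surj[OF fin])
      show "\<tau> ` E \<subseteq> E"
      proof
        fix y assume "y \<in> \<tau> ` E"
        then obtain i j where "y = \<tau> (t (i, j))" "(i, j) \<in> ?D" "even j" by (auto simp: E_def)
        then show "y \<in> E" using same_row[of j i] by (auto simp: E_def)
      qed
      show "inj_on \<tau> E" using permutes_inj[OF \<tau>_perm] by (rule inj_on_subset) simp
    qed
    show "\<tau> (a x) = a (\<tau> x)" if "x \<in> E" for x
    proof -
      obtain i j where ij: "x = t (i, j)" "(i, j) \<in> ?D" "even j" using \<open>x \<in> E\<close> by (auto simp: E_def)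
      obtain r where "(r, j) \<in> ?D" "\<tau> (t (i, j)) = t (r, j)" "\<tau> (t (i, Suc j)) = t (r, Suc j)"
        using same_row[OF ij(3,2)] by blast
      then show ?thesis using ij by (simp add: a(2) partner_def)
    qed
  qed
  moreover have "sign \<tau> = sign \<sigma>"
    unfolding \<tau>_def using perm by (intro sign_inverse) (auto simp: permutation_permutes)
  ultimately show ?thesis by simp
qed

text \<open>The coefficient at the row matching of \<open>t\<close> counts the column permutations \<open>\<sigma>\<close> for which this matching
lies in the rows of \<open>\<sigma> \<circ> t\<close>, and the identity is one of them.\<close>
lemma incidence_hom_polytabloid_nonzero:
  assumes t: "tableau \<mu> t"
  shows "incidence_hom (tabloids \<mu>) (perfect_matchings k) in_rows (polytabloid \<mu> t) \<noteq> 0"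
proof -
  let ?C = "column_stabilizer \<mu> t" and ?M = "row_matching \<mu> t"
  let ?R = "{T \<in> tabloids \<mu>. in_rows T ?M}"
  have "incidence_hom (tabloids \<mu>) (perfect_matchings k) in_rows (polytabloid \<mu> t) ?M =
      (\<Sum>T\<in>?R. \<Sum>\<sigma>\<in>?C. if tabloid \<mu> (\<sigma> \<circ> t) = T then of_int (sign \<sigma>) else 0)"
    using row_matching_perfect[OF t] by (simp add: incidence_hom_def polytabloid_apply[OF t])
  also have "\<dots> = (\<Sum>\<sigma>\<in>?C. \<Sum>T\<in>?R. if tabloid \<mu> (\<sigma> \<circ> t) = T then of_int (sign \<sigma>) else 0)"
    by (rule sum.swap)
  also have "\<dots> = (\<Sum>\<sigma>\<in>?C. if in_rows (tabloid \<mu> (\<sigma> \<circ> t)) ?M then 1 else 0)"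
  proof (intro sum.cong refl)
    fix \<sigma> assume \<sigma>: "\<sigma> \<in> ?C"
    then have "tabloid \<mu> (\<sigma> \<circ> t) \<in> tabloids \<mu>"
      using tabloid_comp_in_tabloids[OF _ t] by (simp add: column_stabilizer_def)
    then show "(\<Sum>T\<in>?R. if tabloid \<mu> (\<sigma> \<circ> t) = T then of_int (sign \<sigma>) else 0) =
        (if in_rows (tabloid \<mu> (\<sigma> \<circ> t)) ?M then 1 else (0 :: complex))"
      using sign_eq_1_if_in_rows[OF t \<sigma>] by (simp add: finite_tabloids)
  qed
  also have "\<dots> = of_nat (card {\<sigma> \<in> ?C. in_rows (tabloid \<mu> (\<sigma> \<circ> t)) ?M})"
    by (simp add: finite_column_stabilizer flip: sum.inter_filter)
  finally have "incidence_hom (tabloids \<mu>) (perfect_matchings k) in_rows (polytabloid \<mu> t) ?M =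
      of_nat (card {\<sigma> \<in> ?C. in_rows (tabloid \<mu> (\<sigma> \<circ> t)) ?M})" .
  moreover have "card {\<sigma> \<in> ?C. in_rows (tabloid \<mu> (\<sigma> \<circ> t)) ?M} \<noteq> 0"
  proof -
    have "id \<in> {\<sigma> \<in> ?C. in_rows (tabloid \<mu> (\<sigma> \<circ> t)) ?M}"
      using id_in_column_stabilizer row_matching_in_rows by simp
    then show ?thesis using finite_column_stabilizer[of \<mu> t] by auto
  qed
  ultimately have "incidence_hom (tabloids \<mu>) (perfect_matchings k) in_rows (polytabloid \<mu> t) ?M \<noteq> 0"
    by simp
  then show ?thesis by (metis zero_fun_apply)
qed

end

section \<open>Pairs of perfect matchings as alternating cycles\<close>
text \<open>The involutions \<open>a\<close> and \<open>b\<close> give the partners of a vertex in two perfect matchings on \<open>X\<close>.\<close>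
locale alternating_pair =
  fixes X :: "'a set" and a b :: "'a \<Rightarrow> 'a"
  assumes finite_X: "finite X"
    and a: "x \<in> X \<Longrightarrow> a x \<in> X" "x \<in> X \<Longrightarrow> a (a x) = x" "x \<in> X \<Longrightarrow> a x \<noteq> x"
    and b: "x \<in> X \<Longrightarrow> b x \<in> X" "x \<in> X \<Longrightarrow> b (b x) = x" "x \<in> X \<Longrightarrow> b x \<noteq> x"
begin

definition alternating_cycle :: "'a list \<Rightarrow> bool" where
  "alternating_cycle c \<longleftrightarrow> c \<noteq> [] \<and> even (length c) \<and> distinct c \<and> set c \<subseteq> X \<and>
    (\<forall>i<length c. (even i \<longrightarrow> a (c ! i) = c ! Suc i) \<and>
      (odd i \<longrightarrow> b (c ! i) = c ! (Suc i mod length c)))"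

definition step :: "'a \<Rightarrow> 'a" where
  "step y = b (a y)"

lemma step_in: "y \<in> X \<Longrightarrow> step y \<in> X"
  unfolding step_def by (simp add: a(1) b(1))

lemma step_inj: "x \<in> X \<Longrightarrow> y \<in> X \<Longrightarrow> step x = step y \<Longrightarrow> x = y"
  unfolding step_def using a(1,2) b(2) by metis

lemma step_closed: "y \<in> X \<Longrightarrow> (step ^^ n) y \<in> X"
  by (induction n) (simp_all add: step_in)

lemma step_cancel:
  assumes "x \<in> X" "y \<in> X"
  shows "(step ^^ n) x = (step ^^ n) y \<Longrightarrow> x = y"
proof (induction n)
  case (Suc n)
  then have "step ((step ^^ n) x) = step ((step ^^ n) y)" by simp
  then have "(step ^^ n) x = (step ^^ n) y"
    by (rule step_inj[OF step_closed[OF assms(1)] step_closed[OF assms(2)]])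
  then show ?case by (rule Suc.IH)
qed simp

text \<open>The composite of \<open>a\<close> with \<open>step ^^ n\<close> is a reflection in the dihedral group generated by \<open>a\<close>
and \<open>b\<close>, hence conjugate to \<open>a\<close> or to \<open>b\<close>, which have no fixed points. The induction performs
this conjugation by moving \<open>y\<close> one step along its cycle.\<close>
lemma step_neq_reflect: "y \<in> X \<Longrightarrow> (step ^^ n) y \<noteq> a y"
proof (induction n arbitrary: y rule: induct_nat_012)
  case 0
  then show ?case using a(3)[of y] by simp
next
  case 1
  then show ?case using a(1) b(3)[of "a y"] by (simp add: step_def)
next
  case (ge2 n)
  let ?c = "step ^^ n"
  have y': "step y \<in> X" by (rule step_in[OF ge2.prems])
  show ?case
  proof
    assume "(step ^^ Suc (Suc n)) y = a y"
    then have "step (?c (step y)) = a y" by (simp add: funpow_swap1)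
    then have "?c (step y) = a (step y)"
      using a(1,2) b(1,2) step_closed[OF y'] ge2.prems unfolding step_def by metis
    then show False using ge2.IH(1)[OF y'] by simp
  qed
qed

lemma step_neq_reflect':
  assumes x: "x \<in> X"
  shows "(step ^^ i) x \<noteq> a ((step ^^ j) x)"
proof
  assume eq: "(step ^^ i) x = a ((step ^^ j) x)"
  show False
  proof (cases "j \<le> i")
    case True
    then have "(step ^^ i) x = (step ^^ (i - j)) ((step ^^ j) x)"
      by (simp flip: comp_apply[of "step ^^ (i - j)"] funpow_add)
    then show False using eq step_neq_reflect[OF step_closed[OF x]] by metis
  next
    case False
    then have "(step ^^ j) x = (step ^^ (j - i)) ((step ^^ i) x)"
      by (simp flip: comp_apply[of "step ^^ (j - i)"] funpow_add)
    moreover have "(step ^^ j) x = a ((step ^^ i) x)"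
      using eq a(2) step_closed[OF x] by metis
    ultimately show False using step_neq_reflect[OF step_closed[OF x]] by metis
  qed
qed

lemma exists_return:
  assumes x: "x \<in> X"
  shows "\<exists>m>0. (step ^^ m) x = x"
proof -
  have "range (\<lambda>i. (step ^^ i) x) \<subseteq> X" using step_closed[OF x] by blast
  then have "\<not> inj (\<lambda>i. (step ^^ i) x)"
    using finite_subset[OF _ finite_X] finite_imageD[of _ UNIV] infinite_UNIV_nat by metis
  then obtain i j where ij: "(step ^^ i) x = (step ^^ j) x" "i < j"
    using linorder_injI[of "\<lambda>i. (step ^^ i) x"] by blast
  then have "(step ^^ i) x = (step ^^ i) ((step ^^ (j - i)) x)"
    by (simp flip: comp_apply[of "step ^^ i"] funpow_add)
  then have "(step ^^ (j - i)) x = x"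
    using step_cancel[OF x step_closed[OF x]] by metis
  then show ?thesis using ij(2) by (intro exI[of _ "j - i"]) simp
qed

text \<open>Starting at \<open>x\<close>, apply \<open>a\<close> and \<open>b\<close> in turn until \<open>x\<close> is reached again for the first time after an even
number of applications. No vertex repeats before: at two positions of equal parity because \<open>m\<close> is least,
at positions of different parity by \<open>step_neq_reflect'\<close>.\<close>
lemma exists_alternating_cycle:
  assumes x: "x \<in> X"
  obtains c where "alternating_cycle c"
proof -
  define p where "p i = (step ^^ i) x" for i
  define m where "m = (LEAST m. m > 0 \<and> p m = x)"
  have "m > 0 \<and> p m = x"
    unfolding m_def p_def using exists_return[OF x] by (rule LeastI_ex[of "\<lambda>m. m > 0 \<and> _ m"])
  then have m: "m > 0" "p m = x" by auto
  have least: "m \<le> d" if "d > 0" "p d = x" for d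
    unfolding m_def using that by (intro Least_le) simp
  have p_X: "p i \<in> X" for i unfolding p_def by (rule step_closed[OF x])
  have p_Suc: "p (Suc i) = b (a (p i))" for i by (simp add: p_def step_def)
  have p_inj: "i = j" if "p i = p j" "i < m" "j < m" for i j
  proof -
    have less: False if "p i = p j" "i < j" "j < m" for i j
    proof -
      have "(step ^^ i) x = (step ^^ i) (p (j - i))"
        using that by (simp add: p_def flip: comp_apply[of "step ^^ i"] funpow_add)
      then have "p (j - i) = x" using step_cancel[OF x p_X] by metis
      then show False using least[of "j - i"] that by simp
    qed
    show ?thesis using less[of i j] less[of j i] that by (metis linorder_neqE_nat)
  qed
  define s where "s i = (if even i then p (i div 2) else a (p (i div 2)))" for i
  have inj: "inj_on s {..<2 * m}"
  proof (rule inj_onI)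
    fix i j assume ij: "i \<in> {..<2 * m}" "j \<in> {..<2 * m}" "s i = s j"
    then have lt: "i div 2 < m" "j div 2 < m" by auto
    have "even i \<longleftrightarrow> even j"
      using ij(3) step_neq_reflect'[OF x] unfolding s_def p_def by (metis (full_types))
    moreover have "p (i div 2) = p (j div 2)"
      using ij(3) \<open>even i \<longleftrightarrow> even j\<close> a(2) p_X unfolding s_def by metis
    then have "i div 2 = j div 2" using p_inj lt by blast
    ultimately show "i = j" by (metis even_two_times_div_two odd_two_times_div_two_succ)
  qed
  have s_a: "a (s i) = s (Suc i)" if "even i" for i using that by (simp add: s_def)
  have s_b: "b (s i) = s (Suc i mod (2 * m))" if "odd i" "i < 2 * m" for i
  proof -
    have "b (s i) = p (Suc (i div 2))" using that(1) by (simp add: s_def p_Suc)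
    also have "\<dots> = s (Suc i)" using that(1) by (simp add: s_def)
    also have "\<dots> = s (Suc i mod (2 * m))"
    proof (cases "Suc i = 2 * m")
      case True
      then show ?thesis using m by (simp add: s_def p_def)
    next
      case False
      then show ?thesis using that(2) by simp
    qed
    finally show ?thesis .
  qed
  show ?thesis
  proof
    have "Suc i < 2 * m" if "even i" "i < 2 * m" for i using that by presburger
    then show "alternating_cycle (map s [0..<2 * m])"
      using m(1) inj s_a s_b p_X a(1)
      by (auto simp: alternating_cycle_def distinct_map s_def atLeast0LessThan)
  qed
qed

lemma alternating_cycle_closed:
  assumes c: "alternating_cycle c" and x: "x \<in> set c"
  shows "a x \<in> set c" "b x \<in> set c"
proof -
  let ?n = "length c"
  have n: "even ?n" "?n > 0" and cX: "set c \<subseteq> X"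
    and ca: "\<And>i. i < ?n \<Longrightarrow> even i \<Longrightarrow> a (c ! i) = c ! Suc i"
    and cb: "\<And>i. i < ?n \<Longrightarrow> odd i \<Longrightarrow> b (c ! i) = c ! (Suc i mod ?n)"
    using c by (auto simp: alternating_cycle_def)
  obtain i where i: "i < ?n" "x = c ! i" using x by (auto simp: in_set_conv_nth)
  have mem: "c ! j \<in> X" if "j < ?n" for j using cX that by auto
  show "a x \<in> set c"
  proof (cases "even i")
    case True
    then have "Suc i < ?n" using i(1) n(1) by presburger
    then show ?thesis using ca[OF i(1) True] i(2) by simp
  next
    case False
    then obtain j where "i = Suc j" "even j" by (cases i) auto
    then have "x = a (c ! j)" "j < ?n" using ca[of j] i by auto
    then show ?thesis using a(2)[OF mem] by simp
  qed
  show "b x \<in> set c"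
  proof (cases "odd i")
    case True
    then show ?thesis using cb[OF i(1) True] i(2) n(2) by simp
  next
    case False
    obtain j where j: "j < ?n" "odd j" "Suc j mod ?n = i"
    proof (cases i)
      case 0
      then show ?thesis using that[of "?n - 1"] n by simp
    next
      case (Suc l)
      then show ?thesis using that[of l] i(1) False by simp
    qed
    then have "x = b (c ! j)" using cb[OF j(1,2)] i(2) by simp
    then show ?thesis using b(2)[OF mem[OF j(1)]] j(1) by simp
  qed
qed

end

text \<open>The vertices outside one alternating cycle are again closed under \<open>a\<close> and \<open>b\<close>, so one can induct. Since
the lengths of the cycles add up to \<open>card X\<close>, the cycles that cover \<open>X\<close> are disjoint.\<close>
lemma alternating_cycle_decomposition:
  assumes "alternating_pair X a b"
  shows "\<exists>cs. (\<forall>c\<in>set cs. alternating_pair.alternating_cycle X a b c) \<and>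
    \<Union>(set ` set cs) = X \<and> sum_list (map length cs) = card X"
  using alternating_pair.finite_X[OF assms] assms
proof (induction X rule: finite_psubset_induct)
  case (psubset X)
  interpret alternating_pair X a b by (rule psubset.prems)
  show ?case
  proof (cases "X = {}")
    case True
    then show ?thesis by (intro exI[of _ "[]"]) simp
  next
    case False
    then obtain c where c: "alternating_cycle c" using exists_alternating_cycle by blast
    then have cX: "set c \<subseteq> X" "c \<noteq> []" "distinct c" by (auto simp: alternating_cycle_def)
    have rest: "a x \<in> X - set c" "b x \<in> X - set c" if "x \<in> X - set c" for x
      using that a(1,2) b(1,2) alternating_cycle_closed[OF c, of "a x"]
        alternating_cycle_closed[OF c, of "b x"] by auto
    have pair: "alternating_pair (X - set c) a b"
      by unfold_locales (use rest a b finite_X in auto)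
    have smaller: "X - set c \<subset> X" using cX by (cases c) auto
    obtain cs where cs: "\<forall>d\<in>set cs. alternating_pair.alternating_cycle (X - set c) a b d"
      "\<Union>(set ` set cs) = X - set c" "sum_list (map length cs) = card (X - set c)"
      using psubset.IH[OF smaller pair] by (elim exE conjE) (rule that)
    have "\<forall>d\<in>set (c # cs). alternating_cycle d"
      using c cs(1) by (auto simp: alternating_cycle_def alternating_pair.alternating_cycle_def[OF pair])
    moreover have "\<Union>(set ` set (c # cs)) = X" using cs(2) cX(1) by auto
    moreover have "sum_list (map length (c # cs)) = card X"
      using cs(3) cX(1,3) card_Diff_subset[of "set c" X] card_mono[OF finite_X cX(1)]
      by (simp add: distinct_card)
    ultimately show ?thesis by blast
  qed
qed

definition even_partitions :: "nat \<Rightarrow> nat list set" where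
  "even_partitions n = {\<mu> \<in> partitions_of n. \<forall>p\<in>set \<mu>. even p}"

lemma even_shape_if_even_partition: "\<mu> \<in> even_partitions (2 * k) \<Longrightarrow> even_shape \<mu> k"
  by (auto simp: even_partitions_def partitions_of_def even_shape_def)

text \<open>The alternating cycles of the pair, in order of decreasing length, are the rows of \<open>t\<close>.\<close>
lemma matching_pair_tableau:
  assumes M: "M \<in> perfect_matchings k" and N: "N \<in> perfect_matchings k"
  shows "\<exists>\<mu> t. \<mu> \<in> even_partitions (2 * k) \<and> tableau \<mu> t \<and> row_matching \<mu> t = M \<and>
    row_matching \<mu> (t \<circ> rotate_rows \<mu>) = N"
proof -
  let ?X = "{1..2 * k}"
  note One_nat_def [simp del]
  obtain a where a: "\<And>x. x \<in> ?X \<Longrightarrow> a x \<in> ?X" "\<And>x. x \<in> ?X \<Longrightarrow> a (a x) = x" "\<And>x. x \<in> ?X \<Longrightarrow> a x \<noteq> x"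
    and M_a: "M = {{x, a x} |x. x \<in> ?X}"
    using perfect_matching_partner[OF M] by blast
  obtain b where b: "\<And>x. x \<in> ?X \<Longrightarrow> b x \<in> ?X" "\<And>x. x \<in> ?X \<Longrightarrow> b (b x) = x" "\<And>x. x \<in> ?X \<Longrightarrow> b x \<noteq> x"
    and N_b: "N = {{x, b x} |x. x \<in> ?X}"
    using perfect_matching_partner[OF N] by blast
  interpret alternating_pair ?X a b by unfold_locales (use a b in auto)
  obtain cs0 where cs0: "\<forall>c\<in>set cs0. alternating_cycle c" "\<Union>(set ` set cs0) = ?X"
      "sum_list (map length cs0) = 2 * k"
    using alternating_cycle_decomposition[OF alternating_pair_axioms] by auto
  define cs where "cs = rev (sort_key length cs0)"
  have set_cs: "set cs = set cs0" by (simp add: cs_def)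
  have "mset (map length cs) = mset (map length cs0)" by (simp add: cs_def)
  then have sum_cs: "sum_list (map length cs) = 2 * k" using cs0(3) by (metis sum_mset_sum_list)
  define \<mu> where "\<mu> = map length cs"
  define t where "t = (\<lambda>(i, j). cs ! i ! j)"
  have cyc: "alternating_cycle (cs ! i)" if "i < length cs" for i
    using cs0(1) that nth_mem[of i cs] unfolding set_cs by blast
  have mem: "(i, j) \<in> diagram \<mu> \<longleftrightarrow> i < length cs \<and> j < length (cs ! i)" for i j
    by (auto simp: \<mu>_def mem_diagram)
  have \<mu>_nth: "\<mu> ! i = length (cs ! i)" if "i < length cs" for i using that by (simp add: \<mu>_def)
  have "sorted_wrt (\<ge>) \<mu>"
    unfolding \<mu>_def cs_def rev_map[symmetric] sorted_wrt_rev by (simp add: sorted_sort_key)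
  moreover have "\<forall>p\<in>set \<mu>. p \<noteq> 0 \<and> even p"
    using cs0(1) by (auto simp: \<mu>_def set_cs alternating_cycle_def)
  ultimately have \<mu>: "\<mu> \<in> even_partitions (2 * k)"
    using sum_cs by (auto simp: even_partitions_def partitions_of_def \<mu>_def)
  interpret shape: even_shape \<mu> k by (rule even_shape_if_even_partition[OF \<mu>])
  have im: "t ` diagram \<mu> = ?X"
  proof -
    have "t ` diagram \<mu> = \<Union>(set ` set cs)"
    proof (intro equalityI subsetI)
      fix x assume "x \<in> \<Union>(set ` set cs)"
      then obtain i j where "i < length cs" "j < length (cs ! i)" "x = cs ! i ! j"
        by (auto simp: in_set_conv_nth)
      then show "x \<in> t ` diagram \<mu>" using mem by (intro image_eqI[of _ _ "(i, j)"]) (auto simp: t_def)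
    qed (auto simp: t_def mem intro!: bexI[OF _ nth_mem])
    then show ?thesis using cs0(2) set_cs by simp
  qed
  have t: "tableau \<mu> t"
    unfolding tableau_def bij_betw_def shape.size
    using im by (intro conjI eq_card_imp_inj_on finite_diagram) (simp_all add: card_diagram shape.size)
  have t_a: "a (t (i, j)) = t (i, Suc j)" if "even j" "(i, j) \<in> diagram \<mu>" for i j
    using that cyc[of i] by (auto simp: mem t_def alternating_cycle_def)
  have t_b: "b (t (i, j)) = t (rotate_rows \<mu> (i, j))" if "odd j" "(i, j) \<in> diagram \<mu>" for i j
    using that cyc[of i] by (auto simp: mem t_def alternating_cycle_def rotate_rows_def \<mu>_nth)
  have eq_edges: "row_matching \<mu> u = K"
    if K: "K \<in> perfect_matchings k" and u: "tableau \<mu> u"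
      and sub: "\<And>i j. even j \<Longrightarrow> (i, j) \<in> diagram \<mu> \<Longrightarrow> {u (i, j), u (i, Suc j)} \<in> K" for u K
  proof (rule card_subset_eq)
    show "row_matching \<mu> u \<subseteq> K" using sub by (auto simp: row_matching_def)
    show "finite K" "card (row_matching \<mu> u) = card K"
      using K shape.row_matching_perfect[OF u] by (simp_all add: matchings_def)
  qed
  have "row_matching \<mu> t = M"
  proof (rule eq_edges[OF M t])
    fix i j assume ij: "even j" "(i, j) \<in> diagram \<mu>"
    have "t (i, j) \<in> ?X" using ij(2) unfolding im[symmetric] by (rule imageI)
    then have "{t (i, j), a (t (i, j))} \<in> M" unfolding M_a by blast
    then show "{t (i, j), t (i, Suc j)} \<in> M" by (simp add: t_a[OF ij])
  qed
  moreover have "row_matching \<mu> (t \<circ> rotate_rows \<mu>) = N"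
  proof (rule eq_edges[OF N shape.tableau_rotate[OF t]])
    fix i j assume ij: "even j" "(i, j) \<in> diagram \<mu>"
    have S: "(i, Suc j) \<in> diagram \<mu>" by (rule shape.Suc_in_diagram[OF ij])
    then have "rotate_rows \<mu> (i, j) = (i, Suc j)" by (simp add: rotate_rows_def mem_diagram)
    then have "{(t \<circ> rotate_rows \<mu>) (i, j), (t \<circ> rotate_rows \<mu>) (i, Suc j)} = {t (i, Suc j), b (t (i, Suc j))}"
      using t_b[OF _ S] ij(1) by simp
    moreover have "t (i, Suc j) \<in> ?X" using S unfolding im[symmetric] by (rule imageI)
    then have "{t (i, Suc j), b (t (i, Suc j))} \<in> N" unfolding N_b by blast
    ultimately show "{(t \<circ> rotate_rows \<mu>) (i, j), (t \<circ> rotate_rows \<mu>) (i, Suc j)} \<in> N"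
      by simp
  qed
  ultimately show ?thesis using \<mu> t by blast
qed

section \<open>The decomposition of the matching module\<close>
lemma finite_partitions_of: "finite (partitions_of n)"
proof (rule finite_subset)
  show "partitions_of n \<subseteq> {\<mu>. set \<mu> \<subseteq> {..n} \<and> length \<mu> \<le> n}"
  proof
    fix \<mu> assume \<mu>: "\<mu> \<in> partitions_of n"
    have "length \<mu> = sum_list (map (\<lambda>_. 1) \<mu>)" by (simp add: sum_list_triv)
    also have "\<dots> \<le> sum_list (map (\<lambda>p. p) \<mu>)"
      using \<mu> by (intro sum_list_mono) (metis (mono_tags, lifting) One_nat_def Suc_leI mem_Collect_eq neq0_conv partitions_of_def)
    finally show "\<mu> \<in> {\<mu>. set \<mu> \<subseteq> {..n} \<and> length \<mu> \<le> n}"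
      using \<mu> member_le_sum_list[of _ \<mu>] by (auto simp: partitions_of_def)
  qed
  show "finite {\<mu>. set \<mu> \<subseteq> {..n} \<and> length \<mu> \<le> n}" by (rule finite_lists_length_le) simp
qed

text \<open>A permutation that carries a tableau \<open>t\<close> to a tableau \<open>u\<close> of the same even shape carries the pair of
matchings read off from \<open>t\<close> to the pair read off from \<open>u\<close> (\<open>move\<close>). Applied to pairs that begin with
the base matching it shows that the shape determines the orbit under the stabilizer; applied to \<open>t\<close> and
its rotation, which carries the first matching of the pair to the second, it shows transitivity.\<close>
theorem matching_module_distinct_summands:
  "\<exists>\<phi>. distinct_summands (sym_group (2 * k)) (perm_rep (perfect_matchings k) matching_act)
    (even_partitions (2 * k)) specht \<phi>"
proof -
  let ?G = "sym_group (2 * k)" and ?S = "perfect_matchings k" and ?\<Lambda> = "even_partitions (2 * k)"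
  interpret S: perm_action ?G ?S matching_act by (rule perm_action_matchings)
  have shape: "even_shape \<mu> k" "sum_list \<mu> = 2 * k" "sorted_wrt (\<ge>) \<mu>" "\<mu> \<in> partitions_of (2 * k)" if "\<mu> \<in> ?\<Lambda>" for \<mu>
    using that even_shape_if_even_partition by (auto simp: even_partitions_def partitions_of_def)
  have tab: "perm_action ?G (tabloids \<mu>) tabloid_act" if "\<mu> \<in> ?\<Lambda>" for \<mu>
    using perm_action_tabloids[of \<mu>] shape(2)[OF that] by simp
  define \<phi> where "\<phi> \<mu> = incidence_hom (tabloids \<mu>) ?S in_rows" for \<mu>
  have constituents: "distinct_constituents ?G (perm_rep ?S matching_act) ?\<Lambda> specht \<phi>"
  proof
    show "is_rep ?G (perm_rep ?S matching_act)" by (rule S.is_rep)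
    show "finite ?\<Lambda>" using finite_partitions_of by (simp add: even_partitions_def)
    show "irreducible_rep ?G (specht \<mu>)" if "\<mu> \<in> ?\<Lambda>" for \<mu>
      using irreducible_specht[OF shape(3)[OF that]] shape(2)[OF that] by simp
    show "\<not> rep_iso ?G (specht \<mu>) (specht \<nu>)" if "\<mu> \<in> ?\<Lambda>" "\<nu> \<in> ?\<Lambda>" "\<mu> \<noteq> \<nu>" for \<mu> \<nu>
      using specht_iso_imp_eq shape(4) that by blast
    show "rep_hom ?G (specht \<mu>) (perm_rep ?S matching_act) (\<phi> \<mu>)" if "\<mu> \<in> ?\<Lambda>" for \<mu>
    proof -
      have incl: "rep_hom ?G (specht \<mu>) (tabloid_rep \<mu>) (\<lambda>v. v)"
        using rep_hom_specht_inclusion[of \<mu>] shape(2)[OF that] by simp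
      have "rep_hom ?G (tabloid_rep \<mu>) (perm_rep ?S matching_act) (\<phi> \<mu>)"
        unfolding \<phi>_def
        by (rule rep_hom_incidence_hom[OF tab[OF that] S.perm_action_axioms]) (rule in_rows_act)
      from rep_hom_comp[OF incl this] show ?thesis by simp
    qed
    show "\<exists>v\<in>rep_space (specht \<mu>). \<phi> \<mu> v \<noteq> 0" if "\<mu> \<in> ?\<Lambda>" for \<mu>
      using exists_tableau[of \<mu>] polytabloid_in_specht
        even_shape.incidence_hom_polytabloid_nonzero[OF shape(1)[OF that]] unfolding \<phi>_def by blast
  qed
  \<comment> \<open>Any matching can serve as the base point; the one-row tableau provides one.\<close>
  obtain M\<^sub>0 where M0: "M\<^sub>0 \<in> ?S"
  proof -
    have "even_shape [2 * k] k" by (simp add: even_shape_def)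
    then show ?thesis using exists_tableau[of "[2 * k]"] even_shape.row_matching_perfect that by blast
  qed
  have move: "\<exists>\<pi>\<in>carrier ?G. matching_act \<pi> (row_matching \<mu> t) = row_matching \<mu> u \<and>
      matching_act \<pi> (row_matching \<mu> (t \<circ> rotate_rows \<mu>)) = row_matching \<mu> (u \<circ> rotate_rows \<mu>)"
    if \<mu>: "\<mu> \<in> ?\<Lambda>" and t: "tableau \<mu> t" and u: "tableau \<mu> u" for \<mu> t u
  proof -
    interpret even_shape \<mu> k by (rule shape(1)[OF \<mu>])
    obtain \<pi> where \<pi>: "\<pi> permutes {1..sum_list \<mu>}" "\<And>c. c \<in> diagram \<mu> \<Longrightarrow> \<pi> (t c) = u c"
      using tableau_transitive[OF t u] by blast
    have "row_matching \<mu> (\<pi> \<circ> t) = row_matching \<mu> u" by (rule row_matching_cong) (simp add: \<pi>(2))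
    moreover have "row_matching \<mu> (\<pi> \<circ> (t \<circ> rotate_rows \<mu>)) = row_matching \<mu> (u \<circ> rotate_rows \<mu>)"
      using bij_betwE[OF rotate_rows_bij] by (intro row_matching_cong) (simp add: \<pi>(2))
    moreover have "\<pi> \<in> carrier ?G" using \<pi>(1) size by (simp add: sym_group_carrier)
    ultimately show ?thesis unfolding matching_act_row_matching by blast
  qed
  interpret transitive_perm_action ?G ?S matching_act M\<^sub>0
  proof
    show "finite (carrier ?G)" by (simp add: sym_group_def finite_permutations)
    show "M\<^sub>0 \<in> ?S" by (rule M0)
    fix N assume N: "N \<in> ?S"
    then obtain \<mu> t where t: "\<mu> \<in> ?\<Lambda>" "tableau \<mu> t" "row_matching \<mu> t = M\<^sub>0"
      "row_matching \<mu> (t \<circ> rotate_rows \<mu>) = N"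
      using matching_pair_tableau[OF M0] by blast
    then show "\<exists>\<pi>\<in>carrier ?G. matching_act \<pi> M\<^sub>0 = N"
      using move[OF t(1,2) even_shape.tableau_rotate[OF shape(1)[OF t(1)] t(2)]] by metis
  qed
  obtain label where label: "\<And>N. N \<in> ?S \<Longrightarrow> label N \<in> ?\<Lambda> \<and> (\<exists>t. tableau (label N) t \<and>
      row_matching (label N) t = M\<^sub>0 \<and> row_matching (label N) (t \<circ> rotate_rows (label N)) = N)"
    using matching_pair_tableau[OF M0] by metis
  have "distinct_summands ?G (perm_rep ?S matching_act) ?\<Lambda> specht \<phi>"
  proof (rule distinct_summands_of_few_orbits[OF constituents, of label])
    show "label N \<in> ?\<Lambda>" if "N \<in> ?S" for N using label[OF that] by blast
    fix N N' assume N: "N \<in> ?S" and N': "N' \<in> ?S" and eq: "label N = label N'"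
    obtain t where t: "tableau (label N) t" "row_matching (label N) t = M\<^sub>0"
      "row_matching (label N) (t \<circ> rotate_rows (label N)) = N" using label[OF N] by blast
    obtain u where u: "tableau (label N) u" "row_matching (label N) u = M\<^sub>0"
      "row_matching (label N) (u \<circ> rotate_rows (label N)) = N'" using label[OF N'] unfolding eq by blast
    show "\<exists>h\<in>stab. matching_act h N = N'"
      using move[OF _ t(1) u(1)] label[OF N] unfolding t(2,3) u(2,3) stab_def by blast
  qed
  then show ?thesis by blast
qed

theorem lemma3p1:
  fixes k :: nat
  assumes "k > 0"
  defines "G \<equiv> sym_group (2 * k)"
    and "CS \<equiv> perm_rep (matchings k (complete_graph_edges (2 * k))) matching_act"
    and "\<Lambda> \<equiv> {\<mu> \<in> partitions_of (2 * k). \<forall>p\<in>set \<mu>. even p}"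
  shows "rep_iso G CS (direct_sum \<Lambda> specht) \<and> (\<forall>\<mu>\<in>\<Lambda>. multiplicity G CS (specht \<mu>) = 1)"
proof -
  have \<Lambda>: "\<Lambda> = even_partitions (2 * k)" by (simp add: \<Lambda>_def even_partitions_def)
  obtain \<phi> where "distinct_summands G CS \<Lambda> specht \<phi>"
    using matching_module_distinct_summands unfolding G_def CS_def \<Lambda> by blast
  then interpret distinct_summands G CS \<Lambda> specht \<phi> .
  show ?thesis using rep_iso_direct_sum multiplicity_summand by blast
qed

end
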